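(* Let $\Omega\subset\mathbb{R}^m$ be a bounded domain with infinitely smooth boundary and let $\widehat{L}$ be the maximal operator generated by the Laplace operator $-\Delta$ in $L_2(\Omega)$. Let $L$ be a well-defined restriction of $\widehat{L}$ such that $L^{-1}$ is a non-negative compact operator and, for some slowly varying function $\ell$ and some $a$ with $0<a<\infty$, $\lim_{n\to\infty}\frac{1}{\ell(n)}s_n(L^{-1})=a$. Let $K$ be a bounded linear operator in $L_2(\Omega)$ with $R(K)\subset\mathrm{Ker}\,\widehat{L}$ and $K\in\mathfrak{S}_q(L_2(\Omega))$ for some $q$ with $0<q<\infty$, and let $L_K$ be the well-defined restriction of $\widehat{L}$ with inverse $$L_K^{-1}f=L^{-1}f+Kf,\quad f\in L_2(\Omega).$$ Then $L_K^{-1}$ is not a Volterra operator, i.e. $L_K$ is a non-Volterra well-defined restriction of the maximal operator $\widehat{L}$.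
   Context: $L_2(\Omega)$ is the complex Hilbert space of square-integrable functions. $R(\cdot)$ and $\mathrm{Ker}$ denote range and kernel, $D(\cdot)$ domain. The minimal operator $L_0$ is the closure in $L_2(\Omega)$ of $-\Delta$ with domain $C_0^\infty(\Omega)$; the maximal operator $\widehat{L}$ is the adjoint of $L_0$, i.e. $\widehat{L}u=-\Delta u$ with $D(\widehat{L})=\{u\in L_2(\Omega):\ \Delta u\in L_2(\Omega)\}$. A closed linear operator $L$ in a Hilbert space is called well defined if it has a bounded inverse $L^{-1}$ defined on the whole space; a well-defined restriction of $\widehat{L}$ is a well-defined operator $L$ with $L\subset\widehat{L}$ (i.e. $D(L)\subset D(\widehat{L})$ and $Lf=\widehat{L}f$ on $D(L)$). The domain of $L_K$ is $D(L_K)=\{u\in D(\widehat{L}):\ (I-K\widehat{L})u\in D(L)\}$. For a compact operator $T$, the $s$-numbers $s_n(T)$, $n=1,2,\dots$, are the eigenvalues of $(T^*T)^{1/2}$, counted with multiplicity, in non-increasing order; for $0<p<\infty$, $\mathfrak{S}_p(H)$ is the set of compact operators $T$ in $H$ with $\sum_j s_j^p(T)<\infty$. A non-negative operator is a self-adjoint operator $C$ with $(Cf,f)\ge0$ for all $f$. A function $\ell(x)$, $b\le x<\infty$ (with some $b>0$), is called slowly varying if it is positive and continuously differentiable and $\lim_{x\to\infty}\frac{x\,\ell'(x)}{\ell(x)}=0$. A Volterra operator is a compact operator whose spectrum is $\{0\}$; a well-defined operator $L$ is called Volterra if $L^{-1}$ is a Volterra operator. *)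

theory Defs
  imports "HOL-Analysis.Analysis"
begin

section \<open>Complex inner product spaces\<close>

text \<open>
  The inner product \<open>cinner\<close> is linear in the first and conjugate-linear in the second argument.
  Its real part is the inner product of the underlying real space, so norm, distance and topology
  are those of \<open>real_inner\<close>.
\<close>

class complex_inner = real_inner +
  fixes scaleC :: "complex \<Rightarrow> 'a \<Rightarrow> 'a" (infixr \<open>*\<^sub>C\<close> 75)
    and cinner :: "'a \<Rightarrow> 'a \<Rightarrow> complex"
  assumes scaleC_add_right: "c *\<^sub>C (x + y) = c *\<^sub>C x + c *\<^sub>C y"
    and scaleC_add_left: "(c + d) *\<^sub>C x = c *\<^sub>C x + d *\<^sub>C x"
    and scaleC_scaleC: "c *\<^sub>C d *\<^sub>C x = (c * d) *\<^sub>C x"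
    and scaleC_of_real: "complex_of_real r *\<^sub>C x = r *\<^sub>R x"
    and cinner_commute: "cinner x y = cnj (cinner y x)"
    and cinner_add_left: "cinner (x + y) z = cinner x z + cinner y z"
    and cinner_scaleC_left: "cinner (c *\<^sub>C x) y = c * cinner x y"
    and Re_cinner: "Re (cinner x y) = inner x y"

global_interpretation complex_vector: vector_space "scaleC :: complex \<Rightarrow> 'a \<Rightarrow> 'a::complex_inner"
  by unfold_locales
    (simp_all add: scaleC_add_right scaleC_add_left scaleC_scaleC
      scaleC_of_real[of 1, simplified])


section \<open>Linear operators in a Hilbert space\<close>

text \<open>
  A Hilbert space is given as a subset \<open>H\<close> of a type of class \<open>complex_inner\<close> (below: \<open>H = L2_on \<Omega>\<close>).
  A possibly unbounded operator in \<open>H\<close> is identified with its graph \<open>T \<subseteq> H \<times> H\<close>. Thus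
  \<open>Domain T\<close> and \<open>Range T\<close> are domain and range, \<open>S \<subseteq> T\<close> says that \<open>S\<close> is a restriction of \<open>T\<close>,
  \<open>T\<inverse>\<close> is the inverse, and the product \<open>A B\<close> (first \<open>B\<close>, then \<open>A\<close>) is \<open>B O A\<close>.
\<close>

definition linear_operator :: "'h::complex_inner set \<Rightarrow> 'h rel \<Rightarrow> bool" where
  "linear_operator H T \<longleftrightarrow> T \<subseteq> H \<times> H \<and> single_valued T \<and> (0, 0) \<in> T \<and>
     (\<forall>f g f' g'. (f, g) \<in> T \<longrightarrow> (f', g') \<in> T \<longrightarrow> (f + f', g + g') \<in> T) \<and>
     (\<forall>c f g. (f, g) \<in> T \<longrightarrow> (c *\<^sub>C f, c *\<^sub>C g) \<in> T)"

definition bounded_operator :: "'h::complex_inner set \<Rightarrow> 'h rel \<Rightarrow> bool" where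
  "bounded_operator H T \<longleftrightarrow> linear_operator H T \<and> Domain T = H \<and>
     (\<exists>c. \<forall>(f, g) \<in> T. norm g \<le> c * norm f)"

definition compact_operator :: "'h::complex_inner set \<Rightarrow> 'h rel \<Rightarrow> bool" where
  "compact_operator H T \<longleftrightarrow> bounded_operator H T \<and> compact (closure (T `` (H \<inter> cball 0 1)))"

definition op_kernel :: "'h::complex_inner rel \<Rightarrow> 'h set" where
  "op_kernel T = {f. (f, 0) \<in> T}"

definition op_add :: "'h::complex_inner rel \<Rightarrow> 'h rel \<Rightarrow> 'h rel" where
  "op_add S T = {(f, g + h) | f g h. (f, g) \<in> S \<and> (f, h) \<in> T}"

definition adjoint_in :: "'h::complex_inner set \<Rightarrow> 'h rel \<Rightarrow> 'h rel" where
  "adjoint_in H T = {(u, w) \<in> H \<times> H. \<forall>(f, g) \<in> T. cinner g u = cinner f w}"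

definition nonneg_operator :: "'h::complex_inner set \<Rightarrow> 'h rel \<Rightarrow> bool" where
  "nonneg_operator H C \<longleftrightarrow> linear_operator H C \<and> adjoint_in H C = C \<and>
     (\<forall>(f, g) \<in> C. cinner g f \<in> \<real>\<^sub>\<ge>\<^sub>0)"

text \<open>The operator $(T^*T)^{1/2}$ for bounded \<open>T\<close>.\<close>

definition modulus :: "'h::complex_inner set \<Rightarrow> 'h rel \<Rightarrow> 'h rel" where
  "modulus H T =
     (THE R. bounded_operator H R \<and> nonneg_operator H R \<and> R O R = T O adjoint_in H T)"

definition eigenspace :: "'h::complex_inner rel \<Rightarrow> complex \<Rightarrow> 'h set" where
  "eigenspace T \<mu> = {f. (f, \<mu> *\<^sub>C f) \<in> T}"

text \<open>
  \<open>s 0 \<ge> s 1 \<ge> \<dots>\<close> lists the eigenvalues of a compact non-negative operator with multiplicity;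
  if there are only finitely many positive ones, the list is continued by zeros.
  The finiteness condition is needed because \<open>card\<close> is \<open>0\<close> on infinite sets.
\<close>

definition enumerates_eigenvalues :: "'h::complex_inner rel \<Rightarrow> (nat \<Rightarrow> real) \<Rightarrow> bool" where
  "enumerates_eigenvalues A s \<longleftrightarrow> decseq s \<and> (\<forall>n. s n \<ge> 0) \<and>
     (\<forall>\<mu>>0. finite {n. s n = \<mu>} \<and>
        card {n. s n = \<mu>} = complex_vector.dim (eigenspace A (complex_of_real \<mu>)))"

text \<open>The \<open>s\<close>-numbers are indexed by \<open>n = 1, 2, \<dots>\<close>; the value at \<open>n = 0\<close> is irrelevant.\<close>

definition s_number :: "'h::complex_inner set \<Rightarrow> 'h rel \<Rightarrow> nat \<Rightarrow> real" where
  "s_number H T n = (THE s. enumerates_eigenvalues (modulus H T) s) (n - 1)"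

definition schatten_class :: "'h::complex_inner set \<Rightarrow> real \<Rightarrow> 'h rel set" where
  "schatten_class H p =
     {T. compact_operator H T \<and> summable (\<lambda>j. s_number H T (Suc j) powr p)}"

text \<open>Closed linear operators with a bounded inverse defined on all of \<open>H\<close>.\<close>

definition well_defined :: "'h::complex_inner set \<Rightarrow> 'h rel \<Rightarrow> bool" where
  "well_defined H L \<longleftrightarrow> linear_operator H L \<and> closed L \<and> bounded_operator H (L\<inverse>)"

text \<open>\<open>\<mu>\<close> is in the spectrum iff $T - \mu I$ has no bounded everywhere defined inverse.\<close>

definition spectrum_in :: "'h::complex_inner set \<Rightarrow> 'h rel \<Rightarrow> complex set" where
  "spectrum_in H T = {\<mu>. \<not> well_defined H {(f, g - \<mu> *\<^sub>C f) | f g. (f, g) \<in> T}}"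

definition volterra :: "'h::complex_inner set \<Rightarrow> 'h rel \<Rightarrow> bool" where
  "volterra H T \<longleftrightarrow> compact_operator H T \<and> spectrum_in H T = {0}"

definition volterra_well_defined :: "'h::complex_inner set \<Rightarrow> 'h rel \<Rightarrow> bool" where
  "volterra_well_defined H L \<longleftrightarrow> well_defined H L \<and> volterra H (L\<inverse>)"


section \<open>The space of square-integrable functions\<close>

definition square_integrable :: "('a::euclidean_space \<Rightarrow> complex) \<Rightarrow> bool" where
  "square_integrable f \<longleftrightarrow>
     f \<in> borel_measurable lebesgue \<and> integrable lebesgue (\<lambda>x. (cmod (f x))\<^sup>2)"

definition L2_eq :: "('a::euclidean_space \<Rightarrow> complex) \<Rightarrow> ('a \<Rightarrow> complex) \<Rightarrow> bool" where
  "L2_eq f g \<longleftrightarrow> square_integrable f \<and> square_integrable g \<and> (AE x in lebesgue. f x = g x)"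

lemma square_integrable_zero: "square_integrable (\<lambda>x. 0)"
  by (simp add: square_integrable_def)

lemma square_integrable_scale:
  "square_integrable f \<Longrightarrow> square_integrable (\<lambda>x. c * f x)"
  by (auto simp: square_integrable_def norm_mult power_mult_distrib)

lemma square_integrable_add:
  assumes "square_integrable f" "square_integrable g"
  shows "square_integrable (\<lambda>x. f x + g x)"
proof -
  have m: "(\<lambda>x. f x + g x) \<in> borel_measurable lebesgue"
    using assms unfolding square_integrable_def by (intro borel_measurable_add) blast+
  have bound: "(cmod (u + v))\<^sup>2 \<le> 2 * (cmod u)\<^sup>2 + 2 * (cmod v)\<^sup>2" for u v
  proof -
    have "(cmod (u + v))\<^sup>2 \<le> (cmod u + cmod v)\<^sup>2"
      by (intro power_mono norm_triangle_ineq norm_ge_zero)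
    also have "\<dots> \<le> 2 * (cmod u)\<^sup>2 + 2 * (cmod v)\<^sup>2"
      using sum_squares_bound[of "cmod u" "cmod v"] by (simp add: power2_sum)
    finally show ?thesis .
  qed
  have "integrable lebesgue (\<lambda>x. (cmod (f x + g x))\<^sup>2)"
  proof (rule Bochner_Integration.integrable_bound)
    show "integrable lebesgue (\<lambda>x. 2 * (cmod (f x))\<^sup>2 + 2 * (cmod (g x))\<^sup>2)"
      using assms unfolding square_integrable_def
      by (intro Bochner_Integration.integrable_add integrable_mult_right) blast+
    show "(\<lambda>x. (cmod (f x + g x))\<^sup>2) \<in> borel_measurable lebesgue"
      using m by measurable
    show "AE x in lebesgue. norm ((cmod (f x + g x))\<^sup>2)
        \<le> norm (2 * (cmod (f x))\<^sup>2 + 2 * (cmod (g x))\<^sup>2)"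
      by (intro AE_I2) (simp add: bound)
  qed
  with m show ?thesis
    by (simp add: square_integrable_def)
qed

lemma integrable_mult_cnj:
  assumes "square_integrable f" "square_integrable g"
  shows "integrable lebesgue (\<lambda>x. f x * cnj (g x))"
proof (rule Bochner_Integration.integrable_bound)
  show "integrable lebesgue (\<lambda>x. (cmod (f x))\<^sup>2 + (cmod (g x))\<^sup>2)"
    using assms unfolding square_integrable_def
    by (intro Bochner_Integration.integrable_add) blast+
  have "(\<lambda>x. cnj (g x)) \<in> borel_measurable lebesgue"
    using assms(2) borel_measurable_continuous_onI[OF continuous_on_cnj[OF continuous_on_id]]
    unfolding square_integrable_def by (metis (no_types) measurable_compose)
  then show "(\<lambda>x. f x * cnj (g x)) \<in> borel_measurable lebesgue"
    using assms(1) unfolding square_integrable_def by (intro borel_measurable_times) blast+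
  have "cmod (u * cnj v) \<le> (cmod u)\<^sup>2 + (cmod v)\<^sup>2" for u v
  proof -
    have "2 * (cmod u * cmod v) \<le> (cmod u)\<^sup>2 + (cmod v)\<^sup>2"
      using sum_squares_bound[of "cmod u" "cmod v"] by simp
    moreover have "0 \<le> cmod u * cmod v" by simp
    ultimately show ?thesis unfolding norm_mult complex_mod_cnj by linarith
  qed
  then show "AE x in lebesgue. norm (f x * cnj (g x)) \<le> norm ((cmod (f x))\<^sup>2 + (cmod (g x))\<^sup>2)"
    by (intro AE_I2) simp
qed

text \<open>The space $L_2(\mathbb{R}^m)$; its members are classes of functions equal almost everywhere.\<close>

quotient_type (overloaded) 'a L2 = "'a::euclidean_space \<Rightarrow> complex" / partial: L2_eq
proof (rule part_equivpI)
  show "\<exists>x :: 'a \<Rightarrow> complex. L2_eq x x"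
    by (intro exI[of _ "\<lambda>x. 0"]) (simp add: L2_eq_def square_integrable_zero)
  show "symp (L2_eq :: ('a \<Rightarrow> complex) \<Rightarrow> _)"
    by (auto simp: symp_def L2_eq_def)
  show "transp (L2_eq :: ('a \<Rightarrow> complex) \<Rightarrow> _)"
    by (auto simp: transp_def L2_eq_def)
qed

instantiation L2 :: (euclidean_space) complex_inner
begin

lift_definition zero_L2 :: "'a L2" is "\<lambda>x. 0"
  by (simp add: L2_eq_def square_integrable_zero)

lift_definition scaleC_L2 :: "complex \<Rightarrow> 'a L2 \<Rightarrow> 'a L2" is "\<lambda>c f x. c * f x"
  by (auto simp: L2_eq_def intro: square_integrable_scale)

lift_definition plus_L2 :: "'a L2 \<Rightarrow> 'a L2 \<Rightarrow> 'a L2" is "\<lambda>f g x. f x + g x"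
  by (auto simp: L2_eq_def intro: square_integrable_add)

lift_definition cinner_L2 :: "'a L2 \<Rightarrow> 'a L2 \<Rightarrow> complex"
  is "\<lambda>f g. LINT x|lebesgue. f x * cnj (g x)"
proof (rule integral_cong_AE)
  fix f f' g g' :: "'a \<Rightarrow> complex"
  assume "L2_eq f f'" "L2_eq g g'"
  then have "square_integrable f" "square_integrable f'" "square_integrable g" "square_integrable g'"
    and "AE x in lebesgue. f x = f' x" "AE x in lebesgue. g x = g' x"
    by (auto simp: L2_eq_def)
  then show "(\<lambda>x. f x * cnj (g x)) \<in> borel_measurable lebesgue"
    and "(\<lambda>x. f' x * cnj (g' x)) \<in> borel_measurable lebesgue"
    and "AE x in lebesgue. f x * cnj (g x) = f' x * cnj (g' x)"
    by (simp_all add: borel_measurable_integrable integrable_mult_cnj) auto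
qed

definition scaleR_L2 :: "real \<Rightarrow> 'a L2 \<Rightarrow> 'a L2" where
  "scaleR_L2 r f = complex_of_real r *\<^sub>C f"

definition uminus_L2 :: "'a L2 \<Rightarrow> 'a L2" where
  "uminus_L2 f = (- 1) *\<^sub>C f"

definition minus_L2 :: "'a L2 \<Rightarrow> 'a L2 \<Rightarrow> 'a L2" where
  "minus_L2 f g = f + - g"

definition inner_L2 :: "'a L2 \<Rightarrow> 'a L2 \<Rightarrow> real" where
  "inner_L2 f g = Re (cinner f g)"

definition norm_L2 :: "'a L2 \<Rightarrow> real" where
  "norm_L2 f = sqrt (inner f f)"

definition sgn_L2 :: "'a L2 \<Rightarrow> 'a L2" where
  "sgn_L2 f = inverse (norm f) *\<^sub>R f"

definition dist_L2 :: "'a L2 \<Rightarrow> 'a L2 \<Rightarrow> real" where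
  "dist_L2 f g = norm (f - g)"

definition uniformity_L2 :: "('a L2 \<times> 'a L2) filter" where
  "uniformity_L2 = (INF e\<in>{0<..}. principal {(x, y). dist x y < e})"

definition open_L2 :: "'a L2 set \<Rightarrow> bool" where
  "open_L2 U = (\<forall>x\<in>U. \<forall>\<^sub>F (x', y) in uniformity. x' = x \<longrightarrow> y \<in> U)"

instance
proof
  fix x y z :: "'a L2" and c d :: complex and r s :: real
  show add_assoc: "x + y + z = x + (y + z)" for x y z :: "'a L2"
    by transfer (auto simp: L2_eq_def add.assoc intro!: square_integrable_add)
  show add_comm: "x + y = y + x" for x y :: "'a L2"
    by transfer (auto simp: L2_eq_def add.commute intro!: square_integrable_add)
  show "0 + x = x"
    by transfer (auto simp: L2_eq_def)
  show "- x + x = 0"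
    unfolding uminus_L2_def
    by transfer (auto simp: L2_eq_def square_integrable_zero)
  show "x - y = x + - y"
    by (simp add: minus_L2_def)
  show C1: "c *\<^sub>C (x + y) = c *\<^sub>C x + c *\<^sub>C y" for c and x y :: "'a L2"
    by transfer
      (auto simp: L2_eq_def algebra_simps
        intro!: square_integrable_add square_integrable_scale)
  show C2: "(c + d) *\<^sub>C x = c *\<^sub>C x + d *\<^sub>C x" for c d and x :: "'a L2"
    by transfer
      (auto simp: L2_eq_def distrib_right
        intro!: square_integrable_add square_integrable_scale)
  show C3: "c *\<^sub>C d *\<^sub>C x = (c * d) *\<^sub>C x" for c d and x :: "'a L2"
    by transfer (auto simp: L2_eq_def mult.assoc intro!: square_integrable_scale)
  show "complex_of_real r *\<^sub>C x = r *\<^sub>R x"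
    by (simp add: scaleR_L2_def)
  show "r *\<^sub>R (x + y) = r *\<^sub>R x + r *\<^sub>R y"
    by (simp add: scaleR_L2_def C1)
  show "(r + s) *\<^sub>R x = r *\<^sub>R x + s *\<^sub>R x"
    by (simp add: scaleR_L2_def C2)
  show "r *\<^sub>R s *\<^sub>R x = (r * s) *\<^sub>R x"
    by (simp add: scaleR_L2_def C3)
  show "1 *\<^sub>R x = x"
    unfolding scaleR_L2_def by transfer (auto simp: L2_eq_def)
  show comm: "cinner x y = cnj (cinner y x)" for x y :: "'a L2"
    by transfer (simp add: mult.commute flip: Bochner_Integration.integral_cnj)
  show add: "cinner (x + y) z = cinner x z + cinner y z" for x y z :: "'a L2"
    by transfer
      (simp add: L2_eq_def distrib_right integrable_mult_cnj)
  show scale: "cinner (c *\<^sub>C x) y = c * cinner x y" for c and x y :: "'a L2"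
    by transfer (simp add: mult.assoc)
  show Re: "Re (cinner x y) = inner x y"
    by (simp add: inner_L2_def)
  show "inner x y = inner y x"
    using comm[of x y] by (simp add: inner_L2_def)
  show "inner (x + y) z = inner x z + inner y z"
    by (simp add: inner_L2_def add)
  show "inner (r *\<^sub>R x) y = r * inner x y"
    by (simp add: inner_L2_def scaleR_L2_def scale)
  have sq: "inner x x = (LINT t|lebesgue. (cmod (f t))\<^sup>2)"
    if "x = abs_L2 f" "square_integrable f" for x :: "'a L2" and f
  proof -
    have "cinner x x = (LINT t|lebesgue. f t * cnj (f t))"
      unfolding that(1)
      by (rule cinner_L2.abs_eq) (use that(2) in \<open>auto simp: L2_eq_def eq_onp_def\<close>)
    also have "\<dots> = (LINT t|lebesgue. complex_of_real ((cmod (f t))\<^sup>2))"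
      by (simp only: complex_norm_square)
    finally show ?thesis
      by (simp only: inner_L2_def integral_complex_of_real Re_complex_of_real)
  qed
  have "\<exists>f. x = abs_L2 f \<and> square_integrable f"
    by (induct x rule: L2.abs_induct) (auto simp: L2_eq_def)
  then obtain f where f: "x = abs_L2 f" "square_integrable f"
    by blast
  show "0 \<le> inner x x"
    unfolding sq[OF f] by simp
  show "inner x x = 0 \<longleftrightarrow> x = 0"
  proof -
    have "inner x x = 0 \<longleftrightarrow> (AE t in lebesgue. (cmod (f t))\<^sup>2 = 0)"
      unfolding sq[OF f] using f(2)
      by (intro integral_nonneg_eq_0_iff_AE) (auto simp: square_integrable_def)
    also have "\<dots> \<longleftrightarrow> L2_eq f (\<lambda>x. 0)"
      using f(2) by (auto simp: L2_eq_def square_integrable_zero)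
    also have "\<dots> \<longleftrightarrow> x = 0"
      using Quotient3_rel[OF Quotient3_L2, of f "\<lambda>x. 0"] f(2)
      by (simp add: f(1) zero_L2_def L2_eq_def square_integrable_zero)
    finally show ?thesis .
  qed
  show "norm x = sqrt (inner x x)"
    by (simp add: norm_L2_def)
qed (rule sgn_L2_def dist_L2_def uniformity_L2_def open_L2_def)+

end

text \<open>
  $L_2(\Omega)$, identified via extension by zero with the closed subspace of those elements of
  $L_2(\mathbb{R}^m)$ that vanish almost everywhere outside \<open>\<Omega>\<close>.
\<close>

definition L2_on :: "'a::euclidean_space set \<Rightarrow> 'a L2 set" where
  "L2_on \<Omega> =
     {abs_L2 f | f. square_integrable f \<and> (AE x in lebesgue. x \<notin> \<Omega> \<longrightarrow> f x = 0)}"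


section \<open>Smooth functions and domains with smooth boundary\<close>

definition partial_deriv :: "'a::euclidean_space \<Rightarrow> ('a \<Rightarrow> 'b::real_normed_vector) \<Rightarrow> 'a \<Rightarrow> 'b" where
  "partial_deriv i f x = frechet_derivative f (at x) i"

primrec C_k :: "nat \<Rightarrow> ('a::euclidean_space \<Rightarrow> 'b::real_normed_vector) \<Rightarrow> bool" where
  "C_k 0 f \<longleftrightarrow> continuous_on UNIV f"
| "C_k (Suc k) f \<longleftrightarrow> (\<forall>x. f differentiable (at x)) \<and> (\<forall>i\<in>Basis. C_k k (partial_deriv i f))"

definition smooth :: "('a::euclidean_space \<Rightarrow> 'b::real_normed_vector) \<Rightarrow> bool" where
  "smooth f \<longleftrightarrow> (\<forall>k. C_k k f)"

definition laplacian :: "('a::euclidean_space \<Rightarrow> 'b::real_normed_vector) \<Rightarrow> 'a \<Rightarrow> 'b" where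
  "laplacian f x = (\<Sum>i\<in>Basis. partial_deriv i (partial_deriv i f) x)"

definition bounded_domain :: "'a::euclidean_space set \<Rightarrow> bool" where
  "bounded_domain \<Omega> \<longleftrightarrow> \<Omega> \<noteq> {} \<and> open \<Omega> \<and> connected \<Omega> \<and> bounded \<Omega>"

text \<open>
  Near each boundary point \<open>\<Omega>\<close> is, in suitable orthonormal coordinates, the region above the graph
  of a smooth function \<open>\<gamma>\<close> of the coordinates orthogonal to the unit vector \<open>e\<close>.
\<close>

definition smooth_boundary :: "'a::euclidean_space set \<Rightarrow> bool" where
  "smooth_boundary \<Omega> \<longleftrightarrow>
     (\<forall>p\<in>frontier \<Omega>. \<exists>r>0. \<exists>e (\<gamma> :: 'a \<Rightarrow> real).
        norm e = 1 \<and> smooth \<gamma> \<and> (\<forall>x t. \<gamma> (x + t *\<^sub>R e) = \<gamma> x) \<and>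
        \<Omega> \<inter> ball p r = {x \<in> ball p r. \<gamma> x < inner x e})"


section \<open>The minimal and the maximal operator and their restrictions\<close>

definition test_function :: "'a::euclidean_space set \<Rightarrow> ('a \<Rightarrow> complex) \<Rightarrow> bool" where
  "test_function \<Omega> \<phi> \<longleftrightarrow> smooth \<phi> \<and>
     compact (closure {x. \<phi> x \<noteq> 0}) \<and> closure {x. \<phi> x \<noteq> 0} \<subseteq> \<Omega>"

definition minimal_operator :: "'a::euclidean_space set \<Rightarrow> 'a L2 rel" where
  "minimal_operator \<Omega> =
     closure {(abs_L2 \<phi>, abs_L2 (\<lambda>x. - laplacian \<phi> x)) | \<phi>. test_function \<Omega> \<phi>}"

definition maximal_operator :: "'a::euclidean_space set \<Rightarrow> 'a L2 rel" where
  "maximal_operator \<Omega> = adjoint_in (L2_on \<Omega>) (minimal_operator \<Omega>)"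

definition well_defined_restriction :: "'a::euclidean_space set \<Rightarrow> 'a L2 rel \<Rightarrow> bool" where
  "well_defined_restriction \<Omega> L \<longleftrightarrow>
     well_defined (L2_on \<Omega>) L \<and> L \<subseteq> maximal_operator \<Omega>"

text \<open>
  The operator $L_K$: the restriction of the maximal operator $\widehat{L}$ to
  $\{u \in D(\widehat{L}) : (I - K\widehat{L})u \in D(L)\}$.
\<close>

definition perturbed_restriction ::
  "'a::euclidean_space set \<Rightarrow> 'a L2 rel \<Rightarrow> 'a L2 rel \<Rightarrow> 'a L2 rel" where
  "perturbed_restriction \<Omega> L K =
     {(u, w) \<in> maximal_operator \<Omega>. \<exists>k. (w, k) \<in> K \<and> u - k \<in> Domain L}"


section \<open>Slowly varying functions\<close>

definition slowly_varying :: "real \<Rightarrow> (real \<Rightarrow> real) \<Rightarrow> bool" where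
  "slowly_varying b l \<longleftrightarrow> b > 0 \<and> (\<forall>x\<ge>b. l x > 0) \<and>
     (\<exists>l'. (\<forall>x\<ge>b. (l has_real_derivative l' x) (at x within {b..})) \<and>
        continuous_on {b..} l' \<and> ((\<lambda>x. x * l' x / l x) \<longlongrightarrow> 0) at_top)"

end

theory Submission
  imports Defs "HOL-Computational_Algebra.Fundamental_Theorem_Algebra"
begin

text \<open>
  Put \<open>A = L\<inverse>\<close> and suppose that \<open>V = A + K\<close> has no nonzero eigenvalue. Compress \<open>V\<close> to the span of
  the first \<open>N\<close> eigenvectors of \<open>A\<close> and triangularise the compression; by compactness its
  eigenvalues \<open>\<lambda>\<^sub>j\<close> tend uniformly to \<open>0\<close> as \<open>N \<rightarrow> \<infinity>\<close>. Let \<open>T\<close> be the strictly upper triangular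
  part of the compression. Since \<open>A\<close> is self-adjoint, \<open>T - T\<^sup>*\<close> is \<open>K - K\<^sup>*\<close> without its diagonal, so it is
  bounded in a Schatten class \<open>\<SS>\<^sub>p\<close>, \<open>p = 2, 4, 8, \<dots>\<close>, independently of \<open>N\<close>. In these classes
  \<open>T\<close> is bounded by \<open>T - T\<^sup>*\<close>. Hence the compression of \<open>A\<close> is the sum of an operator bounded
  in \<open>\<SS>\<^sub>p\<close> and one of arbitrarily small norm, and letting \<open>N \<rightarrow> \<infinity>\<close> gives \<open>s\<^sub>n(A) = O(n\<^bsup>-1/p\<^esup>)\<close>.
  This is impossible, because a slowly varying function decays more slowly than every power.
\<close>

section \<open>Complex inner products, projections and adjoints\<close>

text \<open>That a Volterra operator is controlled by its imaginary part in a Schatten class is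
  classical, but rests on triangular truncation along an infinite chain of invariant subspaces. In
  finite dimension a Schur basis replaces the chain, and constants independent of the dimension
  survive the limit. The price is that the compression of a Volterra operator has a diagonal, small
  in norm but without a uniform Schatten bound; only its imaginary part has one, being read off from
  the diagonal of \<open>K - adj K\<close>. Exponents are powers of two because the estimate is
  elementary for Hilbert-Schmidt operators, where squared matrix entries are added, and passes from
  p to 2p by squaring; every q lies below such a power. Approximation numbers carry the estimates
  because sums and products obey direct inequalities for them; the doubled indices cost only
  constant factors. Compressions see all of \<Omega>'s function space since A, being the inverse of
  an operator, is injective there. Density of test functions makes the maximal operator
  single-valued, which identifies the inverse of \<open>perturbed_restriction\<close>.\<close>

lemma cinner_add_right: "cinner x (y + z) = cinner x y + cinner x z"
  by (metis cinner_add_left cinner_commute complex_cnj_add)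

lemma cinner_scaleC_right: "cinner x (c *\<^sub>C y) = cnj c * cinner x y"
  by (metis cinner_commute cinner_scaleC_left complex_cnj_mult)

lemma cinner_zero_left [simp]: "cinner 0 x = 0"
  using cinner_add_left[of 0 0 x] by simp

lemma cinner_zero_right [simp]: "cinner x 0 = 0"
  using cinner_add_right[of x 0 0] by simp

lemma cinner_minus_left: "cinner (- x) y = - cinner x y"
  using cinner_add_left[of x "- x" y] by (simp add: eq_neg_iff_add_eq_0 add.commute)

lemma cinner_minus_right: "cinner x (- y) = - cinner x y"
  using cinner_add_right[of x y "- y"] by (simp add: eq_neg_iff_add_eq_0 add.commute)

lemma cinner_diff_left: "cinner (x - y) z = cinner x z - cinner y z"
  using cinner_add_left[of x "- y" z] by (simp add: cinner_minus_left)

lemma cinner_diff_right: "cinner x (y - z) = cinner x y - cinner x z"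
  using cinner_add_right[of x y "- z"] by (simp add: cinner_minus_right)

lemma cinner_sum_left: "cinner (\<Sum>i\<in>I. f i) x = (\<Sum>i\<in>I. cinner (f i) x)"
  by (induction I rule: infinite_finite_induct) (auto simp: cinner_add_left)

lemma cinner_sum_right: "cinner x (\<Sum>i\<in>I. f i) = (\<Sum>i\<in>I. cinner x (f i))"
  by (induction I rule: infinite_finite_induct) (auto simp: cinner_add_right)

lemma cinner_scaleR_left: "cinner (r *\<^sub>R x) y = complex_of_real r * cinner x y"
  by (metis scaleC_of_real cinner_scaleC_left)

lemma cinner_scaleR_right: "cinner x (r *\<^sub>R y) = complex_of_real r * cinner x y"
  by (metis scaleC_of_real cinner_scaleC_right complex_cnj_complex_of_real)

lemma cinner_self: "cinner x x = complex_of_real ((norm x)\<^sup>2)"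
proof -
  have "Im (cinner x x) = 0"
    using cinner_commute[of x x] by (simp add: complex_eq_iff)
  then show ?thesis
    by (simp add: complex_eq_iff Re_cinner power2_norm_eq_inner)
qed

lemma norm_scaleC: "norm (c *\<^sub>C x) = cmod c * norm x"
proof -
  have "cinner (c *\<^sub>C x) (c *\<^sub>C x) = complex_of_real ((cmod c)\<^sup>2 * (norm x)\<^sup>2)"
    unfolding cinner_scaleC_left cinner_scaleC_right cinner_self[of x] of_real_mult
      complex_norm_square[of c] by simp
  then have "(norm (c *\<^sub>C x))\<^sup>2 = (cmod c * norm x)\<^sup>2"
    by (simp only: cinner_self of_real_eq_iff power_mult_distrib)
  then show ?thesis
    by (simp add: power2_eq_iff_nonneg)
qed

lemma Im_cinner: "Im (cinner x y) = inner x (\<i> *\<^sub>C y)"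
  by (simp flip: Re_cinner add: cinner_scaleC_right)

lemma cinner_eq: "cinner x y = Complex (inner x y) (inner x (\<i> *\<^sub>C y))"
  by (simp add: complex_eq_iff Re_cinner Im_cinner)

text \<open>A unit scalar \<open>c\<close> rotates the product onto the positive real axis, where
  the real Cauchy-Schwarz inequality applies.\<close>

lemma norm_cinner_le: "cmod (cinner x y) \<le> norm x * norm y"
proof (cases "cinner x y = 0")
  case False
  define c where "c = cnj (cinner x y) / cmod (cinner x y)"
  have c: "cmod c = 1"
    using False by (simp add: c_def norm_divide)
  have "cinner (c *\<^sub>C x) y = complex_of_real (cmod (cinner x y))"
    using False
    by (simp add: c_def cinner_scaleC_left mult.commute[of "cnj _"] flip: complex_norm_square)
       (simp add: power2_eq_square)
  then have "cmod (cinner x y) = inner (c *\<^sub>C x) y"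
    by (metis Re_cinner Re_complex_of_real)
  also have "\<dots> \<le> norm (c *\<^sub>C x) * norm y"
    by (rule norm_cauchy_schwarz)
  finally show ?thesis
    by (simp add: norm_scaleC c)
qed simp

lemma scaleC_minus_one: "(-1) *\<^sub>C (x :: 'a::complex_inner) = - x"
  by (simp add: complex_vector.scale_minus_left)

lemmas scaleC_diff_right = complex_vector.scale_right_diff_distrib

lemmas scaleC_diff_left = complex_vector.scale_left_diff_distrib

lemmas scaleC_sum_right = complex_vector.scale_sum_right

lemma bounded_linear_scaleC: "bounded_linear (\<lambda>x::'a::complex_inner. c *\<^sub>C x)"
proof (rule bounded_linear_intro[where K = "cmod c"])
  show "c *\<^sub>C (r *\<^sub>R x) = r *\<^sub>R (c *\<^sub>C x)" for r and x :: 'a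
    by (simp add: scaleC_scaleC mult.commute flip: scaleC_of_real)
qed (simp_all add: scaleC_add_right norm_scaleC)

lemma cinner_eq_zero_iff: "cinner x y = 0 \<longleftrightarrow> inner x y = 0 \<and> inner x (\<i> *\<^sub>C y) = 0"
  by (simp add: complex_eq_iff Re_cinner Im_cinner)

lemma bounded_linear_cinner_scaleC:
  "bounded_linear (\<lambda>f::'a::complex_inner. cinner f g *\<^sub>C h)"
proof (rule bounded_linear_intro[where K = "norm g * norm h"])
  show "cinner (r *\<^sub>R x) g *\<^sub>C h = r *\<^sub>R (cinner x g *\<^sub>C h)" for r x
    by (metis cinner_scaleR_left scaleC_scaleC scaleC_of_real)
  show "norm (cinner x g *\<^sub>C h) \<le> norm x * (norm g * norm h)" for x
    by (simp add: norm_scaleC mult_right_mono norm_cinner_le flip: mult.assoc)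
qed (simp add: cinner_add_left scaleC_add_left)

lemma tendsto_cinner:
  assumes "(f \<longlongrightarrow> x) F"
  shows "((\<lambda>n. cinner (f n) y) \<longlongrightarrow> cinner x y) F"
  unfolding cinner_eq by (intro tendsto_Complex tendsto_inner assms tendsto_const)

lemma cinner_eq_zero_all:
  assumes "\<And>z. cinner x z = 0"
  shows "x = 0"
  using assms[of x] by (simp add: cinner_self)

section \<open>Orthogonal projections and the Riesz representation\<close>

lemma ex_nearest_point:
  fixes M :: "'a::{real_inner, banach} set"
  assumes "subspace M" "closed M"
  shows "\<exists>y\<in>M. \<forall>z\<in>M. norm (x - y) \<le> norm (x - z)"
proof -
  have "0 \<in> M" using assms(1) by (rule subspace_0)
  then have ne: "M \<noteq> {}" by auto
  define d where "d = infdist x M"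
  have d0: "d \<ge> 0" by (simp add: d_def infdist_nonneg)
  have d: "d \<le> norm (x - z)" if "z \<in> M" for z
    using infdist_le[OF that, of x] by (simp add: d_def dist_norm)
  have "\<exists>y\<in>M. (norm (x - y))\<^sup>2 < d\<^sup>2 + e" if "e > 0" for e
  proof -
    have "d < sqrt (d\<^sup>2 + e)" using that d0 by (simp add: real_less_rsqrt)
    then obtain y where "y \<in> M" "dist x y < sqrt (d\<^sup>2 + e)"
      unfolding d_def using ne by (auto simp: infdist_notempty cINF_less_iff)
    moreover have "(norm (x - y))\<^sup>2 < (sqrt (d\<^sup>2 + e))\<^sup>2"
      using calculation(2) by (intro power_strict_mono) (auto simp: dist_norm)
    ultimately show ?thesis using that by (auto intro!: bexI[of _ y])
  qed
  then have "\<exists>y. \<forall>n. y n \<in> M \<and> (norm (x - y n))\<^sup>2 < d\<^sup>2 + inverse (real (Suc n))"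
    by (intro choice) (meson inverse_positive_iff_positive of_nat_0_less_iff zero_less_Suc)
  then obtain y where yM: "\<And>n. y n \<in> M"
    and y: "\<And>n. (norm (x - y n))\<^sup>2 < d\<^sup>2 + inverse (real (Suc n))" by blast
  \<comment> \<open>Parallelogram law: the midpoint lies in \<open>M\<close>, so its distance to
    \<open>x\<close> is at least \<open>d\<close>. This forces a minimising sequence to be
    Cauchy.\<close>
  have par: "(norm (y m - y n))\<^sup>2 \<le> 2 * (inverse (real (Suc m)) + inverse (real (Suc n)))" for m n
  proof -
    have "(1/2) *\<^sub>R (y m + y n) \<in> M"
      using assms(1) yM by (intro subspace_scale subspace_add)
    then have "d \<le> norm (x - (1/2) *\<^sub>R (y m + y n))" by (rule d)
    then have "d\<^sup>2 \<le> (norm (x - (1/2) *\<^sub>R (y m + y n)))\<^sup>2" using d0 by (rule power_mono)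
    moreover have "(norm (y m - y n))\<^sup>2 + 4 * (norm (x - (1/2) *\<^sub>R (y m + y n)))\<^sup>2
        = 2 * (norm (x - y m))\<^sup>2 + 2 * (norm (x - y n))\<^sup>2"
      by (simp add: power2_norm_eq_inner inner_simps inner_commute algebra_simps)
    ultimately show ?thesis using y[of m] y[of n] by (simp only: distrib_left)
  qed
  have "Cauchy y"
  proof (rule metric_CauchyI)
    fix e :: real assume e: "e > 0"
    then have "e\<^sup>2 / 4 > 0" by simp
    then obtain k where k: "inverse (real (Suc k)) < e\<^sup>2 / 4" using reals_Archimedean by blast
    have "dist (y m) (y n) < e" if "m \<ge> k" "n \<ge> k" for m n
    proof -
      have "inverse (real (Suc m)) < e\<^sup>2 / 4" "inverse (real (Suc n)) < e\<^sup>2 / 4"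
        using that k by (meson le_imp_inverse_le le_less_trans of_nat_0_less_iff of_nat_mono
            Suc_le_mono zero_less_Suc)+
      moreover have "w < t" if "i < t / 4" "j < t / 4" "w \<le> 2 * (i + j)" for i j w t :: real
        using that by simp
      ultimately have "(norm (y m - y n))\<^sup>2 < e\<^sup>2" using par[of m n] by blast
      then show ?thesis using e by (simp add: dist_norm power2_less_imp_less)
    qed
    then show "\<exists>M. \<forall>m\<ge>M. \<forall>n\<ge>M. dist (y m) (y n) < e" by blast
  qed
  then obtain l where l: "y \<longlonglongrightarrow> l" using Cauchy_convergent convergent_def by blast
  then have "l \<in> M" using assms(2) yM closed_sequentially by blast
  moreover have "norm (x - l) \<le> norm (x - z)" if "z \<in> M" for z
  proof -
    have "(\<lambda>n. (norm (x - y n))\<^sup>2) \<longlonglongrightarrow> (norm (x - l))\<^sup>2"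
      by (intro tendsto_intros l)
    moreover have "(\<lambda>n. d\<^sup>2 + inverse (real (Suc n))) \<longlonglongrightarrow> d\<^sup>2 + 0"
      by (intro tendsto_intros LIMSEQ_inverse_real_of_nat)
    ultimately have "(norm (x - l))\<^sup>2 \<le> d\<^sup>2 + 0"
      by (rule LIMSEQ_le) (use y less_imp_le in blast)
    also have "\<dots> \<le> (norm (x - z))\<^sup>2" using d[OF that] d0 by (simp add: power_mono)
    finally show ?thesis by simp
  qed
  ultimately show ?thesis by blast
qed

lemma ex_orthogonal_projection:
  fixes M :: "'a::{real_inner, banach} set"
  assumes "subspace M" "closed M"
  shows "\<exists>y\<in>M. \<forall>z\<in>M. inner (x - y) z = 0"
proof -
  obtain y where y: "y \<in> M" and min: "\<And>z. z \<in> M \<Longrightarrow> norm (x - y) \<le> norm (x - z)"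
    using ex_nearest_point[OF assms] by blast
  have "inner (x - y) z = 0" if z: "z \<in> M" for z
  proof (rule ccontr)
    assume ne: "inner (x - y) z \<noteq> 0"
    then have z0: "inner z z > 0" by auto
    \<comment> \<open>The minimiser of the norm of \<open>(x - y) - t *\<^sub>R z\<close>; it would
      beat \<open>y\<close> unless \<open>inner (x - y) z = 0\<close>.\<close>
    define t where "t = inner (x - y) z / inner z z"
    have "y + t *\<^sub>R z \<in> M" using assms(1) y z by (intro subspace_add subspace_scale)
    then have "norm (x - y) \<le> norm (x - (y + t *\<^sub>R z))" by (rule min)
    then have "(norm (x - y))\<^sup>2 \<le> (norm ((x - y) - t *\<^sub>R z))\<^sup>2"
      by (simp add: diff_diff_eq)
    also have "\<dots> = (norm (x - y))\<^sup>2 - 2 * t * inner (x - y) z + t\<^sup>2 * inner z z"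
      unfolding power2_norm_eq_inner
      by (simp add: inner_diff_left inner_diff_right inner_commute power2_eq_square algebra_simps)
    also have "\<dots> = (norm (x - y))\<^sup>2 - (inner (x - y) z)\<^sup>2 / inner z z"
      using z0 by (simp add: t_def power2_eq_square field_simps)
    finally show False using ne z0 by (simp add: divide_le_0_iff)
  qed
  with y show ?thesis by blast
qed

text \<open>Only one point of \<open>M\<close> has a residual orthogonal to \<open>M\<close>; this
  uniqueness (\<open>uniq\<close>) yields additivity and homogeneity of the projection.\<close>

lemma ex_orthogonal_projection_blinfun:
  fixes M :: "'a::{real_inner, banach} set"
  assumes M: "subspace M" "closed M"
  obtains P :: "'a \<Rightarrow>\<^sub>L 'a" where "\<And>x. P x \<in> M" "\<And>x z. z \<in> M \<Longrightarrow> inner (x - P x) z = 0"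
    "\<And>x. x \<in> M \<Longrightarrow> P x = x" "\<And>x. norm (P x) \<le> norm x"
proof -
  have "\<exists>p. \<forall>x. p x \<in> M \<and> (\<forall>z\<in>M. inner (x - p x) z = 0)"
    by (intro choice allI) (use ex_orthogonal_projection[OF M] in blast)
  then obtain p where p: "\<And>x. p x \<in> M" and orth: "\<And>x z. z \<in> M \<Longrightarrow> inner (x - p x) z = 0"
    by blast
  have uniq: "p x = y" if "y \<in> M" "\<And>z. z \<in> M \<Longrightarrow> inner (x - y) z = 0" for x y
  proof -
    have "p x - y \<in> M" using M(1) p that(1) by (intro subspace_diff)
    then have "inner (p x - y) (p x - y) = 0"
      using orth[of "p x - y" x] that(2)[of "p x - y"] by (simp add: inner_simps)
    then show ?thesis by simp
  qed
  have nrm: "norm (p x) \<le> norm x" for x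
  proof -
    have "(norm x)\<^sup>2 = (norm (p x))\<^sup>2 + (norm (x - p x))\<^sup>2"
      using orth[OF p, of x x] by (simp add: power2_norm_eq_inner inner_simps inner_commute)
    then have "(norm (p x))\<^sup>2 \<le> (norm x)\<^sup>2" by simp
    then show ?thesis by simp
  qed
  have "bounded_linear p"
  proof (rule bounded_linear_intro[where K = 1])
    show "p (x + y) = p x + p y" for x y
      using M(1) p orth[of _ x] orth[of _ y]
      by (intro uniq subspace_add) (auto simp: inner_simps algebra_simps)
    show "p (r *\<^sub>R x) = r *\<^sub>R p x" for r x
      using M(1) p orth[of _ x]
      by (intro uniq subspace_scale) (auto simp flip: scaleR_diff_right)
  qed (simp add: nrm)
  then have "blinfun_apply (Blinfun p) = p" by (rule bounded_linear_Blinfun_apply)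
  moreover have "p x = x" if "x \<in> M" for x using that by (intro uniq) auto
  ultimately show ?thesis using that[of "Blinfun p"] p orth nrm by simp
qed

text \<open>The kernel is a closed hyperplane, so its orthogonal complement is spanned by the
  residual \<open>w\<close> of any vector outside it; the representing vector is a multiple of
  \<open>w\<close>.\<close>

lemma riesz_representation:
  fixes \<phi> :: "'a::{real_inner, banach} \<Rightarrow> real"
  assumes "bounded_linear \<phi>"
  shows "\<exists>z. \<forall>x. \<phi> x = inner x z"
proof (cases "\<forall>x. \<phi> x = 0")
  case True
  then show ?thesis by (intro exI[of _ 0]) simp
next
  case False
  interpret bounded_linear \<phi> by fact
  define M where "M = {x. \<phi> x = 0}"
  have "subspace M" by (auto simp: M_def subspace_def add scaleR)
  moreover have "closed M"
    unfolding M_def by (intro closed_Collect_eq continuous_on continuous_on_const continuous_on_id)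
  moreover obtain x where x: "\<phi> x \<noteq> 0" using False by blast
  ultimately obtain y where "y \<in> M" and y: "\<And>z. z \<in> M \<Longrightarrow> inner (x - y) z = 0"
    using ex_orthogonal_projection by metis
  define w where "w = x - y"
  have w: "\<phi> w \<noteq> 0" using x \<open>y \<in> M\<close> by (simp add: w_def M_def diff)
  then have w0: "inner w w \<noteq> 0" by auto
  have "\<phi> u = inner u ((\<phi> w / inner w w) *\<^sub>R w)" for u
  proof -
    have "u - (\<phi> u / \<phi> w) *\<^sub>R w \<in> M" using w by (simp add: M_def diff scaleR)
    then have "inner w (u - (\<phi> u / \<phi> w) *\<^sub>R w) = 0" unfolding w_def by (rule y)
    then have "inner u w = \<phi> u / \<phi> w * inner w w"
      by (simp add: inner_diff_right inner_commute)
    then show ?thesis using w w0 by simp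
  qed
  then show ?thesis by blast
qed

text \<open>Adjoint for the real inner product. For complex linear operators it is the complex
  adjoint as well (\<open>cinner_adj\<close>), so Riesz representation is needed only over the
  reals.\<close>

definition adj :: "('a::{real_inner, banach} \<Rightarrow>\<^sub>L 'a) \<Rightarrow> ('a \<Rightarrow>\<^sub>L 'a)" where
  "adj X = (SOME Y. \<forall>f g. inner (X f) g = inner f (blinfun_apply Y g))"

lemma inner_adj: "inner (blinfun_apply X f) g = inner f (adj X g)"
proof -
  have "\<exists>z. \<forall>f. inner (X f) g = inner f z" for g
    by (intro riesz_representation bounded_linear_inner_left_comp blinfun.bounded_linear_right)
  then obtain y where y: "\<And>f g. inner (X f) g = inner f (y g)" by metis
  have eq: "a = b" if "\<And>f. inner f a = inner f b" for a b :: 'a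
  proof -
    have "inner (a - b) (a - b) = 0" using that[of "a - b"] by (simp add: inner_diff_right)
    then show ?thesis by simp
  qed
  have "bounded_linear y"
  proof (rule bounded_linear_intro[where K = "norm X"])
    show "y (a + b) = y a + y b" for a b
      by (intro eq) (simp add: inner_add_right flip: y)
    show "y (r *\<^sub>R a) = r *\<^sub>R y a" for r a
      by (intro eq) (simp flip: y)
    show "norm (y a) \<le> norm a * norm X" for a
    proof -
      have "(norm (y a))\<^sup>2 = inner (X (y a)) a" by (simp add: y power2_norm_eq_inner)
      also have "\<dots> \<le> norm (X (y a)) * norm a" by (rule norm_cauchy_schwarz)
      also have "\<dots> \<le> norm X * norm (y a) * norm a"
        by (intro mult_right_mono norm_blinfun) simp
      finally have "norm (y a) * norm (y a) \<le> norm (y a) * (norm a * norm X)"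
        by (simp add: power2_eq_square mult_ac)
      then show ?thesis
        by (cases "y a = 0") auto
    qed
  qed
  then have "\<exists>Y. \<forall>f g. inner (X f) g = inner f (blinfun_apply Y g)"
    using y by (intro exI[of _ "Blinfun y"]) (simp add: bounded_linear_Blinfun_apply)
  then show ?thesis unfolding adj_def by (rule someI2_ex) blast
qed

lemma inner_adj': "inner f (blinfun_apply X g) = inner (adj X f) g"
  by (metis inner_adj inner_commute)

lemma adj_eqI:
  assumes "\<And>f g. inner (blinfun_apply X f) g = inner f (blinfun_apply Y g)"
  shows "adj X = Y"
proof (rule blinfun_eqI)
  fix g
  have "inner (adj X g - Y g) (adj X g - Y g) = 0"
    unfolding inner_diff_right by (simp flip: inner_adj assms)
  then show "adj X g = Y g" by simp
qed

lemma adj_adj [simp]: "adj (adj X) = X"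
  by (intro adj_eqI) (simp add: inner_adj')

lemma adj_add: "adj (X + Y) = adj X + adj Y"
  by (intro adj_eqI) (simp add: inner_simps plus_blinfun.rep_eq inner_adj)

lemma adj_diff: "adj (X - Y) = adj X - adj Y"
  by (intro adj_eqI) (simp add: inner_simps minus_blinfun.rep_eq inner_adj)

lemma adj_compose: "adj (X o\<^sub>L Y) = adj Y o\<^sub>L adj X"
  by (intro adj_eqI) (simp add: inner_adj)

lemma adj_zero [simp]: "adj 0 = 0"
  by (intro adj_eqI) simp

lemma norm_adj_le: "norm (adj X) \<le> norm X"
proof (rule norm_blinfun_bound)
  fix g
  have "(norm (adj X g))\<^sup>2 = inner (X (adj X g)) g" by (simp add: inner_adj power2_norm_eq_inner)
  also have "\<dots> \<le> norm (X (adj X g)) * norm g" by (rule norm_cauchy_schwarz)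
  also have "\<dots> \<le> norm X * norm (adj X g) * norm g"
    by (intro mult_right_mono norm_blinfun) simp
  finally have "norm (adj X g) * norm (adj X g) \<le> norm (adj X g) * (norm X * norm g)"
    by (simp add: power2_eq_square mult_ac)
  then show "norm (adj X g) \<le> norm X * norm g"
    by (cases "adj X g = 0") auto
qed simp

lemma norm_adj [simp]: "norm (adj X) = norm X"
  by (metis adj_adj antisym norm_adj_le)

text \<open>The type of bounded linear functions carries only real linearity, so complex linearity
  is a separate predicate.\<close>

definition clin :: "('a::complex_inner \<Rightarrow>\<^sub>L 'a) \<Rightarrow> bool" where
  "clin X \<longleftrightarrow> (\<forall>c f. X (c *\<^sub>C f) = c *\<^sub>C X f)"

lemma clinD: "clin X \<Longrightarrow> X (c *\<^sub>C f) = c *\<^sub>C X f"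
  by (simp add: clin_def)

lemma clin_add: "clin X \<Longrightarrow> clin Y \<Longrightarrow> clin (X + Y)"
  by (simp add: clin_def plus_blinfun.rep_eq scaleC_add_right)

lemma clin_diff: "clin X \<Longrightarrow> clin Y \<Longrightarrow> clin (X - Y)"
  by (simp add: clin_def minus_blinfun.rep_eq scaleC_diff_right)

lemma clin_compose: "clin X \<Longrightarrow> clin Y \<Longrightarrow> clin (X o\<^sub>L Y)"
  by (simp add: clin_def)

text \<open>Multiplication by \<open>\<i>\<close> is skew-adjoint for the real inner product and
  commutes with \<open>X\<close>; hence the real adjoint identity also settles the imaginary
  part.\<close>

lemma cinner_adj:
  fixes X :: "'a::{complex_inner, banach} \<Rightarrow>\<^sub>L 'a"
  assumes "clin X"
  shows "cinner (X f) g = cinner f (adj X g)"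
proof -
  have "inner (X f) (\<i> *\<^sub>C g) = inner f (\<i> *\<^sub>C adj X g)"
  proof -
    have i: "inner u (\<i> *\<^sub>C v) = - inner (\<i> *\<^sub>C u) v" for u v :: 'a
      by (simp flip: Re_cinner add: cinner_scaleC_left cinner_scaleC_right)
    show ?thesis
      by (simp add: i inner_adj flip: clinD[OF assms])
  qed
  then show ?thesis by (simp add: cinner_eq inner_adj)
qed

lemma clin_adj:
  fixes X :: "'a::{complex_inner, banach} \<Rightarrow>\<^sub>L 'a"
  assumes "clin X"
  shows "clin (adj X)"
  unfolding clin_def
proof (intro allI)
  fix c g
  have "cinner f (adj X (c *\<^sub>C g) - c *\<^sub>C adj X g) = 0" for f
    by (simp add: cinner_diff_right cinner_scaleC_right flip: cinner_adj[OF assms])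
  then show "adj X (c *\<^sub>C g) = c *\<^sub>C adj X g"
    by (metis cinner_commute cinner_eq_zero_all complex_cnj_zero right_minus_eq)
qed

lemma cinner_adj':
  fixes X :: "'a::{complex_inner, banach} \<Rightarrow>\<^sub>L 'a"
  assumes "clin X"
  shows "cinner f (X g) = cinner (adj X f) g"
  using cinner_adj[OF clin_adj[OF assms], of f g] by simp


section \<open>Approximation numbers and Schatten sums\<close>

definition rank1 :: "'a::real_inner \<Rightarrow> 'a \<Rightarrow> ('a \<Rightarrow>\<^sub>L 'a)" where
  "rank1 g h = Blinfun (\<lambda>f. inner f g *\<^sub>R h)"

lemma rank1_apply [simp]: "rank1 g h f = inner f g *\<^sub>R h"
  unfolding rank1_def
  by (subst bounded_linear_Blinfun_apply)
     (rule bounded_linear_compose[OF bounded_linear_scaleR_left bounded_linear_inner_left], rule refl)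

text \<open>Rank is measured by the number of rank one summands rather than by the dimension of the
  range: sums, products and adjoints then follow by induction, adjoints because
  \<open>rank1 g h\<close> and \<open>rank1 h g\<close> are adjoint to each other.\<close>

inductive rank_le :: "nat \<Rightarrow> ('a::real_inner \<Rightarrow>\<^sub>L 'a) \<Rightarrow> bool" where
  zero: "rank_le 0 0"
| Suc: "rank_le n F \<Longrightarrow> rank_le (Suc n) (F + rank1 g h)"

lemma rank_le_zero: "rank_le n 0"
proof (induction n)
  case (Suc n)
  have "0 + rank1 (0::'a) 0 = 0" by (rule blinfun_eqI) simp
  then show ?case using rank_le.Suc[OF Suc, of 0 0] by simp
qed (rule rank_le.zero)

lemma rank_le_add:
  assumes "rank_le n F" "rank_le m G"
  shows "rank_le (n + m) (F + G)"
  using assms(2)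
proof (induction rule: rank_le.induct)
  case (Suc m G g h)
  then show ?case using rank_le.Suc[of "n + m" "F + G" g h] by (simp add: add.assoc)
qed (use assms(1) in simp)

lemma rank_le_mono: "rank_le n F \<Longrightarrow> n \<le> m \<Longrightarrow> rank_le m F"
  using rank_le_add[OF _ rank_le_zero, of n F "m - n"] by simp

lemma rank_le_rank1: "rank_le 1 (rank1 g h)"
  using rank_le.Suc[OF rank_le.zero, of g h] by simp

lemma rank_le_sum:
  assumes "\<And>i. i < N \<Longrightarrow> rank_le k (F i)"
  shows "rank_le (k * N) (\<Sum>i<N. F i)"
  using assms
proof (induction N)
  case (Suc N)
  then have "rank_le (k * N + k) (sum F {..<N} + F N)" by (intro rank_le_add) auto
  then show ?case by (simp add: add.commute)
qed (simp add: rank_le.zero)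

lemma rank_le_compose_left:
  assumes "rank_le n F"
  shows "rank_le n (X o\<^sub>L F)"
  using assms
proof (induction rule: rank_le.induct)
  case (Suc n F g h)
  have "X o\<^sub>L (F + rank1 g h) = (X o\<^sub>L F) + rank1 g (X h)"
    by (rule blinfun_eqI) (simp add: plus_blinfun.rep_eq blinfun.add_right blinfun.scaleR_right)
  then show ?case using Suc.IH rank_le.Suc by metis
qed (simp add: rank_le_zero)

lemma rank_le_compose_right:
  fixes X :: "'a::{real_inner, banach} \<Rightarrow>\<^sub>L 'a"
  assumes "rank_le n F"
  shows "rank_le n (F o\<^sub>L X)"
  using assms
proof (induction rule: rank_le.induct)
  case (Suc n F g h)
  have "(F + rank1 g h) o\<^sub>L X = (F o\<^sub>L X) + rank1 (adj X g) h"
    by (rule blinfun_eqI) (simp add: plus_blinfun.rep_eq inner_adj)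
  then show ?case using Suc.IH rank_le.Suc by metis
qed (simp add: rank_le_zero)

lemma rank_le_adj:
  fixes F :: "'a::{real_inner, banach} \<Rightarrow>\<^sub>L 'a"
  assumes "rank_le n F"
  shows "rank_le n (adj F)"
  using assms
proof (induction rule: rank_le.induct)
  case (Suc n F g h)
  have "adj (F + rank1 g h) = adj F + rank1 h g"
    unfolding adj_add by (intro arg_cong2[of _ _ _ _ "(+)"] adj_eqI refl) (simp add: inner_commute)
  then show ?case using Suc.IH rank_le.Suc by metis
qed (simp add: rank_le_zero)

lemma rank_le_uminus:
  assumes "rank_le n F"
  shows "rank_le n (- F)"
  using assms
proof (induction rule: rank_le.induct)
  case (Suc n F g h)
  have "- (F + rank1 g h) = - F + rank1 g (- h)"
    by (rule blinfun_eqI) (simp add: plus_blinfun.rep_eq uminus_blinfun.rep_eq minus_blinfun.rep_eq)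
  then show ?case using Suc.IH rank_le.Suc by metis
qed (simp add: rank_le_zero)

lemma rank_le_range:
  assumes "rank_le n F"
  shows "\<exists>B. finite B \<and> card B \<le> n \<and> range (blinfun_apply F) \<subseteq> span B"
  using assms
proof (induction rule: rank_le.induct)
  case zero
  then show ?case by (intro exI[of _ "{}"]) auto
next
  case (Suc n F g h)
  then obtain B where B: "finite B" "card B \<le> n" "range (blinfun_apply F) \<subseteq> span B" by blast
  have "F x + inner x g *\<^sub>R h \<in> span (insert h B)" for x
  proof (intro span_add span_scale)
    show "F x \<in> span (insert h B)" using B(3) span_mono[of B "insert h B"] by blast
  qed (simp add: span_base)
  then show ?case using B by (intro exI[of _ "insert h B"])
      (auto simp: card_insert_if plus_blinfun.rep_eq)
qed

text \<open>More vectors than the dimension allows. A repeated vector is treated separately, since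
  \<open>dependent\<close> speaks of the set of values and not of the family. Stated for any scalar
  field: over the reals it serves ranks, over the complex numbers Schur bases.\<close>

lemma (in vector_space) ex_nontrivial_relation:
  assumes B: "finite B" "card B \<le> n" and g: "\<And>i. i \<le> n \<Longrightarrow> g i \<in> span B"
  shows "\<exists>c. (\<exists>i\<le>n. c i \<noteq> 0) \<and> (\<Sum>i\<le>n. scale (c i) (g i)) = 0"
proof (cases "inj_on g {..n}")
  case False
  then obtain i j where ij: "i \<le> n" "j \<le> n" "i \<noteq> j" "g i = g j"
    by (auto simp: inj_on_def)
  define c where "c k = (if k = i then 1 else if k = j then - 1 else 0 :: 'a)" for k
  have "(\<Sum>k\<le>n. scale (c k) (g k)) = (\<Sum>k\<in>{i, j}. scale (c k) (g k))"
    using ij by (intro sum.mono_neutral_right) (auto simp: c_def)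
  also have "\<dots> = 0" using ij by (simp add: c_def)
  finally show ?thesis using ij by (intro exI[of _ c]) (auto simp: c_def)
next
  case True
  let ?S = "g ` {..n}"
  have "dependent ?S"
  proof (rule ccontr)
    assume "\<not> dependent ?S"
    moreover have "?S \<subseteq> span B" using g by blast
    ultimately have "card ?S \<le> card B" using independent_span_bound[OF B(1)] by blast
    then show False using B(2) card_image[OF True] by simp
  qed
  then obtain u where "(\<exists>v\<in>?S. u v \<noteq> 0)" "(\<Sum>v\<in>?S. scale (u v) v) = 0"
    using dependent_finite[of ?S] by auto
  then show ?thesis
    unfolding sum.reindex[OF True]
    by (intro exI[of _ "\<lambda>i. u (g i)"]) (simp add: Bex_def image_iff, blast)
qed

text \<open>The \<open>n + 1\<close> vectors are mapped into the span of at most \<open>n\<close>; a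
  linear relation between the images, normalised, gives a unit vector in the kernel.\<close>

lemma rank_le_kernel:
  fixes e :: "nat \<Rightarrow> 'a::real_inner"
  assumes F: "rank_le n F"
    and e: "\<And>i j. i \<le> n \<Longrightarrow> j \<le> n \<Longrightarrow> inner (e i) (e j) = (if i = j then 1 else 0)"
  shows "\<exists>c. (\<Sum>i\<le>n. (c i)\<^sup>2) = (1::real) \<and> F (\<Sum>i\<le>n. c i *\<^sub>R e i) = 0"
proof -
  obtain B where B: "finite B" "card B \<le> n" "range (blinfun_apply F) \<subseteq> span B"
    using rank_le_range[OF F] by blast
  then have "\<exists>c. (\<exists>i\<le>n. c i \<noteq> 0) \<and> (\<Sum>i\<le>n. c i *\<^sub>R F (e i)) = 0"
    by (intro real_vector.ex_nontrivial_relation) auto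
  then obtain c where c: "\<exists>i\<le>n. c i \<noteq> 0" "(\<Sum>i\<le>n. c i *\<^sub>R F (e i)) = 0" by blast
  define s where "s = (\<Sum>i\<le>n. (c i)\<^sup>2)"
  have s: "s > 0" unfolding s_def using c(1) by (metis atMost_iff finite_atMost sum_pos2 zero_le_power2 zero_less_power2)
  show ?thesis
  proof (intro exI conjI)
    show "(\<Sum>i\<le>n. (c i / sqrt s)\<^sup>2) = 1"
      using s by (simp add: power_divide s_def flip: sum_divide_distrib)
    have "F (\<Sum>i\<le>n. (c i / sqrt s) *\<^sub>R e i) = (1 / sqrt s) *\<^sub>R (\<Sum>i\<le>n. c i *\<^sub>R F (e i))"
      by (simp add: blinfun.sum_right blinfun.scaleR_right scaleR_sum_right)
    then show "F (\<Sum>i\<le>n. (c i / sqrt s) *\<^sub>R e i) = 0" using c(2) by simp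
  qed
qed

text \<open>Approximation numbers, indexed from \<open>0\<close>. The rank is the rank over the reals, also for
  complex linear operators; this costs only a factor \<open>2\<close> in the index.\<close>

definition apn :: "nat \<Rightarrow> ('a::real_inner \<Rightarrow>\<^sub>L 'a) \<Rightarrow> real" where
  "apn n X = infdist X {F. rank_le n F}"

lemma apn_nonneg [simp]: "0 \<le> apn n X"
  by (simp add: apn_def infdist_nonneg)

lemma apn_le: "rank_le n F \<Longrightarrow> apn n X \<le> norm (X - F)"
  using infdist_le[of F "{F. rank_le n F}" X] by (simp add: apn_def dist_norm)

lemma apn_ge:
  assumes "\<And>F. rank_le n F \<Longrightarrow> c \<le> norm (X - F)"
  shows "c \<le> apn n X"
proof -
  have "{F. rank_le n F} \<noteq> ({} :: ('a \<Rightarrow>\<^sub>L 'a) set)" using rank_le_zero by auto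
  then show ?thesis
    unfolding apn_def infdist_notempty[OF \<open>_ \<noteq> {}\<close>]
    using assms by (intro cINF_greatest) (auto simp: dist_norm)
qed

lemma apn_approx:
  assumes "e > 0"
  obtains F where "rank_le n F" "norm (X - F) < apn n X + e"
proof -
  have "\<exists>F. rank_le n F \<and> \<not> apn n X + e \<le> norm (X - F)"
    using apn_ge[of n "apn n X + e" X] assms by fastforce
  then show ?thesis using that not_le by blast
qed

lemma apn_antimono: "n \<le> m \<Longrightarrow> apn m X \<le> apn n X"
  by (rule apn_ge, rule apn_le, erule rank_le_mono)

lemma apn_le_norm: "apn n X \<le> norm X"
  using apn_le[OF rank_le_zero, of n X] by simp

lemma apn_rank: "rank_le n X \<Longrightarrow> apn n X = 0"
  using apn_le[of n X X] apn_nonneg[of n X] by simp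

lemma apn_add: "apn (n + m) (X + Y) \<le> apn n X + apn m Y"
proof (rule field_le_epsilon)
  fix e :: real assume "e > 0"
  then have e: "e / 2 > 0" by simp
  obtain F where F: "rank_le n F" "norm (X - F) < apn n X + e / 2" using apn_approx[OF e] .
  obtain G where G: "rank_le m G" "norm (Y - G) < apn m Y + e / 2" using apn_approx[OF e] .
  have "apn (n + m) (X + Y) \<le> norm ((X + Y) - (F + G))"
    by (intro apn_le rank_le_add F G)
  also have "\<dots> = norm ((X - F) + (Y - G))" by (simp add: algebra_simps)
  also have "\<dots> \<le> norm (X - F) + norm (Y - G)" by (rule norm_triangle_ineq)
  finally show "apn (n + m) (X + Y) \<le> apn n X + apn m Y + e" using F G by simp
qed

lemma apn_uminus [simp]: "apn n (- X) = apn n X"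
proof -
  have "apn n (- X) \<le> apn n X" for X :: "'a \<Rightarrow>\<^sub>L 'a"
  proof (rule apn_ge)
    fix F :: "'a \<Rightarrow>\<^sub>L 'a" assume "rank_le n F"
    then have "apn n (- X) \<le> norm (- X - - F)" by (intro apn_le rank_le_uminus)
    then show "apn n (- X) \<le> norm (X - F)" by (simp add: norm_minus_commute)
  qed
  from this[of X] this[of "- X"] show ?thesis by simp
qed

text \<open>If \<open>F\<close> and \<open>G\<close> approximate \<open>X\<close> and
  \<open>Y\<close>, then \<open>(F o\<^sub>L Y) + ((X - F) o\<^sub>L G)\<close> has rank at most
  \<open>n + m\<close>, and its error is the product of the two errors.\<close>

lemma apn_compose:
  fixes X :: "'a::{real_inner, banach} \<Rightarrow>\<^sub>L 'a"
  shows "apn (n + m) (X o\<^sub>L Y) \<le> apn n X * apn m Y"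
proof -
  have *: "apn (n + m) (X o\<^sub>L Y) \<le> norm (X - F) * norm (Y - G)"
    if F: "rank_le n F" and G: "rank_le m G" for F G
  proof -
    have "apn (n + m) (X o\<^sub>L Y) \<le> norm ((X o\<^sub>L Y) - ((F o\<^sub>L Y) + ((X - F) o\<^sub>L G)))"
      by (intro apn_le rank_le_add rank_le_compose_left rank_le_compose_right F G)
    also have "(X o\<^sub>L Y) - ((F o\<^sub>L Y) + ((X - F) o\<^sub>L G)) = (X - F) o\<^sub>L (Y - G)"
      by (rule blinfun_eqI)
         (simp add: minus_blinfun.rep_eq plus_blinfun.rep_eq blinfun.diff_right)
    finally show ?thesis using norm_blinfun_compose order_trans by blast
  qed
  have le: "apn (n + m) (X o\<^sub>L Y) \<le> (apn n X + e) * (apn m Y + e)" if e: "e > 0" for e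
  proof -
    obtain F where F: "rank_le n F" "norm (X - F) < apn n X + e" using apn_approx[OF e] .
    obtain G where G: "rank_le m G" "norm (Y - G) < apn m Y + e" using apn_approx[OF e] .
    have "norm (X - F) * norm (Y - G) \<le> (apn n X + e) * (apn m Y + e)"
      using F G that by (intro mult_mono) auto
    then show ?thesis using *[OF F(1) G(1)] by linarith
  qed
  have lim: "((\<lambda>e. (apn n X + e) * (apn m Y + e)) \<longlongrightarrow> (apn n X + 0) * (apn m Y + 0)) (at_right 0)"
    by (intro tendsto_intros)
  have "apn (n + m) (X o\<^sub>L Y) \<le> (apn n X + 0) * (apn m Y + 0)"
    by (rule tendsto_lowerbound[OF lim])
       (auto simp: eventually_at_right_field intro!: exI[of _ 1] le)
  then show ?thesis by simp
qed

lemma apn_adj [simp]: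
  fixes X :: "'a::{real_inner, banach} \<Rightarrow>\<^sub>L 'a"
  shows "apn n (adj X) = apn n X"
proof -
  have "apn n (adj X) \<le> apn n X" for X :: "'a \<Rightarrow>\<^sub>L 'a"
  proof (rule apn_ge)
    fix F :: "'a \<Rightarrow>\<^sub>L 'a" assume "rank_le n F"
    then have "apn n (adj X) \<le> norm (adj X - adj F)" by (intro apn_le rank_le_adj)
    then show "apn n (adj X) \<le> norm (X - F)" by (simp flip: adj_diff)
  qed
  from this[of X] this[of "adj X"] show ?thesis by simp
qed

lemma apn_compose_le:
  fixes X :: "'a::{real_inner, banach} \<Rightarrow>\<^sub>L 'a"
  shows "apn n (X o\<^sub>L Y o\<^sub>L Z) \<le> norm X * apn n Y * norm Z"
proof -
  have "apn (0 + n + 0) (X o\<^sub>L Y o\<^sub>L Z) \<le> apn (0 + n) (X o\<^sub>L Y) * apn 0 Z" by (rule apn_compose)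
  also have "\<dots> \<le> (norm X * apn n Y) * norm Z"
    by (intro mult_mono apn_le_norm order_trans[OF apn_compose] mult_nonneg_nonneg) auto
  finally show ?thesis by simp
qed

text \<open>The min-max argument: every \<open>F\<close> of rank at most \<open>n\<close> kills some
  unit vector in the span of \<open>n + 1\<close> orthonormal vectors, and there
  \<open>X - F\<close> agrees with \<open>X\<close>.\<close>

lemma apn_lower_bound:
  fixes X :: "'a::{real_inner, banach} \<Rightarrow>\<^sub>L 'a"
  assumes e: "\<And>i j. i \<le> n \<Longrightarrow> j \<le> n \<Longrightarrow> inner (e i) (e j) = (if i = j then 1 else 0)"
    and X: "\<And>c. (\<Sum>i\<le>n. (c i)\<^sup>2) = 1 \<Longrightarrow> t \<le> norm (X (\<Sum>i\<le>n. c i *\<^sub>R e i))"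
  shows "t \<le> apn n X"
proof (rule apn_ge)
  fix F :: "'a \<Rightarrow>\<^sub>L 'a" assume "rank_le n F"
  then obtain c where c: "(\<Sum>i\<le>n. (c i)\<^sup>2) = (1::real)" "F (\<Sum>i\<le>n. c i *\<^sub>R e i) = 0"
    using rank_le_kernel[OF _ e] by blast
  let ?f = "\<Sum>i\<le>n. c i *\<^sub>R e i"
  have "(norm ?f)\<^sup>2 = (\<Sum>i\<le>n. \<Sum>j\<le>n. c i * (c j * inner (e i) (e j)))"
    by (simp add: power2_norm_eq_inner inner_sum_left inner_sum_right sum_distrib_left)
       (simp add: inner_commute)
  also have "\<dots> = (\<Sum>i\<le>n. \<Sum>j\<le>n. if i = j then (c i)\<^sup>2 else 0)"
    by (intro sum.cong refl) (simp add: e power2_eq_square)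
  also have "\<dots> = 1" using c(1) by simp
  finally have f1: "norm ?f = 1" using power2_eq_imp_eq[of "norm ?f" 1] by simp
  have "t \<le> norm (X ?f)" by (rule X) (rule c)
  also have "X ?f = (X - F) ?f" by (simp add: minus_blinfun.rep_eq c(2))
  also have "norm \<dots> \<le> norm (X - F) * norm ?f" by (rule norm_blinfun)
  finally show "t \<le> norm (X - F)" by (simp add: f1)
qed

text \<open>A truncated p-th power of the Schatten quasinorm. The truncation at \<open>N\<close>
  keeps it finite for every operator and loses nothing on operators of rank at most
  \<open>N\<close>.\<close>

definition schatten_sum :: "nat \<Rightarrow> nat \<Rightarrow> ('a::real_inner \<Rightarrow>\<^sub>L 'a) \<Rightarrow> real" where
  "schatten_sum p N X = (\<Sum>n<N. apn n X ^ p)"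

lemma schatten_sum_nonneg [simp]: "0 \<le> schatten_sum p N X"
  by (simp add: schatten_sum_def sum_nonneg)

lemma schatten_sum_adj [simp]:
  fixes X :: "'a::{real_inner, banach} \<Rightarrow>\<^sub>L 'a"
  shows "schatten_sum p N (adj X) = schatten_sum p N X"
  by (simp add: schatten_sum_def)

lemma schatten_sum_uminus [simp]: "schatten_sum p N (- X) = schatten_sum p N X"
  by (simp add: schatten_sum_def)

text \<open>Absorbs the doubling of the index in \<open>apn_add\<close> and
  \<open>apn_compose\<close>: each odd term is at most the even term before it.\<close>

lemma sum_le_even_terms:
  fixes f :: "nat \<Rightarrow> real"
  assumes "\<And>n m. n \<le> m \<Longrightarrow> f m \<le> f n" "\<And>n. 0 \<le> f n"
  shows "(\<Sum>n<N. f n) \<le> 2 * (\<Sum>n<N. f (n + n))"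
proof -
  have "(\<Sum>n<N. f n) \<le> (\<Sum>n<2 * N. f n)"
    using assms(2) by (intro sum_mono2) auto
  also have "\<dots> \<le> 2 * (\<Sum>n<N. f (n + n))"
  proof (induction N)
    case (Suc N)
    have "(\<Sum>n<2 * Suc N. f n) = (\<Sum>n<2 * N. f n) + f (2 * N) + f (Suc (2 * N))"
      by simp
    moreover have "f (Suc (2 * N)) \<le> f (2 * N)" by (rule assms(1)) simp
    moreover have "(\<Sum>n<Suc N. f (n + n)) = (\<Sum>n<N. f (n + n)) + f (2 * N)"
      by (simp add: mult_2)
    ultimately show ?case using Suc by linarith
  qed simp
  finally show ?thesis .
qed

lemma schatten_sum_even_terms: "schatten_sum p N X \<le> 2 * (\<Sum>n<N. apn (n + n) X ^ p)"
  unfolding schatten_sum_def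
  by (rule sum_le_even_terms) (auto intro!: power_mono apn_antimono)

lemma schatten_sum_add:
  "schatten_sum p N (X + Y) \<le> 2 * 2 ^ p * (schatten_sum p N X + schatten_sum p N Y)"
proof -
  \<comment> \<open>A crude substitute for convexity; with the factor 2 from the even terms it gives
    the constant \<open>2 * 2 ^ p\<close>, called \<open>q\<close> further on.\<close>
  have pw: "(a + b) ^ p \<le> 2 ^ p * (a ^ p + b ^ p)" if "0 \<le> a" "0 \<le> b" for a b :: real
  proof -
    have "(a + b) ^ p \<le> (2 * max a b) ^ p" using that by (intro power_mono) auto
    also have "\<dots> \<le> 2 ^ p * (a ^ p + b ^ p)"
      using that by (cases "a \<le> b") (simp_all add: power_mult_distrib max_def)
    finally show ?thesis .
  qed
  have "schatten_sum p N (X + Y) \<le> 2 * (\<Sum>n<N. apn (n + n) (X + Y) ^ p)"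
    by (rule schatten_sum_even_terms)
  also have "\<dots> \<le> 2 * (\<Sum>n<N. 2 ^ p * (apn n X ^ p + apn n Y ^ p))"
    by (intro mult_left_mono sum_mono order_trans[OF power_mono[OF apn_add] pw]) auto
  also have "\<dots> = 2 * 2 ^ p * (schatten_sum p N X + schatten_sum p N Y)"
    by (simp add: schatten_sum_def sum.distrib flip: sum_distrib_left)
  finally show ?thesis .
qed

lemma schatten_sum_diff:
  "schatten_sum p N (X - Y) \<le> 2 * 2 ^ p * (schatten_sum p N X + schatten_sum p N Y)"
  using schatten_sum_add[of p N X "- Y"] by simp

text \<open>Hoelder's inequality with both factors in the class of exponent \<open>2 * p\<close>;
  for the p-th powers of the approximation numbers this is Cauchy-Schwarz.\<close>

lemma schatten_sum_compose:
  fixes X :: "'a::{real_inner, banach} \<Rightarrow>\<^sub>L 'a"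
  shows "schatten_sum p N (X o\<^sub>L Y)
    \<le> 2 * (sqrt (schatten_sum (2 * p) N X) * sqrt (schatten_sum (2 * p) N Y))"
proof -
  have "schatten_sum p N (X o\<^sub>L Y) \<le> 2 * (\<Sum>n<N. apn (n + n) (X o\<^sub>L Y) ^ p)"
    by (rule schatten_sum_even_terms)
  also have "\<dots> \<le> 2 * (\<Sum>n<N. apn n X ^ p * apn n Y ^ p)"
    unfolding power_mult_distrib[symmetric]
    by (intro mult_left_mono sum_mono power_mono apn_compose) auto
  also have "(\<Sum>n<N. apn n X ^ p * apn n Y ^ p)
      \<le> sqrt ((\<Sum>n<N. (apn n X ^ p)\<^sup>2) * (\<Sum>n<N. (apn n Y ^ p)\<^sup>2))"
    by (rule real_le_rsqrt) (rule Cauchy_Schwarz_ineq_sum)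
  also have "\<dots> = sqrt (schatten_sum (2 * p) N X) * sqrt (schatten_sum (2 * p) N Y)"
    by (simp add: schatten_sum_def real_sqrt_mult power_mult mult.commute[of 2])
  finally show ?thesis by simp
qed


section \<open>Orthonormal systems and compact operators\<close>

definition crank1 :: "'a::complex_inner \<Rightarrow> 'a \<Rightarrow> ('a \<Rightarrow>\<^sub>L 'a)" where
  "crank1 g h = Blinfun (\<lambda>f. cinner f g *\<^sub>C h)"

lemma crank1_apply [simp]: "crank1 g h f = cinner f g *\<^sub>C h"
  unfolding crank1_def by (subst bounded_linear_Blinfun_apply) (rule bounded_linear_cinner_scaleC, rule refl)

lemma scaleC_Complex: "Complex a b *\<^sub>C h = a *\<^sub>R h + b *\<^sub>R (\<i> *\<^sub>C h)"
proof -
  have "Complex a b = complex_of_real a + complex_of_real b * \<i>"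
    by (simp add: complex_eq_iff)
  then show ?thesis
    by (simp only: scaleC_add_left scaleC_of_real scaleC_scaleC[symmetric])
qed

text \<open>A complex coefficient is two real ones, so a complex rank one operator has real rank at
  most two.\<close>

lemma rank_le_crank1: "rank_le 2 (crank1 g h)"
proof -
  have "crank1 g h = rank1 g h + rank1 (\<i> *\<^sub>C g) (\<i> *\<^sub>C h)"
    by (rule blinfun_eqI) (simp add: plus_blinfun.rep_eq cinner_eq scaleC_Complex)
  then show ?thesis
    using rank_le_add[OF rank_le_rank1 rank_le_rank1] by (simp add: numeral_2_eq_2)
qed

lemma clin_crank1: "clin (crank1 g h)"
  by (simp add: clin_def cinner_scaleC_left scaleC_scaleC)

lemma clin_zero: "clin 0"
  by (simp add: clin_def)

lemma clin_sum: "(\<And>i. i \<in> I \<Longrightarrow> clin (F i)) \<Longrightarrow> clin (\<Sum>i\<in>I. F i)"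
  by (induction I rule: infinite_finite_induct) (auto simp: clin_add clin_zero)

lemma blinfun_sum_apply: "blinfun_apply (\<Sum>i\<in>I. F i) x = (\<Sum>i\<in>I. F i x)"
  by (induction I rule: infinite_finite_induct) (auto simp: plus_blinfun.rep_eq)

lemma adj_sum: "adj (\<Sum>i\<in>I. F i) = (\<Sum>i\<in>I. adj (F i))"
  by (induction I rule: infinite_finite_induct) (auto simp: adj_add)

lemma clin_adj_eqI:
  fixes X Y :: "'a::{complex_inner, banach} \<Rightarrow>\<^sub>L 'a"
  assumes "\<And>f g. cinner (X f) g = cinner f (Y g)"
  shows "adj X = Y"
  by (rule adj_eqI) (metis Re_cinner assms)

lemma adj_crank1:
  fixes g h :: "'a::{complex_inner, banach}"
  shows "adj (crank1 g h) = crank1 h g"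
  by (rule clin_adj_eqI)
     (simp add: cinner_scaleC_left cinner_scaleC_right mult.commute flip: cinner_commute[of h])

text \<open>Orthonormal systems; zero vectors are admitted so that a finite system can be
  continued to a sequence.\<close>

definition ortho :: "(nat \<Rightarrow> 'a::complex_inner) \<Rightarrow> bool" where
  "ortho e \<longleftrightarrow> (\<forall>i. norm (e i) = 1 \<or> e i = 0) \<and> (\<forall>i j. i \<noteq> j \<longrightarrow> cinner (e i) (e j) = 0)"

definition cproj :: "(nat \<Rightarrow> 'a::complex_inner) \<Rightarrow> nat \<Rightarrow> ('a \<Rightarrow>\<^sub>L 'a)" where
  "cproj e n = (\<Sum>i<n. crank1 (e i) (e i))"

lemma cproj_apply: "cproj e n f = (\<Sum>i<n. cinner f (e i) *\<^sub>C e i)"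
  by (simp add: cproj_def blinfun_sum_apply)

lemma clin_cproj: "clin (cproj e n)"
  unfolding cproj_def by (intro clin_sum clin_crank1)

lemma rank_le_cproj: "rank_le (2 * n) (cproj e n)"
  unfolding cproj_def by (intro rank_le_sum rank_le_crank1)

lemma adj_cproj [simp]: "adj (cproj e n) = cproj (e :: nat \<Rightarrow> 'a::{complex_inner, banach}) n"
  by (simp add: cproj_def adj_sum adj_crank1)

context
  fixes e :: "nat \<Rightarrow> 'a::complex_inner"
  assumes e: "ortho e"
begin

lemma ortho_self: "cinner (e i) (e i) = (if e i = 0 then 0 else 1)"
proof -
  have "e i = 0 \<or> norm (e i) = 1" using e by (auto simp: ortho_def)
  then show ?thesis by (auto simp: cinner_self)
qed

lemma ortho_scale: "cinner (e i) (e i) *\<^sub>C e i = e i"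
  by (simp add: ortho_self)

lemma ortho_sum: "cinner (\<Sum>i<n. c i *\<^sub>C e i) (e j) = (if j < n then c j * cinner (e j) (e j) else 0)"
proof -
  have "cinner (\<Sum>i<n. c i *\<^sub>C e i) (e j) = (\<Sum>i<n. if i = j then c j * cinner (e j) (e j) else 0)"
    unfolding cinner_sum_left cinner_scaleC_left using e
    by (intro sum.cong) (auto simp: ortho_def)
  then show ?thesis by simp
qed

lemma cinner_self_mult: "cinner f (e j) * cinner (e j) (e j) = cinner f (e j)"
  by (simp add: ortho_self)

lemma cproj_orth: "i < n \<Longrightarrow> cinner (f - cproj e n f) (e i) = 0"
  by (simp add: cinner_diff_left cproj_apply ortho_sum cinner_self_mult)

lemma cproj_fix: "i < n \<Longrightarrow> cproj e n (e i) = e i"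
proof -
  assume "i < n"
  have "cproj e n (e i) = (\<Sum>j<n. if j = i then cinner (e i) (e i) *\<^sub>C e i else 0)"
    unfolding cproj_apply using e by (intro sum.cong) (auto simp: ortho_def)
  then show ?thesis using \<open>i < n\<close> by (simp add: ortho_scale)
qed

lemma cproj_idem: "cproj e n (cproj e n f) = cproj e n f"
  using cproj_fix
  by (simp add: cproj_apply[of e n f] blinfun.sum_right clinD[OF clin_cproj])

lemma norm_sum_ortho: "(norm (\<Sum>i<n. c i *\<^sub>C e i))\<^sup>2 = (\<Sum>i<n. (cmod (c i))\<^sup>2 * (norm (e i))\<^sup>2)"
proof -
  have "complex_of_real ((norm (\<Sum>i<n. c i *\<^sub>C e i))\<^sup>2)
      = (\<Sum>j<n. cnj (c j) * cinner (\<Sum>i<n. c i *\<^sub>C e i) (e j))"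
    unfolding cinner_self[symmetric] cinner_sum_right cinner_scaleC_right ..
  also have "\<dots> = (\<Sum>j<n. complex_of_real ((cmod (c j))\<^sup>2 * (norm (e j))\<^sup>2))"
    by (intro sum.cong refl) (simp add: ortho_sum cinner_self complex_norm_square mult_ac del: of_real_power)
  finally show ?thesis by (simp only: of_real_eq_iff flip: of_real_sum)
qed

lemma cmod_cinner_ortho: "cmod (cinner f (e i)) * norm (e i) = cmod (cinner f (e i))"
  using e by (cases "e i = 0") (auto simp: ortho_def)

lemma norm_cproj: "(norm (cproj e n f))\<^sup>2 = (\<Sum>i<n. (cmod (cinner f (e i)))\<^sup>2)"
  unfolding cproj_apply norm_sum_ortho
  by (simp flip: power_mult_distrib add: cmod_cinner_ortho)

lemma cproj_orth_range: "cinner (f - cproj e n f) (cproj e n g) = 0"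
  unfolding cproj_apply[of e n g] cinner_sum_right cinner_scaleC_right
  by (intro sum.neutral) (simp add: cproj_orth)

lemma norm_pythagoras: "(norm f)\<^sup>2 = (norm (cproj e n f))\<^sup>2 + (norm (f - cproj e n f))\<^sup>2"
proof -
  have "inner (f - cproj e n f) (cproj e n f) = 0"
    using cproj_orth_range[of f n f] by (metis Re_cinner zero_complex.simps(1))
  then show ?thesis
    by (simp add: power2_norm_eq_inner inner_simps inner_commute)
qed

lemma norm_res_le: "norm (f - cproj e n f) \<le> norm f"
  by (rule power2_le_imp_le) (use norm_pythagoras[of f n] in auto)

lemma norm_cproj_le: "norm (cproj e n f) \<le> norm f"
  by (rule power2_le_imp_le) (use norm_pythagoras[of f n] in auto)

lemma norm_cproj_le_1: "norm (cproj e n) \<le> 1"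
  by (rule norm_blinfun_bound) (auto simp: norm_cproj_le)

lemma bessel: "(\<Sum>i<n. (cmod (cinner f (e i)))\<^sup>2) \<le> (norm f)\<^sup>2"
  using norm_cproj_le[of n f] by (simp flip: norm_cproj add: power_mono)

end

section \<open>Compact operators and norm-maximising vectors\<close>

definition compact_blinfun :: "('a::real_normed_vector \<Rightarrow>\<^sub>L 'a) \<Rightarrow> bool" where
  "compact_blinfun X \<longleftrightarrow> (\<forall>f. (\<forall>n. norm (f n) \<le> 1) \<longrightarrow>
     (\<exists>r l. strict_mono (r :: nat \<Rightarrow> nat) \<and> (\<lambda>n. X (f (r n))) \<longlonglongrightarrow> l))"

lemma compact_blinfunE:
  assumes "compact_blinfun X" "\<And>n. norm (f n) \<le> 1"
  obtains r l where "strict_mono (r :: nat \<Rightarrow> nat)" "(\<lambda>n. X (f (r n))) \<longlonglongrightarrow> l"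
  using assms unfolding compact_blinfun_def by blast

lemma compact_blinfun_add:
  assumes X: "compact_blinfun X" and Y: "compact_blinfun Y"
  shows "compact_blinfun (X + Y)"
  unfolding compact_blinfun_def
proof (intro allI impI)
  fix f :: "nat \<Rightarrow> 'a" assume f: "\<forall>n. norm (f n) \<le> 1"
  obtain r l where r: "strict_mono r" "(\<lambda>n. X (f (r n))) \<longlonglongrightarrow> l"
    using compact_blinfunE[OF X] f by blast
  obtain q k where q: "strict_mono q" "(\<lambda>n. Y (f (r (q n)))) \<longlonglongrightarrow> k"
    using compact_blinfunE[OF Y, of "f \<circ> r"] f by auto
  have "(\<lambda>n. X (f (r (q n)))) \<longlonglongrightarrow> l"
    using LIMSEQ_subseq_LIMSEQ[OF r(2) q(1)] by (simp add: o_def)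
  then have "(\<lambda>n. (X + Y) (f ((r \<circ> q) n))) \<longlonglongrightarrow> l + k"
    unfolding plus_blinfun.rep_eq o_def using q(2) by (rule tendsto_add)
  then show "\<exists>r l. strict_mono r \<and> (\<lambda>n. (X + Y) (f (r n))) \<longlonglongrightarrow> l"
    using strict_mono_o[OF r(1) q(1)] by blast
qed

lemma compact_blinfun_rank1: "compact_blinfun (rank1 g h)"
  unfolding compact_blinfun_def
proof (intro allI impI)
  fix f :: "nat \<Rightarrow> 'a" assume f: "\<forall>n. norm (f n) \<le> 1"
  have "\<forall>n. inner (f n) g \<in> cball 0 (norm g)"
    using f by (auto intro!: order_trans[OF Cauchy_Schwarz_ineq2] mult_left_le_one_le)
  then have "\<exists>l\<in>cball 0 (norm g). \<exists>r. strict_mono r \<and> ((\<lambda>n. inner (f n) g) \<circ> r) \<longlonglongrightarrow> l"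
    by (intro compact_def[THEN iffD1, rule_format, OF compact_cball]) blast
  then obtain r l where "strict_mono r" "((\<lambda>n. inner (f n) g) \<circ> r) \<longlonglongrightarrow> l"
    by blast
  then show "\<exists>r l. strict_mono r \<and> (\<lambda>n. rank1 g h (f (r n))) \<longlonglongrightarrow> l"
    by (intro exI[of _ r] exI[of _ "l *\<^sub>R h"]) (auto simp: o_def intro!: tendsto_intros)
qed

lemma compact_blinfun_rank_le:
  assumes "rank_le n F"
  shows "compact_blinfun F"
  using assms
proof (induction rule: rank_le.induct)
  case zero
  show ?case unfolding compact_blinfun_def by (auto intro!: exI[of _ id] exI[of _ 0] strict_mono_id)
qed (intro compact_blinfun_add compact_blinfun_rank1)

text \<open>The bound \<open>s\<close> is required only at the vector \<open>adj X (X f)\<close>;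
  thus it may be the norm of \<open>X\<close> on a subspace invariant under
  \<open>adj X o\<^sub>L X\<close>.\<close>

lemma norm_adj_compose_le:
  fixes X :: "'a::{real_inner, banach} \<Rightarrow>\<^sub>L 'a"
  assumes s: "0 \<le> s" and "norm (X (adj X (X f))) \<le> s * norm (adj X (X f))"
  shows "norm (adj X (X f)) \<le> s * norm (X f)"
proof -
  let ?g = "adj X (X f)"
  have "(norm ?g)\<^sup>2 = inner (X f) (X ?g)" by (simp add: inner_adj power2_norm_eq_inner)
  also have "\<dots> \<le> norm (X f) * norm (X ?g)" by (rule norm_cauchy_schwarz)
  also have "\<dots> \<le> norm (X f) * (s * norm ?g)" by (intro mult_left_mono assms(2)) simp
  finally have "norm ?g * norm ?g \<le> norm ?g * (s * norm (X f))"
    by (simp add: power2_eq_square mult_ac)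
  then show ?thesis using s by (cases "?g = 0") auto
qed

text \<open>On an invariant subspace the norm of a compact operator is attained, and the maximiser
  is an eigenvector of \<open>adj X o\<^sub>L X\<close>. If \<open>X\<close> vanishes on
  \<open>M\<close>, the zero vector is returned, in accordance with the convention of
  \<open>ortho\<close>.\<close>

lemma ex_maximal_vector:
  fixes X :: "'a::{real_inner, banach} \<Rightarrow>\<^sub>L 'a"
  assumes X: "compact_blinfun X" and M: "subspace M" "closed M"
    and inv: "\<And>f. f \<in> M \<Longrightarrow> adj X (X f) \<in> M"
  shows "\<exists>e s. (norm e = 1 \<or> e = 0 \<and> s = 0) \<and> e \<in> M \<and> 0 \<le> s \<and> adj X (X e) = s\<^sup>2 *\<^sub>R e \<and>
    (\<forall>g\<in>M. norm (X g) \<le> s * norm g)"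
proof -
  define A where "A = (\<lambda>f. norm (X f)) ` (M \<inter> cball 0 1)"
  define s where "s = Sup A"
  have bdd: "bdd_above A"
  proof (rule bdd_aboveI)
    fix x assume "x \<in> A"
    then obtain f where "norm f \<le> 1" "x = norm (X f)" by (auto simp: A_def)
    moreover have "norm X * norm f \<le> norm X * 1" using calculation(1) by (intro mult_left_mono) auto
    ultimately show "x \<le> norm X" using norm_blinfun[of X f] by simp
  qed
  have 0: "0 \<in> M \<inter> cball 0 1" using subspace_0[OF M(1)] by simp
  have le1: "norm (X f) \<le> s" if "f \<in> M" "norm f \<le> 1" for f
    unfolding s_def using that by (intro cSup_upper bdd) (auto simp: A_def)
  have s0: "s \<ge> 0" using le1[of 0] 0 by simp
  have le: "norm (X g) \<le> s * norm g" if g: "g \<in> M" for g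
  proof (cases "g = 0")
    case False
    have "norm (X ((1 / norm g) *\<^sub>R g)) \<le> s"
      using False by (intro le1 subspace_scale M g) auto
    then show ?thesis using False by (simp add: blinfun.scaleR_right field_simps)
  qed simp
  show ?thesis
  proof (cases "s = 0")
    case True
    then show ?thesis using le 0 by (intro exI[of _ 0]) auto
  next
    case False
    then have sp: "s > 0" using s0 by simp
    have "\<exists>f. f \<in> M \<and> norm f \<le> 1 \<and> s - inverse (real (Suc n)) < norm (X f)" for n
    proof -
      have "A \<noteq> {}" using 0 by (auto simp: A_def)
      moreover have "s - inverse (real (Suc n)) < Sup A" by (simp add: s_def)
      ultimately show ?thesis using less_cSupD[of A] by (fastforce simp: A_def)
    qed
    then obtain f where f: "\<And>n. f n \<in> M" "\<And>n. norm (f n) \<le> 1"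
        "\<And>n. s - inverse (real (Suc n)) < norm (X (f n))" by metis
    obtain r l where r: "strict_mono r" and l: "(\<lambda>n. X (f (r n))) \<longlonglongrightarrow> l"
      using compact_blinfunE[OF X, of f] f(2) by blast
    define h where "h n = f (r n)" for n
    have h: "h n \<in> M" "norm (h n) \<le> 1" for n using f by (auto simp: h_def)
    have hs: "(\<lambda>n. norm (X (h n))) \<longlonglongrightarrow> s"
    proof -
      have "(\<lambda>n. norm (X (f n))) \<longlonglongrightarrow> s"
      proof (rule tendsto_sandwich)
        have "(\<lambda>n. s - inverse (real (Suc n))) \<longlonglongrightarrow> s - 0"
          by (intro tendsto_intros LIMSEQ_inverse_real_of_nat)
        then show "(\<lambda>n. s - inverse (real (Suc n))) \<longlonglongrightarrow> s" by simp
        show "\<forall>\<^sub>F n in sequentially. s - inverse (real (Suc n)) \<le> norm (X (f n))"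
          by (intro always_eventually allI less_imp_le f)
        show "\<forall>\<^sub>F n in sequentially. norm (X (f n)) \<le> s"
          by (intro always_eventually allI le1 f)
      qed (rule tendsto_const)
      from LIMSEQ_subseq_LIMSEQ[OF this r] show ?thesis by (simp add: o_def h_def)
    qed
    have Sh: "(\<lambda>n. adj X (X (h n))) \<longlonglongrightarrow> adj X l"
      unfolding h_def by (intro tendsto_intros l)
    \<comment> \<open>Expand the square, bound the norm of \<open>adj X (X (h n))\<close> by
      \<open>s\<^sup>2\<close>, and use that its inner product with \<open>h n\<close> is
      \<open>(norm (X (h n)))\<^sup>2\<close>. The right-hand side tends to 0, so \<open>h n\<close>
      converges along with \<open>adj X (X (h n))\<close>.\<close>
    have nrm: "(norm (adj X (X (h n)) - s\<^sup>2 *\<^sub>R h n))\<^sup>2 \<le> 2 * s ^ 4 - 2 * s\<^sup>2 * (norm (X (h n)))\<^sup>2" for n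
    proof -
      let ?g = "adj X (X (h n))"
      have "norm ?g \<le> s * norm (X (h n))"
        using h by (intro norm_adj_compose_le le inv s0)
      also have "\<dots> \<le> s * s" using h s0 by (intro mult_left_mono le1)
      finally have "(norm ?g)\<^sup>2 \<le> (s * s)\<^sup>2" by (intro power_mono) auto
      moreover have "(s\<^sup>2)\<^sup>2 * (norm (h n))\<^sup>2 \<le> (s\<^sup>2)\<^sup>2 * 1\<^sup>2"
        using h by (intro mult_left_mono power_mono) auto
      moreover have "(norm (a - t *\<^sub>R b))\<^sup>2 = (norm a)\<^sup>2 - 2 * t * inner a b + t\<^sup>2 * (norm b)\<^sup>2"
        for a b :: 'a and t
        unfolding power2_norm_eq_inner
        by (simp add: inner_diff_left inner_diff_right inner_commute[of b a] power2_eq_square algebra_simps)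
      moreover have "inner ?g (h n) = (norm (X (h n)))\<^sup>2"
        by (simp add: power2_norm_eq_inner flip: inner_adj')
      ultimately show ?thesis by (simp add: power2_eq_square power4_eq_xxxx)
    qed
    have "(\<lambda>n. 2 * s ^ 4 - 2 * s\<^sup>2 * (norm (X (h n)))\<^sup>2) \<longlonglongrightarrow> 2 * s ^ 4 - 2 * s\<^sup>2 * s\<^sup>2"
      by (intro tendsto_intros hs)
    then have "(\<lambda>n. 2 * s ^ 4 - 2 * s\<^sup>2 * (norm (X (h n)))\<^sup>2) \<longlonglongrightarrow> 0"
      by (simp add: power2_eq_square power4_eq_xxxx)
    then have "(\<lambda>n. (norm (adj X (X (h n)) - s\<^sup>2 *\<^sub>R h n))\<^sup>2) \<longlonglongrightarrow> 0"
      by (rule tendsto_sandwich[OF _ _ tendsto_const, rotated 2]) (use nrm in auto)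
    then have "(\<lambda>n. sqrt ((norm (adj X (X (h n)) - s\<^sup>2 *\<^sub>R h n))\<^sup>2)) \<longlonglongrightarrow> sqrt 0"
      by (intro tendsto_real_sqrt)
    then have "(\<lambda>n. adj X (X (h n)) - s\<^sup>2 *\<^sub>R h n) \<longlonglongrightarrow> 0"
      by (simp add: tendsto_norm_zero_iff)
    from tendsto_diff[OF Sh this] have "(\<lambda>n. s\<^sup>2 *\<^sub>R h n) \<longlonglongrightarrow> adj X l" by simp
    from tendsto_scaleR[OF tendsto_const[of "1 / s\<^sup>2"] this]
    have lim: "h \<longlonglongrightarrow> (1 / s\<^sup>2) *\<^sub>R adj X l" using sp by simp
    define e where "e = (1 / s\<^sup>2) *\<^sub>R adj X l"
    note lim = lim[folded e_def]
    have eM: "e \<in> M" using closed_sequentially[OF M(2) _ lim] h by blast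
    have "(\<lambda>n. norm (X (h n))) \<longlonglongrightarrow> norm (X e)" by (intro tendsto_intros lim)
    then have Xe: "norm (X e) = s" using hs LIMSEQ_unique by blast
    have "(\<lambda>n. norm (h n)) \<longlonglongrightarrow> norm e" by (intro tendsto_intros lim)
    then have "norm e \<le> 1" using h by (intro LIMSEQ_le_const2) auto
    moreover have "norm e \<ge> 1" using le[OF eM] Xe sp by simp
    ultimately have e1: "norm e = 1" by simp
    have "(\<lambda>n. adj X (X (h n))) \<longlonglongrightarrow> adj X (X e)" by (intro tendsto_intros lim)
    then have "adj X (X e) = adj X l" using Sh LIMSEQ_unique by blast
    also have "\<dots> = s\<^sup>2 *\<^sub>R e" using sp by (simp add: e_def)
    finally show ?thesis using e1 eM s0 le by blast
  qed
qed


section \<open>Singular value decomposition of compact operators\<close>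

lemma cmod_cinner_commute: "cmod (cinner x y) = cmod (cinner y x)"
  by (metis cinner_commute complex_mod_cnj)

text \<open>Only \<open>adj X o\<^sub>L X\<close> is diagonalised: the \<open>e n\<close> are right
  singular vectors and the \<open>s n\<close> singular values, the left ones being implicit in
  \<open>X (e n)\<close>. The assumption \<open>bound\<close> is the variational property:
  \<open>s n\<close> dominates \<open>X\<close> on the complement of the first \<open>n\<close>
  vectors.\<close>

locale svd =
  fixes X :: "'a::{complex_inner, banach} \<Rightarrow>\<^sub>L 'a" and e :: "nat \<Rightarrow> 'a" and s :: "nat \<Rightarrow> real"
  assumes clin: "clin X"
    and ortho: "ortho e"
    and vanish: "e n = 0 \<Longrightarrow> s n = 0"
    and nonneg: "0 \<le> s n"
    and dec: "decseq s"
    and lim: "s \<longlonglongrightarrow> 0"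
    and eig: "adj X (X (e n)) = (s n)\<^sup>2 *\<^sub>R e n"
    and bound: "(\<And>i. i < n \<Longrightarrow> cinner g (e i) = 0) \<Longrightarrow> norm (X g) \<le> s n * norm g"

text \<open>Greedy construction: \<open>e n\<close> maximises the norm of \<open>X\<close> on the
  complement of the earlier vectors, which is invariant because those are eigenvectors of
  \<open>adj X o\<^sub>L X\<close>.\<close>

theorem ex_svd:
  fixes X :: "'a::{complex_inner, banach} \<Rightarrow>\<^sub>L 'a"
  assumes clin: "clin X" and X: "compact_blinfun X"
  shows "\<exists>e s. svd X e s"
proof -
  define M where "M p n = {f. \<forall>i<n. cinner f (fst (p i) :: 'a) = 0}" for n :: nat and p :: "nat \<Rightarrow> 'a \<times> real"
  define Q where "Q p n r \<longleftrightarrow> (norm (fst r) = 1 \<or> fst r = 0 \<and> snd r = 0) \<and> fst r \<in> M p n \<and>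
    0 \<le> snd r \<and> adj X (X (fst r)) = (snd r)\<^sup>2 *\<^sub>R fst r \<and> (\<forall>g\<in>M p n. norm (X g) \<le> snd r * norm g)"
    for n and p and r :: "'a \<times> real"
  have "\<exists>p. \<forall>n. Q p n (p n)"
  proof (rule dependent_wellorder_choice[where P = Q])
    fix r and f g :: "nat \<Rightarrow> 'a \<times> real" and n assume "\<And>m::nat. m < n \<Longrightarrow> f m = g m"
    then have "M f n = M g n" by (simp add: M_def)
    then show "Q f n r = Q g n r" by (simp add: Q_def)
  next
    fix n and p :: "nat \<Rightarrow> 'a \<times> real" assume IH: "\<And>m::nat. m < n \<Longrightarrow> Q p m (p m)"
    have "subspace (M p n)"
      by (auto simp: M_def subspace_def cinner_add_left cinner_scaleR_left)
    moreover have "closed (M p n)"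
    proof -
      have "M p n = (\<Inter>i\<in>{..<n}. {f. inner f (fst (p i)) = 0} \<inter> {f. inner f (\<i> *\<^sub>C fst (p i)) = 0})"
        by (auto simp: M_def cinner_eq_zero_iff)
      then show ?thesis
        by (auto intro!: closed_INT closed_Int closed_Collect_eq continuous_intros)
    qed
    moreover have "adj X (X f) \<in> M p n" if f: "f \<in> M p n" for f
      unfolding M_def
    proof (intro CollectI allI impI)
      fix i assume "i < n"
      then have "cinner (adj X (X f)) (fst (p i)) = cinner f (adj X (X (fst (p i))))"
        by (simp add: cinner_adj[OF clin] flip: cinner_adj'[OF clin])
      also have "\<dots> = cinner f ((snd (p i))\<^sup>2 *\<^sub>R fst (p i))"
        using IH[OF \<open>i < n\<close>] by (simp add: Q_def)
      also have "\<dots> = 0" using f \<open>i < n\<close> by (simp add: M_def cinner_scaleR_right)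
      finally show "cinner (adj X (X f)) (fst (p i)) = 0" .
    qed
    ultimately obtain e s where "(norm e = 1 \<or> e = 0 \<and> s = 0) \<and> e \<in> M p n \<and> 0 \<le> s \<and>
        adj X (X e) = s\<^sup>2 *\<^sub>R e \<and> (\<forall>g\<in>M p n. norm (X g) \<le> s * norm g)"
      using ex_maximal_vector[OF X] by blast
    then have "Q p n (e, s)" by (simp add: Q_def)
    then show "\<exists>r. Q p n r" ..
  qed
  then obtain p where p: "\<And>n. Q p n (p n)" by blast
  define e where "e n = fst (p n)" for n
  define s where "s n = snd (p n)" for n
  have unit: "norm (e n) = 1 \<or> e n = 0 \<and> s n = 0" and s0: "0 \<le> s n"
    and eig: "adj X (X (e n)) = (s n)\<^sup>2 *\<^sub>R e n" for n
    using p[of n] by (auto simp: Q_def e_def s_def)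
  have orth: "cinner (e n) (e i) = 0" if "i < n" for i n
    using p[of n] that by (auto simp: Q_def e_def M_def)
  have bound: "norm (X g) \<le> s n * norm g" if "\<And>i. i < n \<Longrightarrow> cinner g (e i) = 0" for g n
    using p[of n] that by (auto simp: Q_def e_def s_def M_def)
  have orth': "cinner (e i) (e j) = 0" if "i \<noteq> j" for i j
  proof (cases "i < j")
    case True
    then show ?thesis using orth[of i j] cinner_commute[of "e i" "e j"] by simp
  qed (use that orth[of j i] in simp)
  have Xe: "norm (X (e n)) = s n" for n
  proof -
    have "(norm (X (e n)))\<^sup>2 = (s n)\<^sup>2 * (norm (e n))\<^sup>2"
      using eig[of n] by (simp add: power2_norm_eq_inner inner_adj)
    then have "(norm (X (e n)))\<^sup>2 = (s n)\<^sup>2" using unit[of n] by auto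
    then show ?thesis using s0[of n] by (simp add: power2_eq_iff_nonneg)
  qed
  have dec: "decseq s"
  proof (rule decseq_SucI)
    fix n
    have "s (Suc n) = norm (X (e (Suc n)))" by (simp add: Xe)
    also have "\<dots> \<le> s n * norm (e (Suc n))" by (intro bound orth) simp
    also have "\<dots> \<le> s n * 1" using unit[of "Suc n"] s0[of n] by (intro mult_left_mono) auto
    finally show "s (Suc n) \<le> s n" by simp
  qed
  then obtain c where c: "s \<longlonglongrightarrow> c" and cle: "\<And>n. c \<le> s n"
    using decseq_convergent[of s 0] s0 by metis
  \<comment> \<open>If \<open>c\<close> were positive, the images of the \<open>e n\<close> would be
    orthogonal with norms at least \<open>c\<close>, so pairwise at distance at least
    \<open>c\<close>, against compactness.\<close>
  have "c = 0"
  proof (rule ccontr)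
    assume "c \<noteq> 0"
    then have c0: "c > 0" using LIMSEQ_le_const[OF c] s0 by force
    then have s_pos: "s n > 0" for n using cle[of n] by linarith
    have e1: "norm (e n) = 1" for n using unit[of n] s_pos[of n] by auto
    then obtain r l where r: "strict_mono r" "(\<lambda>n. X (e (r n))) \<longlonglongrightarrow> l"
      using compact_blinfunE[OF X, of e] by auto
    from r(2) have "Cauchy (\<lambda>n. X (e (r n)))" using LIMSEQ_imp_Cauchy by blast
    then obtain N where N: "\<And>m n. m \<ge> N \<Longrightarrow> n \<ge> N \<Longrightarrow> norm (X (e (r m)) - X (e (r n))) < c"
      using c0 unfolding Cauchy_iff by meson
    let ?i = "r N" and ?j = "r (Suc N)"
    have ij: "?i \<noteq> ?j" using r(1) by (metis n_not_Suc_n strict_mono_eq)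
    have "inner (X (e ?i)) (X (e ?j)) = 0"
    proof -
      have "inner (X (e ?i)) (X (e ?j)) = inner (e ?i) (adj X (X (e ?j)))" by (simp add: inner_adj)
      also have "\<dots> = (s ?j)\<^sup>2 * Re (cinner (e ?i) (e ?j))" by (simp add: eig Re_cinner)
      finally show ?thesis using orth'[OF ij] by simp
    qed
    then have "(norm (X (e ?i) - X (e ?j)))\<^sup>2 = (s ?i)\<^sup>2 + (s ?j)\<^sup>2"
      by (simp add: Xe[symmetric] power2_norm_eq_inner inner_simps inner_commute)
    moreover have "c\<^sup>2 \<le> (s ?i)\<^sup>2" using cle[of ?i] c0 by (intro power_mono) auto
    ultimately have "c\<^sup>2 \<le> (norm (X (e ?i) - X (e ?j)))\<^sup>2"
      using zero_le_power2[of "s ?j"] by linarith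
    then have "c \<le> norm (X (e ?i) - X (e ?j))" by (rule power2_le_imp_le) simp
    moreover have "norm (X (e ?i) - X (e ?j)) < c" by (rule N) auto
    ultimately show False by simp
  qed
  with c have "s \<longlonglongrightarrow> 0" by simp
  moreover have "ortho e" using unit orth' by (auto simp: ortho_def)
  moreover have "s n = 0" if "e n = 0" for n using unit[of n] that by auto
  ultimately have "svd X e s"
    using clin s0 dec eig bound by unfold_locales auto
  then show ?thesis by blast
qed

context svd
begin

lemma norm_e: "e n = 0 \<or> norm (e n) = 1"
  using ortho by (auto simp: ortho_def)

lemma orth: "i \<noteq> j \<Longrightarrow> cinner (e i) (e j) = 0"
  using ortho by (auto simp: ortho_def)

lemma res_bound: "norm (X (f - cproj e n f)) \<le> s n * norm (f - cproj e n f)"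
  by (intro bound cproj_orth ortho)

lemma res_bound': "norm (X (f - cproj e n f)) \<le> s n * norm f"
  using res_bound[of f n] norm_res_le[OF ortho, of f n] nonneg[of n]
  by (meson mult_left_mono order_trans)

lemma inner_orthonormal:
  assumes "s n > 0" "i \<le> n" "j \<le> n"
  shows "inner (e i) (e j) = (if i = j then 1 else 0)"
proof (cases "i = j")
  case True
  have "s i > 0" using assms dec by (metis decseqD order_less_le_trans)
  then have "e i \<noteq> 0" using vanish[of i] by auto
  then have "norm (e i) = 1" using norm_e by blast
  then show ?thesis using True by (simp add: power2_norm_eq_inner[symmetric])
next
  case False
  then show ?thesis using orth[of i j] by (simp flip: Re_cinner)
qed

lemma norm_diagonal_ge:
  assumes n: "s n > 0" and t: "\<And>i. i \<le> n \<Longrightarrow> t \<le> a i" "0 \<le> t" and c: "(\<Sum>i\<le>n. (c i)\<^sup>2) = (1::real)"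
  shows "t \<le> norm (\<Sum>i\<le>n. c i *\<^sub>R (a i *\<^sub>R e i))"
proof -
  let ?f = "\<Sum>i\<le>n. c i *\<^sub>R (a i *\<^sub>R e i)"
  have "(norm ?f)\<^sup>2 = (\<Sum>i\<le>n. \<Sum>j\<le>n. (c i * a i) * ((c j * a j) * inner (e i) (e j)))"
    unfolding power2_norm_eq_inner inner_sum_left inner_sum_right
    by (simp add: mult_ac inner_commute)
  also have "\<dots> = (\<Sum>i\<le>n. \<Sum>j\<le>n. if i = j then (c i * a i)\<^sup>2 else 0)"
    by (intro sum.cong refl) (simp add: inner_orthonormal[OF n] power2_eq_square)
  also have "\<dots> = (\<Sum>i\<le>n. (c i)\<^sup>2 * (a i)\<^sup>2)" by (simp add: power_mult_distrib)
  also have "\<dots> \<ge> (\<Sum>i\<le>n. (c i)\<^sup>2 * t\<^sup>2)"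
    using t by (intro sum_mono mult_left_mono power_mono) auto
  also have "(\<Sum>i\<le>n. (c i)\<^sup>2 * t\<^sup>2) = t\<^sup>2" using c by (simp flip: sum_distrib_right)
  finally show ?thesis by (rule power2_le_imp_le) simp
qed

text \<open>Prepares \<open>apn_lower_bound\<close> for operators diagonal in \<open>e\<close>. If
  \<open>s n = 0\<close>, the vector \<open>e n\<close> may be zero and orthonormality fails, whence
  the last condition on \<open>t\<close>.\<close>

lemma le_apn:
  fixes Y :: "'a \<Rightarrow>\<^sub>L 'a"
  assumes Y: "\<And>i. i \<le> n \<Longrightarrow> Y (e i) = a i *\<^sub>R e i"
    and t: "s n > 0 \<Longrightarrow> t \<ge> 0" "\<And>i. s n > 0 \<Longrightarrow> i \<le> n \<Longrightarrow> t \<le> a i" "s n = 0 \<Longrightarrow> t \<le> 0"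
  shows "t \<le> apn n Y"
proof (cases "s n > 0")
  case True
  show ?thesis
  proof (rule apn_lower_bound[where e = e])
    show "inner (e i) (e j) = (if i = j then 1 else 0)" if "i \<le> n" "j \<le> n" for i j
      using inner_orthonormal[OF True that] .
    fix c :: "nat \<Rightarrow> real" assume "(\<Sum>i\<le>n. (c i)\<^sup>2) = 1"
    then have "t \<le> norm (\<Sum>i\<le>n. c i *\<^sub>R (a i *\<^sub>R e i))"
      using t True by (intro norm_diagonal_ge) auto
    then show "t \<le> norm (Y (\<Sum>i\<le>n. c i *\<^sub>R e i))"
      by (simp add: blinfun.sum_right blinfun.scaleR_right Y)
  qed
next
  case False
  then have "t \<le> 0" using t nonneg[of n] by simp
  then show ?thesis using apn_nonneg[of n Y] by linarith
qed

lemma power2_le_apn: "(s n)\<^sup>2 \<le> apn n (adj X o\<^sub>L X)"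
proof (rule le_apn[where a = "\<lambda>i. (s i)\<^sup>2"])
  show "(s n)\<^sup>2 \<le> (s i)\<^sup>2" if "i \<le> n" for i
    using dec nonneg that by (intro power_mono) (auto dest: decseqD)
qed (auto simp: eig)

text \<open>Approximate by \<open>X o\<^sub>L cproj e n\<close>. The index doubles because
  \<open>n\<close> complex dimensions are \<open>2 * n\<close> real ones.\<close>

lemma apn_le_s: "apn (n + n) X \<le> s n"
proof -
  have "apn (n + n) X \<le> norm (X - (X o\<^sub>L cproj e n))"
    using rank_le_cproj[of n e] by (intro apn_le rank_le_compose_left) (simp add: mult_2)
  also have "\<dots> \<le> s n"
    by (rule norm_blinfun_bound[OF nonneg])
       (use res_bound' in \<open>simp add: minus_blinfun.rep_eq blinfun.diff_right\<close>)
  finally show ?thesis .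
qed

lemma s_le_apn: "s n \<le> apn n X"
proof -
  have "s n \<le> norm (X (\<Sum>i\<le>n. c i *\<^sub>R e i))" if "s n > 0" "(\<Sum>i\<le>n. (c i)\<^sup>2) = 1" for c
  proof -
    let ?f = "\<Sum>i\<le>n. c i *\<^sub>R e i"
    have "adj X (X ?f) = (\<Sum>i\<le>n. c i *\<^sub>R ((s i)\<^sup>2 *\<^sub>R e i))"
      by (simp add: blinfun.sum_right blinfun.scaleR_right eig)
    then have "(norm (X ?f))\<^sup>2 = (\<Sum>i\<le>n. \<Sum>j\<le>n. c i * (s i)\<^sup>2 * (c j * inner (e j) (e i)))"
      by (simp add: power2_norm_eq_inner inner_adj inner_sum_left inner_sum_right sum_distrib_left)
    also have "\<dots> = (\<Sum>j\<le>n. \<Sum>i\<le>n. if i = j then (c j)\<^sup>2 * (s j)\<^sup>2 else 0)"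
      by (intro sum.cong refl) (simp add: inner_orthonormal[OF that(1)] power2_eq_square)
    also have "\<dots> = (\<Sum>j\<le>n. (c j)\<^sup>2 * (s j)\<^sup>2)" by simp
    also have "\<dots> \<ge> (\<Sum>j\<le>n. (c j)\<^sup>2 * (s n)\<^sup>2)"
      using dec nonneg by (intro sum_mono mult_left_mono power_mono) (auto dest: decseqD)
    also have "(\<Sum>j\<le>n. (c j)\<^sup>2 * (s n)\<^sup>2) = (s n)\<^sup>2" using that(2) by (simp flip: sum_distrib_right)
    finally show ?thesis by (rule power2_le_imp_le) simp
  qed
  then have "s n \<le> apn n X" if "s n > 0"
    using that inner_orthonormal by (intro apn_lower_bound[where e = e]) auto
  then show ?thesis using nonneg[of n] apn_nonneg[of n X] by force
qed

text \<open>The residual is orthogonal to the eigenvectors of \<open>adj X o\<^sub>L X\<close>, so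
  the images of the projection and of the residual are orthogonal as well.\<close>

lemma norm_split:
  "(norm (X f))\<^sup>2 = (\<Sum>i<n. (s i)\<^sup>2 * (cmod (cinner f (e i)))\<^sup>2) + (norm (X (f - cproj e n f)))\<^sup>2"
proof -
  let ?p = "cproj e n f" and ?r = "f - cproj e n f"
  have Sp: "adj X (X ?p) = (\<Sum>i<n. (complex_of_real ((s i)\<^sup>2) * cinner f (e i)) *\<^sub>C e i)"
    by (simp only: cproj_apply blinfun.sum_right clinD[OF clin] clinD[OF clin_adj[OF clin]] eig
        scaleC_of_real[symmetric] scaleC_scaleC mult.commute)
  have "inner ?r (adj X (X ?p)) = 0"
  proof -
    have "cinner ?r (adj X (X ?p)) = 0"
      unfolding Sp cinner_sum_right cinner_scaleC_right
      by (intro sum.neutral) (simp add: cproj_orth[OF ortho])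
    then show ?thesis by (simp flip: Re_cinner)
  qed
  then have 1: "inner (X ?r) (X ?p) = 0" by (simp add: inner_adj)
  have pe: "cinner ?p (e i) = cinner f (e i)" if "i < n" for i
    using cproj_orth[OF ortho that, of f] by (simp add: cinner_diff_left)
  have "cinner ?p (adj X (X ?p)) = complex_of_real (\<Sum>i<n. (s i)\<^sup>2 * (cmod (cinner f (e i)))\<^sup>2)"
    unfolding Sp cinner_sum_right cinner_scaleC_right of_real_sum
    by (intro sum.cong refl) (simp add: pe complex_norm_square mult_ac del: of_real_power)
  then have "inner ?p (adj X (X ?p)) = (\<Sum>i<n. (s i)\<^sup>2 * (cmod (cinner f (e i)))\<^sup>2)"
    by (metis Re_cinner Re_complex_of_real)
  then have 2: "(norm (X ?p))\<^sup>2 = (\<Sum>i<n. (s i)\<^sup>2 * (cmod (cinner f (e i)))\<^sup>2)"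
    by (simp add: power2_norm_eq_inner inner_adj)
  have "X f = X ?p + X ?r" by (simp flip: blinfun.add_right)
  then have "(norm (X f))\<^sup>2 = (norm (X ?p))\<^sup>2 + (norm (X ?r))\<^sup>2"
    using 1 by (simp only: power2_norm_eq_inner inner_add_left inner_add_right inner_commute[of "X ?p" "X ?r"])
  then show ?thesis using 2 by simp
qed

lemma schatten_sum_le: "schatten_sum p N X \<le> 2 * (\<Sum>n<N. s n ^ p)"
  by (intro order_trans[OF schatten_sum_even_terms] mult_left_mono sum_mono power_mono apn_le_s) auto

end

text \<open>Counterpart of \<open>schatten_sum_compose\<close>: the singular values of
  \<open>adj X o\<^sub>L X\<close> are the squares of those of \<open>X\<close>, so a bound with
  exponent \<open>p\<close> becomes one with exponent \<open>2 * p\<close>.\<close>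

lemma schatten_sum_square:
  fixes X :: "'a::{complex_inner, banach} \<Rightarrow>\<^sub>L 'a"
  assumes "clin X" "compact_blinfun X"
  shows "schatten_sum (2 * p) N X \<le> 2 * schatten_sum p N (adj X o\<^sub>L X)"
proof -
  obtain e s where "svd X e s" using ex_svd[OF assms] by blast
  then interpret svd X e s .
  have "schatten_sum (2 * p) N X \<le> 2 * (\<Sum>n<N. s n ^ (2 * p))" by (rule schatten_sum_le)
  also have "\<dots> \<le> 2 * schatten_sum p N (adj X o\<^sub>L X)"
    unfolding schatten_sum_def power_mult
    by (intro mult_left_mono sum_mono power_mono power2_le_apn) auto
  finally show ?thesis .
qed

text \<open>The Hilbert-Schmidt sum can be computed in any orthonormal basis. The vectors
  \<open>e n\<close> with \<open>s n > 0\<close> lie in the span of \<open>u\<close>, because the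
  range of \<open>adj X\<close> does.\<close>

lemma schatten_sum_2_le:
  fixes X :: "'a::{complex_inner, banach} \<Rightarrow>\<^sub>L 'a"
  assumes X: "clin X" "compact_blinfun X" and u: "ortho u" and XP: "X o\<^sub>L cproj u N = X"
  shows "schatten_sum 2 M X \<le> 2 * (\<Sum>j<N. (norm (X (u j)))\<^sup>2)"
proof -
  obtain e s where "svd X e s" using ex_svd[OF X] by blast
  then interpret svd X e s .
  have eP: "(s n)\<^sup>2 = (\<Sum>j<N. (s n)\<^sup>2 * (cmod (cinner (u j) (e n)))\<^sup>2)" for n
  proof (cases "s n = 0")
    case False
    have "cproj u N (adj X g) = adj X g" for g
      using arg_cong[OF XP, of adj] by (metis adj_compose adj_cproj blinfun_apply_blinfun_compose)
    then have "(s n)\<^sup>2 *\<^sub>R cproj u N (e n) = (s n)\<^sup>2 *\<^sub>R e n"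
      by (metis eig blinfun.scaleR_right)
    then have "cproj u N (e n) = e n" using False by simp
    then have "(norm (e n))\<^sup>2 = (\<Sum>j<N. (cmod (cinner (e n) (u j)))\<^sup>2)"
      using norm_cproj[OF u, of N "e n"] by simp
    moreover have "norm (e n) = 1" using norm_e vanish False by blast
    moreover have "cmod (cinner (e n) (u j)) = cmod (cinner (u j) (e n))" for j
      by (rule cmod_cinner_commute)
    ultimately show ?thesis by (simp flip: sum_distrib_left)
  qed simp
  have "(\<Sum>n<M. (s n)\<^sup>2) = (\<Sum>j<N. \<Sum>n<M. (s n)\<^sup>2 * (cmod (cinner (u j) (e n)))\<^sup>2)"
    by (subst sum.swap) (intro sum.cong refl eP)
  also have "\<dots> \<le> (\<Sum>j<N. (norm (X (u j)))\<^sup>2)"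
  proof (rule sum_mono)
    show "(\<Sum>n<M. (s n)\<^sup>2 * (cmod (cinner (u j) (e n)))\<^sup>2) \<le> (norm (X (u j)))\<^sup>2" for j
      using norm_split[of "u j" M] by simp
  qed
  finally show ?thesis using schatten_sum_le[of 2 M] by simp
qed

text \<open>For the reverse comparison Bessel's inequality suffices, so \<open>u\<close> may be any
  orthonormal system. The rank bound makes \<open>s M\<close> vanish, hence the first
  \<open>M\<close> singular values describe \<open>X\<close> completely.\<close>

lemma sum_norm_le_schatten_sum_2:
  fixes X :: "'a::{complex_inner, banach} \<Rightarrow>\<^sub>L 'a"
  assumes X: "clin X" "rank_le M X" and u: "ortho u"
  shows "(\<Sum>j<N. (norm (X (u j)))\<^sup>2) \<le> schatten_sum 2 M X"
proof -
  obtain e s where "svd X e s" using ex_svd[OF X(1) compact_blinfun_rank_le[OF X(2)]] by blast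
  then interpret svd X e s .
  have "s M = 0" using s_le_apn[of M] nonneg[of M] apn_rank[OF X(2)] by simp
  then have "X (f - cproj e M f) = 0" for f using res_bound[of f M] by simp
  then have split: "(norm (X f))\<^sup>2 = (\<Sum>n<M. (s n)\<^sup>2 * (cmod (cinner f (e n)))\<^sup>2)" for f
    using norm_split[of f M] by simp
  have "(\<Sum>j<N. (norm (X (u j)))\<^sup>2) = (\<Sum>j<N. \<Sum>n<M. (s n)\<^sup>2 * (cmod (cinner (u j) (e n)))\<^sup>2)"
    by (simp add: split)
  also have "\<dots> = (\<Sum>n<M. (s n)\<^sup>2 * (\<Sum>j<N. (cmod (cinner (e n) (u j)))\<^sup>2))"
    unfolding sum_distrib_left
    by (subst sum.swap) (intro sum.cong refl arg_cong2[of _ _ _ _ "(*)"] arg_cong[of _ _ "\<lambda>x. x\<^sup>2"]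
        cmod_cinner_commute)
  also have "\<dots> \<le> (\<Sum>n<M. (apn n X)\<^sup>2 * 1)"
  proof (intro sum_mono mult_mono power_mono s_le_apn)
    fix n
    have "(\<Sum>j<N. (cmod (cinner (e n) (u j)))\<^sup>2) \<le> (norm (e n))\<^sup>2" by (rule bessel[OF u])
    also have "\<dots> \<le> 1" using norm_e[of n] by auto
    finally show "(\<Sum>j<N. (cmod (cinner (e n) (u j)))\<^sup>2) \<le> 1" .
  qed (auto intro: nonneg sum_nonneg)
  finally show ?thesis by (simp add: schatten_sum_def)
qed


section \<open>Triangular operators\<close>

text \<open>Operators of the finite-dimensional space spanned by \<open>u 0, ..., u (N - 1)\<close>,
  extended by zero to the orthogonal complement; this keeps the type fixed while \<open>N\<close>
  varies.\<close>

definition on_span :: "(nat \<Rightarrow> 'a::complex_inner) \<Rightarrow> nat \<Rightarrow> ('a \<Rightarrow>\<^sub>L 'a) \<Rightarrow> bool" where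
  "on_span u N X \<longleftrightarrow> clin X \<and> cproj u N o\<^sub>L X = X \<and> X o\<^sub>L cproj u N = X"

lemma blinfun_compose_assoc: "(X o\<^sub>L Y) o\<^sub>L Z = X o\<^sub>L (Y o\<^sub>L Z)"
  by (rule blinfun_eqI) simp

lemma on_span_compose: "on_span u N X \<Longrightarrow> on_span u N Y \<Longrightarrow> on_span u N (X o\<^sub>L Y)"
  unfolding on_span_def by (metis blinfun_compose_assoc clin_compose)

lemma blinfun_compose_add_left: "(X + Y) o\<^sub>L Z = (X o\<^sub>L Z) + (Y o\<^sub>L Z)"
  by (rule blinfun_eqI) (simp add: plus_blinfun.rep_eq)

lemma blinfun_compose_add_right: "X o\<^sub>L (Y + Z) = (X o\<^sub>L Y) + (X o\<^sub>L Z)"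
  by (rule blinfun_eqI) (simp add: plus_blinfun.rep_eq blinfun.add_right)

lemma blinfun_compose_diff_left: "(X - Y) o\<^sub>L Z = (X o\<^sub>L Z) - (Y o\<^sub>L Z)"
  by (rule blinfun_eqI) (simp add: minus_blinfun.rep_eq)

lemma blinfun_compose_diff_right: "X o\<^sub>L (Y - Z) = (X o\<^sub>L Y) - (X o\<^sub>L Z)"
  by (rule blinfun_eqI) (simp add: minus_blinfun.rep_eq blinfun.diff_right)

lemmas blinfun_compose_simps = blinfun_compose_add_left blinfun_compose_add_right
  blinfun_compose_diff_left blinfun_compose_diff_right

lemma on_span_add: "on_span u N X \<Longrightarrow> on_span u N Y \<Longrightarrow> on_span u N (X + Y)"
  by (simp add: on_span_def clin_add blinfun_compose_simps)

lemma on_span_diff: "on_span u N X \<Longrightarrow> on_span u N Y \<Longrightarrow> on_span u N (X - Y)"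
  by (simp add: on_span_def clin_diff blinfun_compose_simps)

lemma on_span_adj: "on_span u N X \<Longrightarrow> on_span u N (adj (X :: 'a::{complex_inner, banach} \<Rightarrow>\<^sub>L 'a))"
  unfolding on_span_def by (metis adj_compose adj_cproj clin_adj)

lemma on_span_rank_le: "on_span u N X \<Longrightarrow> rank_le (2 * N) X"
  unfolding on_span_def by (metis rank_le_cproj rank_le_compose_left)

lemma on_span_norm:
  assumes "ortho u" "on_span u N X"
  shows "(norm (X f))\<^sup>2 = (\<Sum>i<N. (cmod (cinner (X f) (u i)))\<^sup>2)"
proof -
  have "cproj u N (X f) = X f"
    using assms(2) by (metis on_span_def blinfun_apply_blinfun_compose)
  then show ?thesis using norm_cproj[OF assms(1), of N "X f"] by simp
qed

section \<open>Diagonal operators and diagonals of operators\<close>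

definition diag_op :: "(nat \<Rightarrow> 'a::complex_inner) \<Rightarrow> nat \<Rightarrow> (nat \<Rightarrow> complex) \<Rightarrow> ('a \<Rightarrow>\<^sub>L 'a)" where
  "diag_op u N d = (\<Sum>j<N. crank1 (u j) (d j *\<^sub>C u j))"

lemma diag_op_apply: "diag_op u N d f = (\<Sum>j<N. (d j * cinner f (u j)) *\<^sub>C u j)"
  by (simp add: diag_op_def blinfun_sum_apply scaleC_scaleC mult.commute)

lemma clin_diag_op: "clin (diag_op u N d)"
  unfolding diag_op_def by (intro clin_sum clin_crank1)

lemma adj_diag_op:
  fixes u :: "nat \<Rightarrow> 'a::{complex_inner, banach}"
  shows "adj (diag_op u N d) = diag_op u N (\<lambda>j. cnj (d j))"
  by (rule clin_adj_eqI)
     (simp add: diag_op_apply cinner_sum_left cinner_sum_right cinner_scaleC_left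
        cinner_scaleC_right mult_ac flip: cinner_commute[of "u _"])

lemma diag_op_diff: "diag_op u N c - diag_op u N d = diag_op u N (\<lambda>j. c j - d j)"
  by (rule blinfun_eqI)
     (simp add: minus_blinfun.rep_eq diag_op_apply left_diff_distrib scaleC_diff_left sum_subtractf)

lemma diag_op_cinner:
  assumes "ortho u" "i < N"
  shows "cinner (diag_op u N d f) (u i) = d i * cinner f (u i)"
  using assms(2)
  by (simp add: diag_op_apply ortho_sum[OF assms(1)] cinner_self_mult[OF assms(1)] mult.assoc)

lemma diag_op_unit:
  assumes u: "ortho u" and "i < N"
  shows "diag_op u N d (u i) = d i *\<^sub>C u i"
proof -
  have "diag_op u N d (u i) = (\<Sum>j<N. if j = i then (d i * cinner (u i) (u i)) *\<^sub>C u i else 0)"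
    unfolding diag_op_apply using u by (intro sum.cong) (auto simp: ortho_def)
  then show ?thesis using assms by (simp add: ortho_scale flip: scaleC_scaleC)
qed

lemma on_span_diag_op:
  assumes u: "ortho u"
  shows "on_span u N (diag_op u N d)"
  unfolding on_span_def
proof (intro conjI clin_diag_op blinfun_eqI)
  fix f
  have 1: "cproj u N (u i) = u i" if "i < N" for i using cproj_fix[OF u that] .
  show "(cproj u N o\<^sub>L diag_op u N d) f = diag_op u N d f"
    by (simp add: diag_op_apply blinfun.sum_right clinD[OF clin_cproj] 1)
  have 2: "cinner (cproj u N f) (u i) = cinner f (u i)" if "i < N" for i
    using cproj_orth[OF u that, of f] by (simp add: cinner_diff_left)
  show "(diag_op u N d o\<^sub>L cproj u N) f = diag_op u N d f"
    by (simp add: diag_op_apply 2)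
qed

lemma diag_op_compose:
  assumes u: "ortho u"
  shows "diag_op u N c o\<^sub>L diag_op u N d = diag_op u N (\<lambda>j. c j * d j)"
  by (rule blinfun_eqI)
     (simp add: diag_op_apply[of u N c] diag_op_apply[of u N "\<lambda>j. c j * d j"] diag_op_cinner[OF u] mult.assoc)

lemma norm_diag_op_le:
  assumes u: "ortho u" and d: "\<And>j. j < N \<Longrightarrow> cmod (d j) \<le> c" and c: "0 \<le> c"
  shows "norm (diag_op u N d) \<le> c"
proof (rule norm_blinfun_bound[OF c])
  fix f
  have "(norm (diag_op u N d f))\<^sup>2 = (\<Sum>i<N. (cmod (d i))\<^sup>2 * (cmod (cinner f (u i)))\<^sup>2)"
    by (simp add: on_span_norm[OF u on_span_diag_op[OF u]] diag_op_cinner[OF u] norm_mult power_mult_distrib)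
  also have "\<dots> \<le> (\<Sum>i<N. c\<^sup>2 * (cmod (cinner f (u i)))\<^sup>2)"
    using d by (intro sum_mono mult_right_mono power_mono) auto
  also have "\<dots> \<le> c\<^sup>2 * (norm f)\<^sup>2"
    unfolding sum_distrib_left[symmetric] by (intro mult_left_mono bessel u) simp
  also have "\<dots> = (c * norm f)\<^sup>2" by (simp add: power_mult_distrib)
  finally show "norm (diag_op u N d f) \<le> c * norm f"
    by (rule power2_le_imp_le) (use c in simp)
qed

lemma norm_ortho_le: "ortho u \<Longrightarrow> norm (u j) \<le> 1"
  unfolding ortho_def by (metis norm_zero order_refl zero_le_one)

text \<open>For a diagonal operator \<open>D\<close>, the product \<open>adj D o\<^sub>L D\<close>
  is diagonal with the squared moduli as entries, which doubles the exponent starting from the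
  Hilbert-Schmidt case. The constant depends on \<open>k\<close> alone; such uniformity is essential
  because \<open>N\<close> will tend to infinity.\<close>

lemma schatten_sum_diag_op:
  "\<exists>C\<ge>0. \<forall>(u :: nat \<Rightarrow> 'a::{complex_inner, banach}) N M d. ortho u \<longrightarrow>
    schatten_sum (2 ^ Suc k) M (diag_op u N d) \<le> C * (\<Sum>j<N. cmod (d j) ^ (2 ^ Suc k))"
proof (induction k)
  case 0
  have "schatten_sum 2 M (diag_op u N d) \<le> 2 * (\<Sum>j<N. (cmod (d j))\<^sup>2)"
    if u: "ortho u" for u :: "nat \<Rightarrow> 'a" and N M d
  proof -
    have X: "on_span u N (diag_op u N d)" using on_span_diag_op[OF u] .
    have "schatten_sum 2 M (diag_op u N d) \<le> 2 * (\<Sum>j<N. (norm (diag_op u N d (u j)))\<^sup>2)"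
      using X by (intro schatten_sum_2_le u clin_diag_op)
        (auto simp: on_span_def intro: compact_blinfun_rank_le on_span_rank_le[OF X])
    also have "\<dots> \<le> 2 * (\<Sum>j<N. (cmod (d j))\<^sup>2)"
    proof (intro mult_left_mono sum_mono power_mono)
      show "norm (diag_op u N d (u j)) \<le> cmod (d j)" if "j \<in> {..<N}" for j
        using that norm_ortho_le[OF u, of j]
        by (simp add: diag_op_unit[OF u] norm_scaleC mult_left_le)
    qed auto
    finally show ?thesis .
  qed
  then show ?case by (intro exI[of _ 2]) simp
next
  case (Suc k)
  then obtain C where C: "C \<ge> 0" and IH: "\<And>(u :: nat \<Rightarrow> 'a) N M d. ortho u \<Longrightarrow>
    schatten_sum (2 ^ Suc k) M (diag_op u N d) \<le> C * (\<Sum>j<N. cmod (d j) ^ (2 ^ Suc k))" by blast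
  have "schatten_sum (2 ^ Suc (Suc k)) M (diag_op u N d)
      \<le> 2 * C * (\<Sum>j<N. cmod (d j) ^ (2 ^ Suc (Suc k)))"
    if u: "ortho u" for u :: "nat \<Rightarrow> 'a" and N M d
  proof -
    let ?D = "diag_op u N d"
    have "schatten_sum (2 * 2 ^ Suc k) M ?D \<le> 2 * schatten_sum (2 ^ Suc k) M (adj ?D o\<^sub>L ?D)"
      by (intro schatten_sum_square clin_diag_op
          compact_blinfun_rank_le[OF on_span_rank_le[OF on_span_diag_op[OF u]]])
    also have "adj ?D o\<^sub>L ?D = diag_op u N (\<lambda>j. cnj (d j) * d j)"
      by (simp add: adj_diag_op diag_op_compose[OF u])
    also have "schatten_sum (2 ^ Suc k) M \<dots> \<le> C * (\<Sum>j<N. cmod (cnj (d j) * d j) ^ (2 ^ Suc k))"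
      by (rule IH[OF u])
    also have "\<dots> = C * (\<Sum>j<N. cmod (d j) ^ (2 * 2 ^ Suc k))"
      by (simp only: norm_mult complex_mod_cnj power_mult power2_eq_square)
    finally show ?thesis by simp
  qed
  then show ?case using C by (intro exI[of _ "2 * C"]) auto
qed

text \<open>The exponent is doubled by \<open>\<bar>\<langle>X u, u\<rangle>\<bar>\<^sup>2 \<le> \<langle>X\<^sup>* X u, u\<rangle>\<close>.\<close>

lemma sum_diagonal_le:
  "\<exists>C\<ge>0. \<forall>(u :: nat \<Rightarrow> 'a::{complex_inner, banach}) N M X. ortho u \<longrightarrow> clin X \<longrightarrow> rank_le M X \<longrightarrow>
    (\<Sum>j<N. cmod (cinner (X (u j)) (u j)) ^ (2 ^ Suc k)) \<le> C * schatten_sum (2 ^ Suc k) M X"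
proof (induction k)
  case 0
  have "(\<Sum>j<N. (cmod (cinner (X (u j)) (u j)))\<^sup>2) \<le> schatten_sum 2 M X"
    if "ortho u" "clin X" "rank_le M X" for u :: "nat \<Rightarrow> 'a" and N M X
  proof -
    have "cmod (cinner (X (u j)) (u j)) \<le> norm (X (u j))" for j
      using norm_ortho_le[OF that(1)] by (rule order_trans[OF norm_cinner_le mult_left_le]) simp
    then have "(\<Sum>j<N. (cmod (cinner (X (u j)) (u j)))\<^sup>2) \<le> (\<Sum>j<N. (norm (X (u j)))\<^sup>2)"
      by (intro sum_mono power_mono) auto
    also have "\<dots> \<le> schatten_sum 2 M X" using that by (intro sum_norm_le_schatten_sum_2)
    finally show ?thesis .
  qed
  then show ?case by (intro exI[of _ 1]) simp
next
  case (Suc k)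
  then obtain C where C: "C \<ge> 0" and IH: "\<And>(u :: nat \<Rightarrow> 'a) N M X. ortho u \<Longrightarrow> clin X \<Longrightarrow> rank_le M X \<Longrightarrow>
    (\<Sum>j<N. cmod (cinner (X (u j)) (u j)) ^ (2 ^ Suc k)) \<le> C * schatten_sum (2 ^ Suc k) M X" by blast
  have "(\<Sum>j<N. cmod (cinner (X (u j)) (u j)) ^ (2 ^ Suc (Suc k)))
      \<le> C * 2 * schatten_sum (2 ^ Suc (Suc k)) M X"
    if u: "ortho u" and X: "clin X" "rank_le M X" for u :: "nat \<Rightarrow> 'a" and N M X
  proof -
    have le: "(cmod (cinner (X (u j)) (u j)))\<^sup>2 \<le> cmod (cinner ((adj X o\<^sub>L X) (u j)) (u j))" for j
    proof -
      have "cinner ((adj X o\<^sub>L X) (u j)) (u j) = complex_of_real ((norm (X (u j)))\<^sup>2)"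
        by (simp add: cinner_self flip: cinner_adj'[OF X(1)])
      moreover have "cmod (cinner (X (u j)) (u j)) \<le> norm (X (u j))"
        using norm_ortho_le[OF u] by (rule order_trans[OF norm_cinner_le mult_left_le]) simp
      ultimately show ?thesis by (simp add: power_mono norm_power)
    qed
    have "(\<Sum>j<N. cmod (cinner (X (u j)) (u j)) ^ (2 * 2 ^ Suc k))
        \<le> (\<Sum>j<N. cmod (cinner ((adj X o\<^sub>L X) (u j)) (u j)) ^ (2 ^ Suc k))"
      unfolding power_mult by (intro sum_mono power_mono le) auto
    also have "\<dots> \<le> C * schatten_sum (2 ^ Suc k) M (adj X o\<^sub>L X)"
      by (intro IH u clin_compose clin_adj X rank_le_compose_left)
    also have "\<dots> \<le> C * (2 * (sqrt (schatten_sum (2 * 2 ^ Suc k) M (adj X))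
        * sqrt (schatten_sum (2 * 2 ^ Suc k) M X)))"
      by (intro mult_left_mono schatten_sum_compose C)
    also have "\<dots> = C * 2 * schatten_sum (2 * 2 ^ Suc k) M X" by simp
    finally show ?thesis by simp
  qed
  then show ?case using C by (intro exI[of _ "C * 2"]) auto
qed

definition strictly_upper :: "(nat \<Rightarrow> 'a::complex_inner) \<Rightarrow> nat \<Rightarrow> ('a \<Rightarrow>\<^sub>L 'a) \<Rightarrow> bool" where
  "strictly_upper u N T \<longleftrightarrow> on_span u N T \<and> (\<forall>i<N. \<forall>j\<le>i. cinner (T (u j)) (u i) = 0)"

lemma strictly_upper_compose:
  assumes u: "ortho u" and S: "strictly_upper u N S" and T: "strictly_upper u N T"
  shows "strictly_upper u N (S o\<^sub>L T)"
  unfolding strictly_upper_def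
proof (intro conjI allI impI)
  show "on_span u N (S o\<^sub>L T)" using S T by (simp add: strictly_upper_def on_span_compose)
  fix i j assume i: "i < N" and j: "j \<le> i"
  have "S (cproj u N f) = (\<Sum>k<N. cinner f (u k) *\<^sub>C S (u k))" for f
    using S by (simp add: cproj_apply blinfun.sum_right clinD strictly_upper_def on_span_def)
  moreover have "cproj u N (T (u j)) = T (u j)"
    using T by (metis strictly_upper_def on_span_def blinfun_apply_blinfun_compose)
  ultimately have "S (T (u j)) = (\<Sum>k<N. cinner (T (u j)) (u k) *\<^sub>C S (u k))"
    by metis
  then have "cinner ((S o\<^sub>L T) (u j)) (u i) = (\<Sum>k<N. cinner (T (u j)) (u k) * cinner (S (u k)) (u i))"
    by (simp add: cinner_sum_left cinner_scaleC_left)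
  \<comment> \<open>For \<open>j \<le> k\<close> the first factor vanishes, for
    \<open>k < j \<le> i\<close> the second.\<close>
  also have "\<dots> = 0"
  proof (intro sum.neutral ballI)
    fix k assume "k \<in> {..<N}"
    then show "cinner (T (u j)) (u k) * cinner (S (u k)) (u i) = 0"
      using S T i j by (cases "j \<le> k") (auto simp: strictly_upper_def)
  qed
  finally show "cinner ((S o\<^sub>L T) (u j)) (u i) = 0" .
qed

text \<open>With \<open>B = T - T\<^sup>*\<close>, the exponent is doubled by applying the previous estimate to \<open>T\<^sup>2\<close>,
  because \<open>T\<^sup>2 - (T\<^sup>*)\<^sup>2 = T B + B T - B\<^sup>2\<close> and \<open>T\<^sup>* T = T\<^sup>2 - B T\<close>.\<close>

lemma strictly_upper_bound:
  "\<exists>C\<ge>0. \<forall>(u :: nat \<Rightarrow> 'a::{complex_inner, banach}) N M T. ortho u \<longrightarrow> strictly_upper u N T \<longrightarrow>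
    2 * N \<le> M \<longrightarrow> schatten_sum (2 ^ Suc k) M T \<le> C * schatten_sum (2 ^ Suc k) M (T - adj T)"
proof (induction k)
  case 0
  have "schatten_sum 2 M T \<le> 2 * schatten_sum 2 M (T - adj T)"
    if u: "ortho u" and T: "strictly_upper u N T" and M: "2 * N \<le> M"
    for u :: "nat \<Rightarrow> 'a" and N M T
  proof -
    let ?B = "T - adj T"
    have Ts: "on_span u N T" using T by (simp add: strictly_upper_def)
    then have Bs: "on_span u N ?B" by (intro on_span_diff on_span_adj)
    have cT: "clin T" using Ts by (simp add: on_span_def)
    have "schatten_sum 2 M T \<le> 2 * (\<Sum>j<N. (norm (T (u j)))\<^sup>2)"
      using Ts by (intro schatten_sum_2_le u compact_blinfun_rank_le[OF on_span_rank_le[OF Ts]])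
        (auto simp: on_span_def)
    \<comment> \<open>\<open>T\<close> and \<open>adj T\<close> have no nonzero matrix position in
      common, so every nonzero entry of \<open>T\<close> is found unchanged in
      \<open>?B\<close>.\<close>
    also have "(\<Sum>j<N. (norm (T (u j)))\<^sup>2) \<le> (\<Sum>j<N. (norm (?B (u j)))\<^sup>2)"
      unfolding on_span_norm[OF u Ts] on_span_norm[OF u Bs]
    proof (intro sum_mono power_mono)
      fix i j assume "j \<in> {..<N}" "i \<in> {..<N}"
      then have ij: "i < N" "j < N" by auto
      have "cinner (adj T (u j)) (u i) = cnj (cinner (T (u i)) (u j))"
        by (simp add: cinner_adj'[OF cT, symmetric] flip: cinner_commute)
      then have B: "cinner (?B (u j)) (u i) = cinner (T (u j)) (u i) - cnj (cinner (T (u i)) (u j))"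
        by (simp add: minus_blinfun.rep_eq cinner_diff_left)
      show "cmod (cinner (T (u j)) (u i)) \<le> cmod (cinner (?B (u j)) (u i))"
        unfolding B using T ij by (cases "j \<le> i") (auto simp: strictly_upper_def)
    qed auto
    also have "\<dots> \<le> schatten_sum 2 M ?B"
      using Bs rank_le_mono[OF on_span_rank_le[OF Bs] M]
      by (intro sum_norm_le_schatten_sum_2 u) (auto simp: on_span_def)
    finally show ?thesis by simp
  qed
  then show ?case by (intro exI[of _ 2]) simp
next
  case (Suc k)
  define p :: nat where "p = 2 ^ Suc k"
  define q :: real where "q = 2 * 2 ^ p"
  have q: "q \<ge> 0" by (simp add: q_def)
  obtain C where C: "C \<ge> 0" and IH: "\<And>(u :: nat \<Rightarrow> 'a) N M T. ortho u \<Longrightarrow> strictly_upper u N T \<Longrightarrow>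
    2 * N \<le> M \<Longrightarrow> schatten_sum p M T \<le> C * schatten_sum p M (T - adj T)"
    using Suc.IH unfolding p_def by blast
  \<comment> \<open>\<open>\<alpha>\<close> and \<open>\<beta>\<close> are the coefficients of
    \<open>x * b\<close> and \<open>b\<^sup>2\<close> that result from multiplying out the bound on
    \<open>adj T o\<^sub>L T\<close> below.\<close>
  define \<alpha> where "\<alpha> = 8 * C * q ^ 3 + 4 * q"
  define \<beta> where "\<beta> = 4 * C * q\<^sup>2"
  have "schatten_sum (2 * p) M T \<le> (\<alpha>\<^sup>2 + 2 * \<beta>) * schatten_sum (2 * p) M (T - adj T)"
    if u: "ortho u" and T: "strictly_upper u N T" and M: "2 * N \<le> M"
    for u :: "nat \<Rightarrow> 'a" and N M T
  proof -
    define B where "B = T - adj T"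
    then have aT: "adj T = T - B" by simp
    have Ts: "on_span u N T" using T by (simp add: strictly_upper_def)
    define x where "x = sqrt (schatten_sum (2 * p) M T)"
    define b where "b = sqrt (schatten_sum (2 * p) M B)"
    have x0: "x \<ge> 0" and b0: "b \<ge> 0" by (auto simp: x_def b_def)
    have TB: "schatten_sum p M (T o\<^sub>L B) \<le> 2 * (x * b)"
      and BT: "schatten_sum p M (B o\<^sub>L T) \<le> 2 * (b * x)"
      and BB: "schatten_sum p M (B o\<^sub>L B) \<le> 2 * (b * b)"
      unfolding x_def b_def by (rule schatten_sum_compose)+
    have add: "schatten_sum p M (X + Y) \<le> q * (c + d)"
      and diff: "schatten_sum p M (X - Y) \<le> q * (c + d)"
      if "schatten_sum p M X \<le> c" "schatten_sum p M Y \<le> d" for X Y :: "'a \<Rightarrow>\<^sub>L 'a" and c d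
      using that q unfolding q_def
      by (intro order_trans[OF schatten_sum_add] order_trans[OF schatten_sum_diff]
          mult_left_mono add_mono; simp)+
    have "(T o\<^sub>L T) - adj (T o\<^sub>L T) = ((T o\<^sub>L B) + (B o\<^sub>L T)) - (B o\<^sub>L B)"
      by (simp add: adj_compose aT blinfun_compose_simps)
    then have "schatten_sum p M ((T o\<^sub>L T) - adj (T o\<^sub>L T)) \<le> q * (q * (2 * (x * b) + 2 * (b * x)) + 2 * (b * b))"
      using diff[OF add[OF TB BT] BB] by simp
    moreover have "schatten_sum p M (T o\<^sub>L T) \<le> C * schatten_sum p M ((T o\<^sub>L T) - adj (T o\<^sub>L T))"
      by (rule IH[OF u strictly_upper_compose[OF u T T] M])
    ultimately have TT: "schatten_sum p M (T o\<^sub>L T) \<le> C * (q * (q * (2 * (x * b) + 2 * (b * x)) + 2 * (b * b)))"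
      using C by (meson mult_left_mono order_trans)
    have "adj T o\<^sub>L T = (T o\<^sub>L T) - (B o\<^sub>L T)" by (simp add: aT blinfun_compose_simps)
    then have "schatten_sum p M (adj T o\<^sub>L T)
        \<le> q * (C * (q * (q * (2 * (x * b) + 2 * (b * x)) + 2 * (b * b))) + 2 * (b * x))"
      using diff[OF TT BT] by simp
    moreover have "schatten_sum (2 * p) M T \<le> 2 * schatten_sum p M (adj T o\<^sub>L T)"
      using Ts by (intro schatten_sum_square compact_blinfun_rank_le[OF on_span_rank_le[OF Ts]])
        (simp add: on_span_def)
    ultimately have "x\<^sup>2 \<le> \<alpha> * (x * b) + \<beta> * b\<^sup>2"
      by (simp add: x_def[symmetric] x_def \<alpha>_def \<beta>_def power2_eq_square power3_eq_cube algebra_simps)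
    \<comment> \<open>The quadratic inequality is solved for \<open>x\<close>:
      \<open>\<alpha> * (x * b)\<close> is at most half of \<open>x\<^sup>2\<close> plus half of
      \<open>(\<alpha> * b)\<^sup>2\<close>. Subtracting half of \<open>x\<^sup>2\<close> is
      legitimate because the truncated sums are finite.\<close>
    moreover have "0 \<le> (x - \<alpha> * b)\<^sup>2" by simp
    ultimately have "x\<^sup>2 \<le> (\<alpha>\<^sup>2 + 2 * \<beta>) * b\<^sup>2"
      by (simp add: power2_eq_square algebra_simps)
    then show ?thesis by (simp add: x_def b_def B_def)
  qed
  moreover have "0 \<le> \<alpha>\<^sup>2 + 2 * \<beta>" using C by (simp add: \<beta>_def)
  ultimately show ?case unfolding p_def by (intro exI[of _ "\<alpha>\<^sup>2 + 2 * \<beta>"]) auto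
qed

text \<open>The witness is \<open>Y = T - K\<close>, where \<open>A + K = T + D\<close> with
  \<open>D\<close> diagonal and \<open>T\<close> strictly upper triangular: then
  \<open>A - Y = D\<close> has norm at most \<open>\<epsilon>\<close>. The constant depends neither
  on the basis and its length nor on the operators or \<open>\<epsilon>\<close>.\<close>

theorem triangular_sum_bound:
  "\<exists>C\<ge>0. \<forall>(u :: nat \<Rightarrow> 'a::{complex_inner, banach}) N A K \<epsilon>. ortho u \<longrightarrow> on_span u N A \<longrightarrow>
    on_span u N K \<longrightarrow> adj A = A \<longrightarrow> 0 \<le> \<epsilon> \<longrightarrow>
    (\<forall>i<N. \<forall>j<i. cinner ((A + K) (u j)) (u i) = 0) \<longrightarrow>
    (\<forall>j<N. cmod (cinner ((A + K) (u j)) (u j)) \<le> \<epsilon>) \<longrightarrow>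
    (\<exists>Y. schatten_sum (2 ^ Suc k) (2 * N) Y \<le> C * schatten_sum (2 ^ Suc k) (2 * N) K \<and>
      norm (A - Y) \<le> \<epsilon>)"
proof -
  define p :: nat where "p = 2 ^ Suc k"
  define q :: real where "q = 2 * 2 ^ p"
  have q: "q \<ge> 0" by (simp add: q_def)
  obtain C1 where C1: "C1 \<ge> 0" and upper: "\<And>(u :: nat \<Rightarrow> 'a) N M T. ortho u \<Longrightarrow> strictly_upper u N T \<Longrightarrow>
    2 * N \<le> M \<Longrightarrow> schatten_sum p M T \<le> C1 * schatten_sum p M (T - adj T)"
    using strictly_upper_bound[of k] unfolding p_def by blast
  obtain C2 where C2: "C2 \<ge> 0" and diag: "\<And>(u :: nat \<Rightarrow> 'a) N M X. ortho u \<Longrightarrow> clin X \<Longrightarrow> rank_le M X \<Longrightarrow>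
    (\<Sum>j<N. cmod (cinner (X (u j)) (u j)) ^ p) \<le> C2 * schatten_sum p M X"
    using sum_diagonal_le[of k] unfolding p_def by blast
  obtain C3 where C3: "C3 \<ge> 0" and dop: "\<And>(u :: nat \<Rightarrow> 'a) N M d. ortho u \<Longrightarrow>
    schatten_sum p M (diag_op u N d) \<le> C3 * (\<Sum>j<N. cmod (d j) ^ p)"
    using schatten_sum_diag_op[of k] unfolding p_def by blast
  \<comment> \<open>Collects the factors of the chain below: \<open>G\<close> costs
    \<open>q * 2\<close>, its diagonal \<open>C2\<close> and then \<open>C3\<close>, the passage to
    \<open>T\<close> costs \<open>C1\<close> and \<open>q\<close>, and subtracting \<open>K\<close>
    one more \<open>q\<close>.\<close>
  define C where "C = q * (C1 * (q * (q * 2 + C3 * (C2 * (q * 2)))) + 1)"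
  have C0: "C \<ge> 0" using q C1 C2 C3 by (simp add: C_def)
  have main: "\<exists>Y. schatten_sum p (2 * N) Y \<le> C * schatten_sum p (2 * N) K \<and> norm (A - Y) \<le> \<epsilon>"
    if u: "ortho u" and A: "on_span u N A" and K: "on_span u N K" and sA: "adj A = A" and eps: "0 \<le> \<epsilon>"
      and tri: "\<And>i j. i < N \<Longrightarrow> j < i \<Longrightarrow> cinner ((A + K) (u j)) (u i) = 0"
      and small: "\<And>j. j < N \<Longrightarrow> cmod (cinner ((A + K) (u j)) (u j)) \<le> \<epsilon>"
    for u :: "nat \<Rightarrow> 'a" and N A K \<epsilon>
  proof -
    define V where "V = A + K"
    have V: "on_span u N V" unfolding V_def by (intro on_span_add A K)
    then have cV: "clin V" by (simp add: on_span_def)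
    have cK: "clin K" using K by (simp add: on_span_def)
    define d where "d j = cinner (V (u j)) (u j)" for j
    define D where "D = diag_op u N d"
    define T where "T = V - D"
    define G where "G = K - adj K"
    let ?S = "schatten_sum p (2 * N)"
    have Gs: "on_span u N G" unfolding G_def by (intro on_span_diff on_span_adj K)
    have G: "G = V - adj V" by (simp add: G_def V_def adj_add sA)
    have SG: "?S G \<le> q * 2 * ?S K" using schatten_sum_diff[of p "2 * N" K "adj K"] by (simp add: G_def q_def)
    have "strictly_upper u N T"
      unfolding strictly_upper_def
    proof (intro conjI allI impI)
      show "on_span u N T" unfolding T_def D_def by (intro on_span_diff V on_span_diag_op u)
      fix i j assume ij: "i < N" "j \<le> i"
      have "cinner (T (u j)) (u i) = cinner (V (u j)) (u i) - d i * cinner (u j) (u i)"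
        using ij by (simp add: T_def D_def minus_blinfun.rep_eq cinner_diff_left diag_op_cinner[OF u])
      also have "\<dots> = 0"
      proof (cases "j = i")
        case True
        then show ?thesis using cinner_self_mult[OF u, of "V (u i)" i] by (simp add: d_def)
      next
        case False
        then show ?thesis using ij tri[of i j] u by (simp add: V_def ortho_def)
      qed
      finally show "cinner (T (u j)) (u i) = 0" .
    qed
    then have "?S T \<le> C1 * ?S (T - adj T)" by (rule upper[OF u]) simp
    \<comment> \<open>Taking imaginary parts turns the diagonal of \<open>V\<close> into that of
      \<open>G\<close>, which has a Schatten bound; \<open>D\<close> itself is only small in
      norm.\<close>
    also have "T - adj T = G - diag_op u N (\<lambda>j. d j - cnj (d j))"
      by (simp add: T_def D_def adj_diff adj_diag_op G flip: diag_op_diff)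
    also have "?S \<dots> \<le> q * (?S G + ?S (diag_op u N (\<lambda>j. d j - cnj (d j))))"
      using schatten_sum_diff unfolding q_def .
    also have "?S (diag_op u N (\<lambda>j. d j - cnj (d j))) \<le> C3 * (\<Sum>j<N. cmod (d j - cnj (d j)) ^ p)"
      by (rule dop[OF u])
    also have "(\<Sum>j<N. cmod (d j - cnj (d j)) ^ p) = (\<Sum>j<N. cmod (cinner (G (u j)) (u j)) ^ p)"
      by (simp add: G d_def minus_blinfun.rep_eq cinner_diff_left cinner_adj'[OF cV, symmetric]
          flip: cinner_commute)
    also have "\<dots> \<le> C2 * ?S G"
      using Gs by (intro diag u on_span_rank_le) (auto simp: on_span_def)
    finally have "?S T \<le> C1 * (q * (?S G + C3 * (C2 * ?S G)))"
      using C1 C3 q by (simp add: mult_left_mono)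
    also have "\<dots> \<le> C1 * (q * (q * 2 * ?S K + C3 * (C2 * (q * 2 * ?S K))))"
      using C1 C2 C3 q SG by (intro mult_left_mono add_mono) auto
    finally have ST: "?S T \<le> C1 * (q * (q * 2 + C3 * (C2 * (q * 2)))) * ?S K"
      by (simp add: algebra_simps)
    have "?S (T - K) \<le> q * (?S T + ?S K)" using schatten_sum_diff unfolding q_def .
    also have "\<dots> \<le> q * (C1 * (q * (q * 2 + C3 * (C2 * (q * 2)))) * ?S K + ?S K)"
      using q ST by (intro mult_left_mono add_right_mono)
    also have "\<dots> = C * ?S K" by (simp add: C_def algebra_simps)
    finally have "?S (T - K) \<le> C * ?S K" .
    moreover have "A - (T - K) = D" by (simp add: T_def V_def)
    moreover have "norm D \<le> \<epsilon>" unfolding D_def d_def V_def by (intro norm_diag_op_le u small eps)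
    ultimately show ?thesis by metis
  qed
  show ?thesis
    unfolding p_def[symmetric]
    by (intro exI[of _ C] conjI C0 allI impI, rule main; (assumption | blast))
qed


section \<open>Schur bases and compressions\<close>

text \<open>The value of \<open>p(W)\<close> at \<open>f\<close>, provided that \<open>n\<close> is
  at least the degree of \<open>p\<close>; keeping \<open>n\<close> separate lets the induction run
  over a bound of the degree.\<close>

definition poly_op :: "nat \<Rightarrow> complex poly \<Rightarrow> ('a::complex_inner \<Rightarrow>\<^sub>L 'a) \<Rightarrow> 'a \<Rightarrow> 'a" where
  "poly_op n p W f = (\<Sum>i\<le>n. coeff p i *\<^sub>C (blinfun_apply W ^^ i) f)"

lemma poly_op_linear_factor:
  assumes "clin W" "degree q \<le> n"
  shows "poly_op (Suc n) ([:- z, 1:] * q) W f = W (poly_op n q W f) - z *\<^sub>C poly_op n q W f"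
proof -
  have "coeff ([:- z, 1:] * q) i = coeff (pCons 0 q) i - z * coeff q i" for i
    by simp
  then have "poly_op (Suc n) ([:- z, 1:] * q) W f
      = (\<Sum>i\<le>Suc n. coeff (pCons 0 q) i *\<^sub>C (blinfun_apply W ^^ i) f)
        - (\<Sum>i\<le>Suc n. z *\<^sub>C coeff q i *\<^sub>C (blinfun_apply W ^^ i) f)"
    unfolding poly_op_def by (simp only: scaleC_diff_left sum_subtractf scaleC_scaleC)
  also have "(\<Sum>i\<le>Suc n. coeff (pCons 0 q) i *\<^sub>C (blinfun_apply W ^^ i) f) = W (poly_op n q W f)"
    unfolding sum.atMost_Suc_shift poly_op_def
    by (simp add: blinfun.sum_right clinD[OF assms(1)])
  also have "coeff q (Suc n) = 0" using assms(2) by (simp add: coeff_eq_0)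
  then have "(\<Sum>i\<le>Suc n. z *\<^sub>C coeff q i *\<^sub>C (blinfun_apply W ^^ i) f) = z *\<^sub>C poly_op n q W f"
    by (simp add: poly_op_def scaleC_sum_right)
  finally show ?thesis .
qed

text \<open>Existence of eigenvectors without determinants: split off a root \<open>z\<close> of
  \<open>p\<close>, with cofactor \<open>q\<close>. Either \<open>q(W) f\<close> is nonzero and an
  eigenvector for \<open>z\<close>, or \<open>q\<close> annihilates \<open>f\<close> and has smaller
  degree.\<close>

lemma poly_op_eigenvector:
  assumes W: "clin W" and M: "complex_vector.subspace M" "\<And>f. f \<in> M \<Longrightarrow> blinfun_apply W f \<in> M"
    and f: "f \<in> M" "f \<noteq> 0" and p: "p \<noteq> 0" "degree p \<le> n" "poly_op n p W f = 0"
  shows "\<exists>g\<in>M. g \<noteq> 0 \<and> (\<exists>\<mu>. W g = \<mu> *\<^sub>C g)"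
  using p
proof (induction n arbitrary: p)
  case 0
  then obtain a where "p = [:a:]" "a \<noteq> 0"
    by (metis degree_0_id le_zero_eq pCons_0_0 degree_eq_zeroE)
  then show ?case using 0 f by (simp add: poly_op_def)
next
  case (Suc n)
  show ?case
  proof (cases "degree p = 0")
    case True
    then obtain a where a: "p = [:a:]" by (auto elim: degree_eq_zeroE)
    then have "poly_op (Suc n) p W f = a *\<^sub>C f"
      unfolding poly_op_def sum.atMost_Suc_shift by simp
    then show ?thesis using Suc.prems a f by simp
  next
    case False
    then have "\<not> constant (poly p)" by (simp add: constant_degree)
    then obtain z where "poly p z = 0" using fundamental_theorem_of_algebra by blast
    then obtain q where q: "p = [:- z, 1:] * q" by (metis dvdE poly_eq_0_iff_dvd)
    with Suc.prems have q0: "q \<noteq> 0" by auto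
    have "degree p = Suc (degree q)" using q0 unfolding q by (subst degree_mult_eq) auto
    then have dq: "degree q \<le> n" using Suc.prems by simp
    let ?g = "poly_op n q W f"
    have "W ?g = z *\<^sub>C ?g"
      using Suc.prems(3) poly_op_linear_factor[OF W dq, of z f] by (simp add: q)
    moreover have "?g \<in> M"
    proof -
      have "(blinfun_apply W ^^ i) f \<in> M" for i by (induction i) (auto simp: f M)
      then show ?thesis
        unfolding poly_op_def by (intro complex_vector.subspace_sum complex_vector.subspace_scale M)
    qed
    ultimately show ?thesis using Suc.IH[OF q0 dq] by (cases "?g = 0") auto
  qed
qed

lemma cproj_range_iff:
  assumes "ortho e"
  shows "f \<in> complex_vector.span (e ` {..<N}) \<longleftrightarrow> cproj e N f = f"
proof
  assume "f \<in> complex_vector.span (e ` {..<N})"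
  then show "cproj e N f = f"
  proof (induction rule: complex_vector.span_induct_alt)
    case (step c x y)
    then show ?case
      by (auto simp: blinfun.add_right clinD[OF clin_cproj] cproj_fix[OF assms])
  qed simp
next
  have "cproj e N f \<in> complex_vector.span (e ` {..<N})"
    unfolding cproj_apply
    by (intro complex_vector.span_sum complex_vector.span_scale complex_vector.span_base) auto
  then show "cproj e N f = f \<Longrightarrow> f \<in> complex_vector.span (e ` {..<N})" by simp
qed

lemma ex_relation_cproj:
  assumes e: "ortho e" and g: "\<And>i. i \<le> n \<Longrightarrow> cproj e n (g i) = g i"
  shows "\<exists>c. (\<exists>i\<le>n. c i \<noteq> 0) \<and> (\<Sum>i\<le>n. c i *\<^sub>C g i) = 0"
proof (rule complex_vector.ex_nontrivial_relation)
  show "card (e ` {..<n}) \<le> n" using card_image_le[of "{..<n}" e] by simp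
qed (use g cproj_range_iff[OF e] in auto)

text \<open>The iterates of \<open>f\<close> up to the exponent \<open>N\<close> are
  \<open>N + 1\<close> vectors in a space of dimension at most \<open>N\<close>, so some nonzero
  polynomial of degree at most \<open>N\<close> annihilates \<open>f\<close>.\<close>

lemma finite_dim_eigenvector:
  assumes e: "ortho e" and W: "clin W"
    and M: "complex_vector.subspace M" "\<And>f. f \<in> M \<Longrightarrow> blinfun_apply W f \<in> M"
      "\<And>f. f \<in> M \<Longrightarrow> cproj e N f = f"
    and f: "f \<in> M" "f \<noteq> 0"
  shows "\<exists>g\<in>M. norm g = 1 \<and> (\<exists>\<mu>. W g = \<mu> *\<^sub>C g)"
proof -
  have "(blinfun_apply W ^^ i) f \<in> M" for i by (induction i) (auto simp: f M)
  then obtain c where c: "\<exists>i\<le>N. c i \<noteq> 0" "(\<Sum>i\<le>N. c i *\<^sub>C (blinfun_apply W ^^ i) f) = 0"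
    using ex_relation_cproj[OF e, of N "\<lambda>i. (blinfun_apply W ^^ i) f"] M(3) by blast
  define p where "p = (\<Sum>i\<le>N. monom (c i) i)"
  have cp: "coeff p i = (if i \<le> N then c i else 0)" for i
    by (simp add: p_def coeff_sum coeff_monom)
  have "degree p \<le> N" by (rule degree_le) (simp add: cp)
  moreover have "p \<noteq> 0" using c(1) by (metis cp coeff_0)
  moreover have "poly_op N p W f = 0" using c(2) by (simp add: poly_op_def cp)
  ultimately obtain g \<mu> where g: "g \<in> M" "g \<noteq> 0" "W g = \<mu> *\<^sub>C g"
    using poly_op_eigenvector[OF W M(1,2) f] by blast
  let ?h = "complex_of_real (1 / norm g) *\<^sub>C g"
  have "?h \<in> M" using M(1) g(1) by (intro complex_vector.subspace_scale)
  moreover have "norm ?h = 1" using g(2) by (simp add: norm_scaleC norm_divide)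
  moreover have "W ?h = \<mu> *\<^sub>C ?h"
    by (simp only: clinD[OF W] g(3) scaleC_scaleC mult.commute)
  ultimately show ?thesis by blast
qed

lemma sum_ortho_eq_0D:
  assumes u: "ortho u" and "(\<Sum>i\<le>n. c i *\<^sub>C u i) = 0" "j \<le> n" "norm (u j) = 1"
  shows "c j = 0"
proof -
  have "cinner (\<Sum>i<Suc n. c i *\<^sub>C u i) (u j) = c j"
    using assms(3,4) by (simp add: ortho_sum[OF u] cinner_self del: sum.lessThan_Suc)
  then show ?thesis using assms(2) by (simp only: lessThan_Suc_atMost cinner_zero_left)
qed

text \<open>Schur triangularisation: \<open>u n\<close> is an eigenvector of the compression of
  \<open>V\<close> to the complement of \<open>u 0, ..., u (n - 1)\<close> within the span of
  \<open>e\<close>. Then \<open>V (u n)\<close> lies in the span of \<open>u 0, ..., u n\<close>.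
  From \<open>N\<close> on the system is continued by zeros.\<close>

lemma ex_schur_basis:
  fixes e :: "nat \<Rightarrow> 'a::{complex_inner, banach}"
  assumes e: "ortho e" "\<And>i. i < N \<Longrightarrow> norm (e i) = 1" and V: "on_span e N V"
  obtains u where "ortho u" "\<And>j. j < N \<Longrightarrow> norm (u j) = 1" "cproj u N = cproj e N"
    "\<And>i j. i < N \<Longrightarrow> j < i \<Longrightarrow> cinner (V (u j)) (u i) = 0"
proof -
  have cV: "clin V" using V by (simp add: on_span_def)
  define Q where "Q u n r \<longleftrightarrow> (if n < N then norm r = 1 \<and> cproj e N r = r \<and> (\<forall>i<n. cinner r (u i) = 0) \<and>
      (\<exists>\<mu>. V r - cproj u n (V r) = \<mu> *\<^sub>C r) else r = 0)" for u n and r :: 'a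
  have "\<exists>u. \<forall>n. Q u n (u n)"
  proof (rule dependent_wellorder_choice[where P = Q])
    fix r n and f g :: "nat \<Rightarrow> 'a" assume "\<And>m. m < n \<Longrightarrow> f m = g m"
    then have "cproj f n = cproj g n" "(\<forall>i<n. cinner r (f i) = 0) \<longleftrightarrow> (\<forall>i<n. cinner r (g i) = 0)"
      by (auto simp: cproj_def)
    then show "Q f n r = Q g n r" unfolding Q_def by simp
  next
    fix n and p :: "nat \<Rightarrow> 'a" assume IH: "\<And>m. m < n \<Longrightarrow> Q p m (p m)"
    show "\<exists>r. Q p n r"
    proof (cases "n < N")
      case True
      \<comment> \<open>Cutting \<open>p\<close> off at \<open>n\<close> makes the vectors chosen so
        far an orthonormal system in the sense of \<open>ortho\<close>.\<close>
      define u where "u i = (if i < n then p i else 0)" for i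
      have cp: "cproj p n = cproj u n" by (simp add: cproj_def u_def)
      have un: "norm (u i) = 1" "cproj e N (u i) = u i" if "i < n" for i
        using IH[OF that] that True by (auto simp: Q_def u_def)
      have o1: "cinner (u i) (u j) = 0" if "j < i" for i j
      proof (cases "i < n")
        case True
        then show ?thesis using that IH[of i] \<open>n < N\<close> by (auto simp: Q_def u_def)
      qed (simp add: u_def)
      have u: "ortho u"
        unfolding ortho_def
      proof (intro conjI allI impI)
        show "norm (u i) = 1 \<or> u i = 0" for i using un(1)[of i] by (cases "i < n") (auto simp: u_def)
        show "cinner (u i) (u j) = 0" if "i \<noteq> j" for i j
          using o1[of i j] o1[of j i] that cinner_commute[of "u i" "u j"] by (cases "i < j") auto
      qed
      define M where "M = {f. cproj e N f = f \<and> (\<forall>i<n. cinner f (u i) = 0)}"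
      define W where "W = V - (cproj u n o\<^sub>L V)"
      have sub: "complex_vector.subspace M"
        unfolding M_def complex_vector.subspace_def
        by (auto simp: blinfun.add_right clinD[OF clin_cproj] cinner_add_left cinner_scaleC_left)
      have WM: "W f \<in> M" for f
      proof -
        have "cproj e N (V f) = V f" using V by (metis on_span_def blinfun_apply_blinfun_compose)
        moreover have "cproj e N (cproj u n g) = cproj u n g" for g
          by (simp add: cproj_apply[of u] blinfun.sum_right clinD[OF clin_cproj] un)
        ultimately show ?thesis
          using cproj_orth[OF u] by (auto simp: M_def W_def minus_blinfun.rep_eq blinfun.diff_right)
      qed
      \<comment> \<open>Dimension count: \<open>e 0, ..., e n\<close> have dependent projections to
        the \<open>n\<close>-dimensional span of \<open>u\<close>; the same combination of the
        \<open>e i\<close> themselves is nonzero and orthogonal to \<open>u\<close>.\<close>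
      have "\<exists>f\<in>M. f \<noteq> 0"
      proof -
        obtain c where c: "\<exists>i\<le>n. c i \<noteq> 0" "(\<Sum>i\<le>n. c i *\<^sub>C cproj u n (e i)) = 0"
          using ex_relation_cproj[OF u, of n "\<lambda>i. cproj u n (e i)"] cproj_idem[OF u] by blast
        let ?f = "\<Sum>i\<le>n. c i *\<^sub>C e i"
        have "cproj u n ?f = 0" using c(2) by (simp add: blinfun.sum_right clinD[OF clin_cproj])
        then have "\<forall>i<n. cinner ?f (u i) = 0" using cproj_orth[OF u, of _ n ?f] by simp
        moreover have "cproj e N ?f = ?f"
          using True by (simp add: blinfun.sum_right clinD[OF clin_cproj] cproj_fix[OF e(1)])
        moreover have "?f \<noteq> 0" using c(1) sum_ortho_eq_0D[OF e(1)] e(2) True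
          by (meson le_less_trans)
        ultimately show ?thesis by (auto simp: M_def)
      qed
      then obtain f where f: "f \<in> M" "f \<noteq> 0" by blast
      have cW: "clin W" unfolding W_def by (intro clin_diff clin_compose clin_cproj cV)
      have MP: "cproj e N g = g" if "g \<in> M" for g using that by (simp add: M_def)
      obtain r \<mu> where "r \<in> M" "norm r = 1" "W r = \<mu> *\<^sub>C r"
        using finite_dim_eigenvector[OF e(1) cW sub WM MP f] by blast
      then have "Q p n r"
        using True by (auto simp: Q_def M_def W_def u_def cp minus_blinfun.rep_eq)
      then show ?thesis ..
    qed (simp add: Q_def)
  qed
  then obtain u where u: "\<And>n. Q u n (u n)" by blast
  have un: "norm (u n) = 1" "cproj e N (u n) = u n" if "n < N" for n
    using u[of n] that by (auto simp: Q_def)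
  have u0: "u n = 0" if "\<not> n < N" for n using u[of n] that by (auto simp: Q_def)
  have o1: "cinner (u i) (u j) = 0" if "j < i" for i j
    using u[of i] that by (cases "i < N") (auto simp: Q_def)
  have ou: "ortho u"
    unfolding ortho_def
  proof (intro conjI allI impI)
    show "norm (u i) = 1 \<or> u i = 0" for i using un u0 by blast
    show "cinner (u i) (u j) = 0" if "i \<noteq> j" for i j
      using o1[of i j] o1[of j i] that cinner_commute[of "u i" "u j"] by (cases "i < j") auto
  qed
  \<comment> \<open>Both systems have \<open>N\<close> vectors: a nonzero \<open>w\<close> in the
    span of \<open>e\<close> orthogonal to \<open>u\<close> would give \<open>N + 1\<close>
    independent vectors there.\<close>
  have "cproj u N o\<^sub>L cproj e N = cproj e N"
  proof (rule blinfun_eqI, rule ccontr)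
    fix f assume neq: "(cproj u N o\<^sub>L cproj e N) f \<noteq> cproj e N f"
    define w where "w = cproj e N f - cproj u N (cproj e N f)"
    have w: "w \<noteq> 0" "\<And>i. i < N \<Longrightarrow> cinner w (u i) = 0"
      using neq cproj_orth[OF ou] by (auto simp: w_def)
    define g where "g i = (if i < N then u i else w)" for i
    have "cproj e N (cproj u N h) = cproj u N h" for h
      by (simp add: cproj_apply[of u] blinfun.sum_right clinD[OF clin_cproj] un)
    then have "cproj e N (g i) = g i" for i
      by (auto simp: g_def w_def blinfun.diff_right un cproj_idem[OF e(1)])
    then obtain c where c: "\<exists>i\<le>N. c i \<noteq> 0" "(\<Sum>i\<le>N. c i *\<^sub>C g i) = 0"
      using ex_relation_cproj[OF e(1), of N g] by blast
    have "(\<Sum>i\<le>N. c i *\<^sub>C g i) = (\<Sum>i<N. c i *\<^sub>C u i) + c N *\<^sub>C w"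
      by (simp add: g_def flip: lessThan_Suc_atMost)
    then have s: "(\<Sum>i<N. c i *\<^sub>C u i) + c N *\<^sub>C w = 0" using c(2) by simp
    have "cinner w (\<Sum>i<N. c i *\<^sub>C u i) = 0"
      using w(2) by (simp add: cinner_sum_right cinner_scaleC_right)
    then have "cinner w (c N *\<^sub>C w) = 0"
      using arg_cong[OF s, of "cinner w"] by (simp add: cinner_add_right)
    then have cN: "c N = 0" using w(1) by (simp add: cinner_scaleC_right cinner_self)
    have "c i = 0" if "i < N" for i
    proof -
      have "cinner (\<Sum>i<N. c i *\<^sub>C u i) (u i) = c i"
        using that un(1) by (simp add: ortho_sum[OF ou] cinner_self)
      then show ?thesis using s cN by simp
    qed
    then show False using c(1) cN le_neq_implies_less by blast
  qed
  moreover have "cproj e N o\<^sub>L cproj u N = cproj u N"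
    by (rule blinfun_eqI)
       (simp add: cproj_apply[of u] blinfun.sum_right clinD[OF clin_cproj] un)
  \<comment> \<open>The adjoint of the first identity is
    \<open>cproj e N o\<^sub>L cproj u N = cproj e N\<close>, to be compared with the
    second.\<close>
  ultimately have P: "cproj u N = cproj e N"
    by (metis adj_compose adj_cproj)
  moreover have "cinner (V (u j)) (u i) = 0" if "i < N" "j < i" for i j
  proof -
    have "j < N" using that by simp
    then obtain \<mu> where \<mu>: "V (u j) - cproj u j (V (u j)) = \<mu> *\<^sub>C u j"
      using u[of j] unfolding Q_def by auto
    have "cinner (cproj u j (V (u j))) (u i) = 0"
      unfolding cproj_apply using that by (simp add: ortho_sum[OF ou])
    moreover have "cinner (\<mu> *\<^sub>C u j) (u i) = 0"
      using ou that by (simp add: ortho_def cinner_scaleC_left)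
    ultimately show ?thesis using \<mu> by (metis cinner_diff_left diff_zero)
  qed
  ultimately show ?thesis using that ou un by blast
qed

text \<open>Subtracting the \<open>j\<close>-th diagonal entry, \<open>V\<close> maps the span of
  \<open>u 0, ..., u j\<close> into that of the first \<open>j\<close> vectors, one dimension less,
  and so acquires a kernel.\<close>

lemma upper_triangular_eigenvalue:
  fixes u :: "nat \<Rightarrow> 'a::{complex_inner, banach}"
  assumes u: "ortho u" "\<And>j. j < N \<Longrightarrow> norm (u j) = 1" and V: "on_span u N V"
    and tri: "\<And>i j. i < N \<Longrightarrow> j < i \<Longrightarrow> cinner (V (u j)) (u i) = 0" and j: "j < N"
  shows "\<exists>f. f \<noteq> 0 \<and> cproj u N f = f \<and> V f = cinner (V (u j)) (u j) *\<^sub>C f"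
proof -
  define d where "d = cinner (V (u j)) (u j)"
  have cV: "clin V" using V by (simp add: on_span_def)
  define g where "g i = V (u i) - d *\<^sub>C u i" for i
  have "cproj u j (g i) = g i" if i: "i \<le> j" for i
  proof -
    have g: "g i = cproj u N (g i)"
    proof -
      have "cproj u N (V (u i)) = V (u i)" using V by (metis on_span_def blinfun_apply_blinfun_compose)
      then show ?thesis using i j by (simp add: g_def blinfun.diff_right clinD[OF clin_cproj] cproj_fix[OF u(1)])
    qed
    have "cinner (g i) (u l) = 0" if "l \<in> {..<N} - {..<j}" for l
    proof -
      have l: "l < N" "j \<le> l" using that by auto
      have gl: "cinner (g i) (u l) = cinner (V (u i)) (u l) - d * cinner (u i) (u l)"
        by (simp add: g_def cinner_diff_left cinner_scaleC_left)
      show ?thesis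
      proof (cases "i = l")
        case True
        then have "i = j" using i l by simp
        then show ?thesis using gl True u(2)[OF j] by (simp add: d_def cinner_self)
      next
        case False
        then show ?thesis using gl tri[of l i] i l u(1) by (simp add: ortho_def)
      qed
    qed
    then have "cproj u N (g i) = cproj u j (g i)"
      unfolding cproj_apply using j by (intro sum.mono_neutral_right) auto
    then show ?thesis using g by simp
  qed
  then obtain c where c: "\<exists>i\<le>j. c i \<noteq> 0" "(\<Sum>i\<le>j. c i *\<^sub>C g i) = 0"
    using ex_relation_cproj[OF u(1), of j g] by blast
  let ?f = "\<Sum>i\<le>j. c i *\<^sub>C u i"
  have "?f \<noteq> 0" using c(1) sum_ortho_eq_0D[OF u(1)] u(2) j by (meson le_less_trans)
  moreover have "cproj u N ?f = ?f"
    using j by (simp add: blinfun.sum_right clinD[OF clin_cproj] cproj_fix[OF u(1)])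
  moreover have "V ?f - d *\<^sub>C ?f = (\<Sum>i\<le>j. c i *\<^sub>C g i)"
    by (simp add: g_def blinfun.sum_right clinD[OF cV] scaleC_diff_right sum_subtractf
        scaleC_sum_right scaleC_scaleC mult.commute)
  ultimately show ?thesis using c(2) by (intro exI[of _ ?f]) (simp add: d_def)
qed

text \<open>The Fourier series converges by Bessel's inequality. The remainder is annihilated by
  \<open>X\<close>, hence orthogonal to \<open>g\<close> by assumption, and it is orthogonal to
  every \<open>e i\<close>; so it is orthogonal to itself.\<close>

lemma (in svd) cproj_tendsto:
  assumes g: "\<And>h. X h = 0 \<Longrightarrow> cinner g h = 0"
  shows "(\<lambda>n. cproj e n g) \<longlonglongrightarrow> g"
proof -
  let ?a = "\<lambda>i. (cmod (cinner g (e i)))\<^sup>2"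
  have "summable ?a"
    by (rule bounded_imp_summable[of _ "(norm g)\<^sup>2"])
       (auto intro: order_trans[OF _ bessel[OF ortho, of g "Suc _"]] simp: lessThan_Suc_atMost)
  then have C: "Cauchy (\<lambda>n. \<Sum>i<n. ?a i)"
    using summable_LIMSEQ LIMSEQ_imp_Cauchy by blast
  have d: "(norm (cproj e m g - cproj e n g))\<^sup>2 = \<bar>(\<Sum>i<m. ?a i) - (\<Sum>i<n. ?a i)\<bar>" for m n
  proof -
    have 1: "(norm (cproj e m g - cproj e n g))\<^sup>2 = (\<Sum>i<m. ?a i) - (\<Sum>i<n. ?a i)" if "n \<le> m" for m n
    proof -
      let ?w = "cproj e m g"
      have "cproj e n ?w = cproj e n g"
        unfolding cproj_apply[of e n] using that
        by (intro sum.cong refl) (simp add: cproj_apply ortho_sum[OF ortho] cinner_self_mult[OF ortho])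
      then have "(norm ?w)\<^sup>2 = (norm (cproj e n g))\<^sup>2 + (norm (?w - cproj e n g))\<^sup>2"
        using norm_pythagoras[OF ortho, of ?w n] by simp
      then show ?thesis by (simp add: norm_cproj[OF ortho])
    qed
    have 2: "(norm (cproj e m g - cproj e n g))\<^sup>2 = \<bar>(\<Sum>i<m. ?a i) - (\<Sum>i<n. ?a i)\<bar>" if "n \<le> m" for m n
      unfolding 1[OF that, symmetric] by simp
    show ?thesis
    proof (cases "n \<le> m")
      case False
      then show ?thesis
        using 2[of m n] norm_minus_commute[of "cproj e m g"] abs_minus_commute[of "\<Sum>i<m. ?a i"]
        by simp
    qed (rule 2)
  qed
  have "Cauchy (\<lambda>n. cproj e n g)"
  proof (rule metric_CauchyI)
    fix r :: real assume r: "r > 0"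
    then obtain M where "\<And>m n. m \<ge> M \<Longrightarrow> n \<ge> M \<Longrightarrow> dist (\<Sum>i<m. ?a i) (\<Sum>i<n. ?a i) < r\<^sup>2"
      using metric_CauchyD[OF C, of "r\<^sup>2"] by auto
    then have "dist (cproj e m g) (cproj e n g) < r" if "m \<ge> M" "n \<ge> M" for m n
      using that r d[of m n] by (auto simp: dist_norm intro!: power2_less_imp_less[of _ r])
    then show "\<exists>M. \<forall>m\<ge>M. \<forall>n\<ge>M. dist (cproj e m g) (cproj e n g) < r" by blast
  qed
  then obtain p where p: "(\<lambda>n. cproj e n g) \<longlonglongrightarrow> p" using Cauchy_convergent convergent_def by blast
  let ?h = "g - p"
  have "X ?h = 0"
  proof -
    have "(\<lambda>n. X (g - cproj e n g)) \<longlonglongrightarrow> X ?h" by (intro tendsto_intros p)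
    moreover have "(\<lambda>n. X (g - cproj e n g)) \<longlonglongrightarrow> 0"
    proof (rule Lim_null_comparison)
      show "\<forall>\<^sub>F n in sequentially. norm (X (g - cproj e n g)) \<le> s n * norm g"
        by (intro always_eventually allI res_bound')
      show "(\<lambda>n. s n * norm g) \<longlonglongrightarrow> 0" using tendsto_mult_right[OF lim, of "norm g"] by simp
    qed
    ultimately show ?thesis using LIMSEQ_unique by blast
  qed
  then have g0: "cinner g ?h = 0" by (rule g)
  have eh: "cinner ?h (e i) = 0" for i
  proof -
    have "(\<lambda>n. cinner (g - cproj e n g) (e i)) \<longlonglongrightarrow> cinner ?h (e i)"
      by (intro tendsto_cinner tendsto_diff tendsto_const p)
    moreover have "(\<lambda>n. cinner (g - cproj e n g) (e i)) \<longlonglongrightarrow> 0"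
      by (rule tendsto_eventually) (auto intro!: eventually_sequentiallyI[of "Suc i"] cproj_orth[OF ortho])
    ultimately show ?thesis using LIMSEQ_unique by blast
  qed
  have "cinner (cproj e n g) ?h = 0" for n
    unfolding cproj_apply cinner_sum_left cinner_scaleC_left
    by (intro sum.neutral ballI) (metis cinner_commute complex_cnj_zero eh mult_zero_right)
  then have "(\<lambda>n. 0) \<longlonglongrightarrow> cinner p ?h" using tendsto_cinner[OF p, of ?h] by simp
  then have "cinner p ?h = 0" by (simp add: LIMSEQ_const_iff)
  then have "cinner ?h ?h = 0" using g0 by (simp add: cinner_diff_left)
  then have "p = g" by (simp add: cinner_self)
  with p show ?thesis by simp
qed

lemma scaleR_eq_scaleC: "r *\<^sub>R x = complex_of_real r *\<^sub>C x"
  by (simp add: scaleC_of_real)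

text \<open>Otherwise there are unit eigenvectors of ever larger compressions with eigenvalues of
  modulus between \<open>\<epsilon>\<close> and \<open>norm V\<close>, and compactness yields a
  limiting eigenvector of \<open>V\<close> with nonzero eigenvalue. By \<open>ran\<close> the limit
  \<open>g\<close> of the images is orthogonal to the kernel of \<open>X\<close>, so
  \<open>cproj_tendsto\<close> applies to it.\<close>

lemma (in svd) compression_eigenvalues_small:
  assumes V: "clin V" "compact_blinfun V"
    and no_eig: "\<And>f \<mu>. V f = \<mu> *\<^sub>C f \<Longrightarrow> \<mu> \<noteq> 0 \<Longrightarrow> f = 0"
    and ran: "\<And>f h. X h = 0 \<Longrightarrow> cinner (V f) h = 0"
    and \<epsilon>: "\<epsilon> > 0"
  shows "\<exists>M. \<forall>N\<ge>M. \<forall>f \<mu>. f \<noteq> 0 \<longrightarrow> cproj e N (V f) = \<mu> *\<^sub>C f \<longrightarrow> cmod \<mu> < \<epsilon>"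
proof (rule ccontr)
  assume "\<not> ?thesis"
  then have ev0: "\<exists>N f \<mu>. N \<ge> M \<and> f \<noteq> 0 \<and> cproj e N (V f) = \<mu> *\<^sub>C f \<and> \<epsilon> \<le> cmod \<mu>" for M
    by (meson not_less)
  have "\<exists>N f \<mu>. N \<ge> M \<and> norm f = 1 \<and> cproj e N (V f) = \<mu> *\<^sub>C f \<and> \<epsilon> \<le> cmod \<mu>" for M
  proof -
    obtain N f \<mu> where f: "N \<ge> M" "f \<noteq> 0" "cproj e N (V f) = \<mu> *\<^sub>C f" "\<epsilon> \<le> cmod \<mu>"
      using ev0[of M] by blast
    let ?g = "complex_of_real (1 / norm f) *\<^sub>C f"
    have "norm ?g = 1" using f(2) by (simp add: norm_scaleC norm_divide)
    moreover have "cproj e N (V ?g) = \<mu> *\<^sub>C ?g"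
      by (simp only: clinD[OF V(1)] clinD[OF clin_cproj] f(3) scaleC_scaleC mult.commute)
    ultimately show ?thesis using f by blast
  qed
  then obtain N f \<mu> where N: "\<And>k. N k \<ge> k" and f: "\<And>k. norm (f k) = 1"
    and ev: "\<And>k. cproj e (N k) (V (f k)) = \<mu> k *\<^sub>C f k" and \<mu>: "\<And>k. \<epsilon> \<le> cmod (\<mu> k)" by metis
  obtain r g where r: "strict_mono r" and g: "(\<lambda>k. V (f (r k))) \<longlonglongrightarrow> g"
    using compact_blinfunE[OF V(2), of f] f by auto
  have "cinner g h = 0" if "X h = 0" for h
  proof -
    have "(\<lambda>k. 0) \<longlonglongrightarrow> cinner g h" using tendsto_cinner[OF g, of h] ran[OF that] by simp
    then show ?thesis by (simp add: LIMSEQ_const_iff)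
  qed
  then have Pg: "(\<lambda>n. cproj e n g) \<longlonglongrightarrow> g" by (rule cproj_tendsto)
  have "filterlim (\<lambda>k. N (r k)) at_top sequentially"
  proof (rule filterlim_at_top_mono[OF filterlim_subseq[OF r]])
    show "\<forall>\<^sub>F k in sequentially. r k \<le> N (r k)" using N by simp
  qed
  then have Pg': "(\<lambda>k. cproj e (N (r k)) g) \<longlonglongrightarrow> g" using Pg by (rule filterlim_compose[rotated])
  \<comment> \<open>The projections are contractions and converge at \<open>g\<close>, so the
    compressed images have the same limit as the images themselves.\<close>
  have lim: "(\<lambda>k. \<mu> (r k) *\<^sub>C f (r k)) \<longlonglongrightarrow> g"
  proof -
    have "(\<lambda>k. cproj e (N (r k)) (V (f (r k)) - g)) \<longlonglongrightarrow> 0"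
    proof (rule Lim_null_comparison)
      show "\<forall>\<^sub>F k in sequentially. norm (cproj e (N (r k)) (V (f (r k)) - g)) \<le> norm (V (f (r k)) - g)"
        by (intro always_eventually allI norm_cproj_le ortho)
      show "(\<lambda>k. norm (V (f (r k)) - g)) \<longlonglongrightarrow> 0"
        using g by (simp add: LIM_zero tendsto_norm_zero)
    qed
    from tendsto_add[OF this Pg'] show ?thesis by (simp add: ev blinfun.diff_right)
  qed
  have "cmod (\<mu> k) \<le> norm V" for k
  proof -
    have "cmod (\<mu> k) = norm (cproj e (N k) (V (f k)))" by (simp add: ev norm_scaleC f)
    also have "\<dots> \<le> norm (V (f k))" by (rule norm_cproj_le[OF ortho])
    also have "\<dots> \<le> norm V" using norm_blinfun[of V "f k"] by (simp add: f)
    finally show ?thesis .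
  qed
  then have "\<forall>k. \<mu> (r k) \<in> cball 0 (norm V)" by simp
  then have "\<exists>l\<in>cball 0 (norm V). \<exists>q. strict_mono q \<and> ((\<lambda>k. \<mu> (r k)) \<circ> q) \<longlonglongrightarrow> l"
    by (intro compact_def[THEN iffD1, rule_format, OF compact_cball]) blast
  then obtain l q where q: "strict_mono q" and l: "(\<lambda>k. \<mu> (r (q k))) \<longlonglongrightarrow> l" by (auto simp: o_def)
  have "\<epsilon> \<le> cmod l"
    by (rule LIMSEQ_le_const[OF tendsto_norm[OF l]]) (use \<mu> in auto)
  then have l0: "l \<noteq> 0" using \<epsilon> by auto
  have \<mu>0: "\<mu> k \<noteq> 0" for k using \<mu>[of k] \<epsilon> by auto
  have "(\<lambda>k. \<mu> (r (q k)) *\<^sub>C f (r (q k))) \<longlonglongrightarrow> g"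
    using LIMSEQ_subseq_LIMSEQ[OF lim q] by (simp add: o_def)
  then have "(\<lambda>k. inverse l *\<^sub>C (\<mu> (r (q k)) *\<^sub>C f (r (q k)))) \<longlonglongrightarrow> inverse l *\<^sub>C g"
    by (rule bounded_linear.tendsto[OF bounded_linear_scaleC])
  \<comment> \<open>Dividing by the limit \<open>l\<close> rather than by the varying eigenvalues
    leaves an error of norm \<open>cmod (1 - \<mu> / l)\<close>, which tends to 0.\<close>
  moreover have "(\<lambda>k. f (r (q k)) - inverse l *\<^sub>C (\<mu> (r (q k)) *\<^sub>C f (r (q k)))) \<longlonglongrightarrow> 0"
  proof (rule tendsto_norm_zero_cancel)
    have "(\<lambda>k. cmod (1 - inverse l * \<mu> (r (q k)))) \<longlonglongrightarrow> cmod (1 - inverse l * l)"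
      by (intro tendsto_intros l)
    moreover have "f k - inverse l *\<^sub>C (c *\<^sub>C f k) = (1 - inverse l * c) *\<^sub>C f k" for k c
      by (simp add: scaleC_diff_left scaleC_scaleC)
    ultimately show "(\<lambda>k. norm (f (r (q k)) - inverse l *\<^sub>C (\<mu> (r (q k)) *\<^sub>C f (r (q k))))) \<longlonglongrightarrow> 0"
      using l0 by (simp add: norm_scaleC f)
  qed
  ultimately have lf: "(\<lambda>k. f (r (q k))) \<longlonglongrightarrow> inverse l *\<^sub>C g"
    using tendsto_add by fastforce
  then have "(\<lambda>k. V (f (r (q k)))) \<longlonglongrightarrow> V (inverse l *\<^sub>C g)" by (intro tendsto_intros)
  moreover have "(\<lambda>k. V (f (r (q k)))) \<longlonglongrightarrow> g" using LIMSEQ_subseq_LIMSEQ[OF g q] by (simp add: o_def)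
  ultimately have "V (inverse l *\<^sub>C g) = g" using LIMSEQ_unique by blast
  then have "V (inverse l *\<^sub>C g) = l *\<^sub>C (inverse l *\<^sub>C g)" using l0 by (simp add: scaleC_scaleC)
  then have "inverse l *\<^sub>C g = 0" using no_eig l0 by blast
  moreover have "norm (inverse l *\<^sub>C g) = 1"
    using tendsto_norm[OF lf] f by (simp add: LIMSEQ_const_iff)
  ultimately show False by (metis norm_zero zero_neq_one)
qed

text \<open>Positivity of all \<open>s n\<close> makes every \<open>e n\<close> a unit vector, so
  \<open>ex_schur_basis\<close> applies to each compression. The assumption \<open>ran\<close> makes
  the compressions approximate \<open>X + K\<close> on its range.\<close>

theorem (in svd) s_number_decay:
  fixes K :: "'a \<Rightarrow>\<^sub>L 'a"
  assumes X: "adj X = X" "compact_blinfun X" and Xe: "\<And>n. X (e n) = s n *\<^sub>R e n" and pos: "\<And>n. s n > 0"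
    and K: "svd K e' t" "compact_blinfun K" and t: "summable (\<lambda>n. t n ^ (2 ^ Suc k))"
    and no_eig: "\<And>f \<mu>. (X + K) f = \<mu> *\<^sub>C f \<Longrightarrow> \<mu> \<noteq> 0 \<Longrightarrow> f = 0"
    and ran: "\<And>f h. X h = 0 \<Longrightarrow> cinner (K f) h = 0"
  shows "\<exists>C. \<forall>n. s n ^ (2 ^ Suc k) * real (Suc n) \<le> C"
proof -
  interpret K: svd K e' t by fact
  define p :: nat where "p = 2 ^ Suc k"
  define V where "V = X + K"
  have V: "clin V" "compact_blinfun V"
    unfolding V_def by (intro clin_add clin K.clin compact_blinfun_add X K)+
  have ranV: "cinner (V f) h = 0" if "X h = 0" for f h
  proof -
    have "cinner (X f) h = cinner f (X h)" using cinner_adj[OF clin, of f h] X(1) by simp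
    then show ?thesis using that ran[OF that] by (simp add: V_def plus_blinfun.rep_eq cinner_add_left)
  qed
  obtain C where C: "C \<ge> 0" and tri: "\<And>(u :: nat \<Rightarrow> 'a) N A K \<epsilon>. ortho u \<Longrightarrow> on_span u N A \<Longrightarrow>
    on_span u N K \<Longrightarrow> adj A = A \<Longrightarrow> 0 \<le> \<epsilon> \<Longrightarrow>
    (\<forall>i<N. \<forall>j<i. cinner ((A + K) (u j)) (u i) = 0) \<Longrightarrow>
    (\<forall>j<N. cmod (cinner ((A + K) (u j)) (u j)) \<le> \<epsilon>) \<Longrightarrow>
    (\<exists>Y. schatten_sum p (2 * N) Y \<le> C * schatten_sum p (2 * N) K \<and> norm (A - Y) \<le> \<epsilon>)"
    using triangular_sum_bound[of k, where 'a = 'a] unfolding p_def by blast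
  \<comment> \<open>\<open>2 ^ p\<close> undoes the halving of \<open>s n\<close>, \<open>C\<close>
    is the triangular constant, and the inner 2 stems from \<open>schatten_sum_le\<close> for
    \<open>K\<close>.\<close>
  define D where "D = 2 ^ p * (C * (2 * (\<Sum>n. t n ^ p)))"
  have e1: "norm (e n) = 1" for n
    using norm_e[of n] vanish[of n] pos[of n] by auto
  have "s n ^ p * real (Suc n) \<le> D" for n
  proof -
    \<comment> \<open>With half of \<open>s n\<close> as admissible error, the other half remains as
      a lower bound for the approximation numbers of \<open>Y\<close>.\<close>
    define \<epsilon> where "\<epsilon> = s n / 2"
    have \<epsilon>: "\<epsilon> > 0" using pos by (simp add: \<epsilon>_def)
    obtain M where M: "\<And>N f \<mu>. N \<ge> M \<Longrightarrow> f \<noteq> 0 \<Longrightarrow> cproj e N (V f) = \<mu> *\<^sub>C f \<Longrightarrow> cmod \<mu> < \<epsilon>"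
      using compression_eigenvalues_small[OF V _ ranV \<epsilon>] no_eig unfolding V_def by metis
    \<comment> \<open>At least \<open>M\<close>, so that the eigenvalues of the compression are
      below \<open>\<epsilon>\<close>, and at least \<open>Suc n\<close>, so that
      \<open>e 0, ..., e n\<close> are not cut off.\<close>
    define N where "N = max M (Suc n)"
    let ?P = "cproj e N"
    define a where "a = ?P o\<^sub>L X o\<^sub>L ?P"
    define c where "c = ?P o\<^sub>L K o\<^sub>L ?P"
    have PP: "?P o\<^sub>L ?P = ?P" by (rule blinfun_eqI) (simp add: cproj_idem[OF ortho])
    have a: "on_span e N a" and c: "on_span e N c"
      unfolding on_span_def a_def c_def
      by (auto intro!: clin_compose clin clin_cproj K.clin simp: blinfun_compose_assoc)
         (auto simp: PP simp flip: blinfun_compose_assoc)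
    have ac: "(a + c) f = ?P (V (?P f))" for f
      by (simp add: a_def c_def V_def plus_blinfun.rep_eq blinfun.add_right)
    obtain u where u: "ortho u" "\<And>j. j < N \<Longrightarrow> norm (u j) = 1" "cproj u N = ?P"
        "\<And>i j. i < N \<Longrightarrow> j < i \<Longrightarrow> cinner ((a + c) (u j)) (u i) = 0"
      using ex_schur_basis[OF ortho e1 on_span_add[OF a c]] by metis
    have a': "on_span u N a" and c': "on_span u N c" using a c by (simp_all add: on_span_def u(3))
    have small: "cmod (cinner ((a + c) (u j)) (u j)) \<le> \<epsilon>" if j: "j < N" for j
    proof -
      obtain f where "f \<noteq> 0" "?P f = f" "(a + c) f = cinner ((a + c) (u j)) (u j) *\<^sub>C f"
        using upper_triangular_eigenvalue[OF u(1,2) on_span_add[OF a' c'] u(4) j] u(3) by auto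
      then show ?thesis using M[of N f] by (simp add: ac N_def less_imp_le)
    qed
    have "adj a = a" by (simp add: a_def adj_compose X(1) blinfun_compose_assoc)
    then obtain Y where Y: "schatten_sum p (2 * N) Y \<le> C * schatten_sum p (2 * N) c" "norm (a - Y) \<le> \<epsilon>"
      using tri[OF u(1) a' c' _ less_imp_le[OF \<epsilon>]] u(4) small by metis
    have "schatten_sum p (2 * N) c \<le> schatten_sum p (2 * N) K"
      unfolding schatten_sum_def
    proof (intro sum_mono power_mono)
      fix i
      have "apn i c \<le> norm ?P * apn i K * norm ?P" unfolding c_def by (rule apn_compose_le)
      also have "\<dots> \<le> 1 * apn i K * 1"
        by (intro mult_mono norm_cproj_le_1 ortho) auto
      finally show "apn i c \<le> apn i K" by simp
    qed auto
    also have "\<dots> \<le> 2 * (\<Sum>n<2 * N. t n ^ p)" by (rule K.schatten_sum_le)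
    also have "(\<Sum>n<2 * N. t n ^ p) \<le> (\<Sum>n. t n ^ p)"
      using t K.nonneg unfolding p_def by (intro sum_le_suminf) auto
    finally have SY: "schatten_sum p (2 * N) Y \<le> C * (2 * (\<Sum>n. t n ^ p))"
      using Y(1) C by (meson mult_left_mono order_trans mult_le_cancel_left_pos zero_less_numeral)
    have "s n \<le> apn n a"
    proof (rule le_apn[where a = s])
      show "a (e i) = s i *\<^sub>R e i" if "i \<le> n" for i
        using that by (simp add: a_def N_def cproj_fix[OF ortho] Xe blinfun.scaleR_right)
    qed (use dec nonneg in \<open>auto dest: decseqD\<close>)
    also have "\<dots> \<le> apn (n + 0) (Y + (a - Y))" by simp
    also have "\<dots> \<le> apn n Y + apn 0 (a - Y)" by (rule apn_add)
    also have "\<dots> \<le> apn n Y + \<epsilon>" using apn_le_norm[of 0 "a - Y"] Y(2) by simp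
    finally have sY: "s n / 2 \<le> apn n Y" by (simp add: \<epsilon>_def)
    \<comment> \<open>The first \<open>n + 1\<close> approximation numbers of \<open>Y\<close> are
      all at least \<open>s n / 2\<close>; adding their powers produces the factor
      \<open>Suc n\<close>.\<close>
    have "(s n / 2) ^ p * real (Suc n) = (\<Sum>i<Suc n. (s n / 2) ^ p)" by simp
    also have "\<dots> \<le> (\<Sum>i<Suc n. apn i Y ^ p)"
    proof (intro sum_mono power_mono)
      fix i assume "i \<in> {..<Suc n}"
      then show "s n / 2 \<le> apn i Y" using sY apn_antimono[of i n Y] by simp
    qed (use nonneg in auto)
    also have "Suc n \<le> N" by (simp add: N_def)
    then have "(\<Sum>i<Suc n. apn i Y ^ p) \<le> schatten_sum p (2 * N) Y"
      unfolding schatten_sum_def by (intro sum_mono2) auto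
    also note SY
    finally have "2 ^ p * ((s n / 2) ^ p * real (Suc n)) \<le> D"
      unfolding D_def by (intro mult_left_mono) auto
    then show ?thesis by (simp add: power_divide)
  qed
  then show ?thesis unfolding p_def by blast
qed


section \<open>Operators in a closed subspace and their s-numbers\<close>

text \<open>For \<open>g = R (e n) - s n *\<^sub>R e n\<close> one has
  \<open>R g + s n *\<^sub>R g = 0\<close>, and a non-negative operator has no negative
  eigenvalue.\<close>

lemma (in svd) sqrt_eigen:
  assumes R: "adj R = R" "\<And>f. 0 \<le> inner (R f) f" "R o\<^sub>L R = adj X o\<^sub>L X"
  shows "R (e n) = s n *\<^sub>R e n"
proof -
  let ?g = "R (e n) - s n *\<^sub>R e n"
  have RR: "R (R f) = adj X (X f)" for f
    using R(3) by (metis blinfun_apply_blinfun_compose)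
  show ?thesis
  proof (cases "s n = 0")
    case True
    have "(norm (R (e n)))\<^sup>2 = inner (e n) (adj X (X (e n)))"
      using inner_adj[of R "e n" "R (e n)"] by (simp add: R(1) RR power2_norm_eq_inner)
    also have "\<dots> = 0" using eig[of n] True by simp
    finally show ?thesis using True by simp
  next
    case False
    have "R ?g + s n *\<^sub>R ?g = 0"
      by (simp add: blinfun.diff_right blinfun.scaleR_right RR eig power2_eq_square scaleR_diff_right)
    then have "inner (R ?g) ?g + s n * inner ?g ?g = 0"
      by (metis inner_add_left inner_scaleR_left inner_zero_left)
    moreover have "0 \<le> s n * inner ?g ?g" using nonneg[of n] by simp
    ultimately have "s n * inner ?g ?g = 0" using R(2)[of ?g] by linarith
    then show ?thesis using False by simp
  qed
qed

text \<open>Two square roots agree on each \<open>e n\<close>, and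
  \<open>norm (R f) = norm (X f)\<close> lets \<open>R\<close> decay on the residuals as
  \<open>X\<close> does, so they agree everywhere. This makes the definite description in
  \<open>modulus\<close> meaningful.\<close>

lemma (in svd) sqrt_unique:
  assumes R: "clin R" "adj R = R" "\<And>f. 0 \<le> inner (R f) f" "R o\<^sub>L R = adj X o\<^sub>L X"
    and Q: "clin Q" "adj Q = Q" "\<And>f. 0 \<le> inner (Q f) f" "Q o\<^sub>L Q = adj X o\<^sub>L X"
  shows "R = Q"
proof (rule blinfun_eqI)
  fix f
  have lim: "(\<lambda>n. R (cproj e n f)) \<longlonglongrightarrow> R f"
    if R: "adj R = R" "R o\<^sub>L R = adj X o\<^sub>L X" for R
  proof -
    have nrm: "norm (R g) = norm (X g)" for g
    proof -
      have "(norm (R g))\<^sup>2 = inner g ((R o\<^sub>L R) g)"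
        using inner_adj[of R g "R g"] by (simp add: R(1) power2_norm_eq_inner)
      also have "\<dots> = (norm (X g))\<^sup>2" by (simp add: R(2) power2_norm_eq_inner inner_adj)
      finally show ?thesis by (simp add: power2_eq_iff_nonneg)
    qed
    have "(\<lambda>n. R f - R (cproj e n f)) \<longlonglongrightarrow> 0"
    proof (rule Lim_null_comparison)
      show "\<forall>\<^sub>F n in sequentially. norm (R f - R (cproj e n f)) \<le> s n * norm f"
        using res_bound' by (simp add: nrm flip: blinfun.diff_right)
      show "(\<lambda>n. s n * norm f) \<longlonglongrightarrow> 0" using tendsto_mult_right[OF lim, of "norm f"] by simp
    qed
    then have "(\<lambda>n. R f - (R f - R (cproj e n f))) \<longlonglongrightarrow> R f - 0" by (intro tendsto_intros)
    then show ?thesis by simp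
  qed
  have "R (cproj e n f) = Q (cproj e n f)" for n
    by (simp add: cproj_apply blinfun.sum_right clinD[OF R(1)] clinD[OF Q(1)]
        sqrt_eigen[OF R(2-4)] sqrt_eigen[OF Q(2-4)])
  then show "R f = Q f" using lim[OF R(2,4)] lim[OF Q(2,4)] LIMSEQ_unique by auto
qed

text \<open>The square root is the norm limit of the diagonal operators with entries
  \<open>s i\<close>; the tail after \<open>n\<close> has norm at most \<open>s n\<close>. The
  projection \<open>P\<close> records that the root acts in the same subspace as
  \<open>X\<close>.\<close>

lemma (in svd) ex_sqrt:
  assumes P: "clin P" "adj P = P" "P o\<^sub>L X = X" "X o\<^sub>L P = X"
  shows "\<exists>R. clin R \<and> adj R = R \<and> (\<forall>f. 0 \<le> inner (R f) f) \<and> R o\<^sub>L R = adj X o\<^sub>L X \<and>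
    P o\<^sub>L R = R \<and> R o\<^sub>L P = R"
proof -
  define R where "R n = diag_op e n (\<lambda>i. complex_of_real (s i))" for n
  have cR: "clin (R n)" and aR: "adj (R n) = R n" for n
    by (simp_all add: R_def clin_diag_op adj_diag_op)
  have diff: "norm (R m - R n) \<le> s n" if "n \<le> m" for m n
  proof -
    have "R m - R n = diag_op e m (\<lambda>i. if i < n then 0 else complex_of_real (s i))"
    proof (rule blinfun_eqI)
      fix f
      have "{..<m} = {..<n} \<union> {n..<m}" using that by auto
      then have "R m f = R n f + (\<Sum>i\<in>{n..<m}. (complex_of_real (s i) * cinner f (e i)) *\<^sub>C e i)"
        unfolding R_def diag_op_apply by (simp only: sum.union_disjoint finite_lessThan finite_atLeastLessThan
            ivl_disj_int)
      also have "(\<Sum>i\<in>{n..<m}. (complex_of_real (s i) * cinner f (e i)) *\<^sub>C e i)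
          = diag_op e m (\<lambda>i. if i < n then 0 else complex_of_real (s i)) f"
        unfolding diag_op_apply by (intro sum.mono_neutral_cong_left) auto
      finally show "(R m - R n) f = diag_op e m (\<lambda>i. if i < n then 0 else complex_of_real (s i)) f"
        by (simp add: minus_blinfun.rep_eq)
    qed
    also have "norm \<dots> \<le> s n"
      using dec nonneg by (intro norm_diag_op_le ortho) (auto simp: decseq_def)
    finally show ?thesis .
  qed
  have "Cauchy R"
  proof (rule metric_CauchyI)
    fix r :: real assume r: "r > 0"
    then obtain N where N: "\<And>n. n \<ge> N \<Longrightarrow> s n < r"
      using order_tendstoD(2)[OF lim r] by (auto simp: eventually_sequentially)
    have "dist (R m) (R n) < r" if "m \<ge> N" "n \<ge> N" for m n
    proof (cases "n \<le> m")
      case True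
      then show ?thesis using diff[OF True] N[OF that(2)] by (simp add: dist_norm)
    next
      case False
      then show ?thesis using diff[of m n] N[OF that(1)] by (simp add: dist_norm norm_minus_commute)
    qed
    then show "\<exists>M. \<forall>m\<ge>M. \<forall>n\<ge>M. dist (R m) (R n) < r" by blast
  qed
  then obtain Q where Q: "R \<longlonglongrightarrow> Q" using Cauchy_convergent convergent_def by blast
  have Qf: "(\<lambda>n. R n f) \<longlonglongrightarrow> Q f" for f by (intro tendsto_intros Q)
  have "clin Q"
    unfolding clin_def
  proof (intro allI)
    fix c f
    have "(\<lambda>n. R n (c *\<^sub>C f)) \<longlonglongrightarrow> c *\<^sub>C Q f"
      by (simp only: clinD[OF cR]) (rule bounded_linear.tendsto[OF bounded_linear_scaleC Qf])
    then show "Q (c *\<^sub>C f) = c *\<^sub>C Q f" using Qf LIMSEQ_unique by blast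
  qed
  moreover have "adj Q = Q"
  proof (rule adj_eqI)
    fix f g
    have "(\<lambda>n. inner (R n f) g) \<longlonglongrightarrow> inner (Q f) g" by (intro tendsto_intros Q)
    moreover have "(\<lambda>n. inner (R n f) g) \<longlonglongrightarrow> inner f (Q g)"
      unfolding inner_adj aR by (intro tendsto_intros Q)
    ultimately show "inner (Q f) g = inner f (Q g)" using LIMSEQ_unique by blast
  qed
  moreover have "0 \<le> inner (Q f) f" for f
  proof (rule LIMSEQ_le_const)
    show "(\<lambda>n. inner (R n f) f) \<longlonglongrightarrow> inner (Q f) f" by (intro tendsto_intros Q)
    have "cinner (R n f) f = (\<Sum>i<n. complex_of_real (s i * (cmod (cinner f (e i)))\<^sup>2))" for n
      unfolding R_def diag_op_apply cinner_sum_left cinner_scaleC_left of_real_mult complex_norm_square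
      by (simp add: mult.assoc flip: cinner_commute[of "e _"])
    then have "inner (R n f) f = (\<Sum>i<n. s i * (cmod (cinner f (e i)))\<^sup>2)" for n
      unfolding Re_cinner[symmetric] by (simp only: Re_sum Re_complex_of_real)
    then show "\<exists>N. \<forall>n\<ge>N. 0 \<le> inner (R n f) f" using nonneg by (simp add: sum_nonneg)
  qed
  moreover have "Q o\<^sub>L Q = adj X o\<^sub>L X"
  proof -
    have "(\<lambda>n. R n o\<^sub>L R n) \<longlonglongrightarrow> (Q o\<^sub>L Q)"
      by (rule bounded_bilinear.tendsto[OF bounded_bilinear_blinfun_compose Q Q])
    moreover have "(\<lambda>n. R n o\<^sub>L R n) \<longlonglongrightarrow> (adj X o\<^sub>L X)"
    proof -
      have le: "norm ((adj X o\<^sub>L X) - (R n o\<^sub>L R n)) \<le> norm X * s n" for n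
      proof (rule norm_blinfun_bound)
        fix f
        have "adj X (X (cproj e n f)) = (R n o\<^sub>L R n) f"
          by (simp add: R_def diag_op_compose[OF ortho] diag_op_apply cproj_apply blinfun.sum_right
              clinD[OF clin] clinD[OF clin_adj[OF clin]] eig scaleR_eq_scaleC scaleC_scaleC
              power2_eq_square mult_ac del: blinfun_apply_blinfun_compose)
        then have "((adj X o\<^sub>L X) - (R n o\<^sub>L R n)) f = adj X (X (f - cproj e n f))"
          by (simp add: minus_blinfun.rep_eq blinfun.diff_right)
        also have "norm \<dots> \<le> norm X * norm (X (f - cproj e n f))"
          using norm_blinfun[of "adj X"] by simp
        also have "\<dots> \<le> norm X * (s n * norm f)" by (intro mult_left_mono res_bound') simp
        finally show "norm (((adj X o\<^sub>L X) - (R n o\<^sub>L R n)) f) \<le> norm X * s n * norm f"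
          by (simp add: mult.assoc)
      qed (simp add: nonneg)
      have "(\<lambda>n. norm X * s n) \<longlonglongrightarrow> 0" using tendsto_mult_left[OF lim, of "norm X"] by simp
      then have "(\<lambda>n. (adj X o\<^sub>L X) - (R n o\<^sub>L R n)) \<longlonglongrightarrow> 0"
        by (rule Lim_null_comparison[OF always_eventually[OF allI[OF le]]])
      then have "(\<lambda>n. (adj X o\<^sub>L X) - ((adj X o\<^sub>L X) - (R n o\<^sub>L R n))) \<longlonglongrightarrow> (adj X o\<^sub>L X) - 0"
        by (intro tendsto_intros)
      then show ?thesis by simp
    qed
    ultimately show ?thesis using LIMSEQ_unique by blast
  qed
  moreover have PQ: "P o\<^sub>L Q = Q"
  proof -
    have se: "complex_of_real (s i) *\<^sub>C P (e i) = complex_of_real (s i) *\<^sub>C e i" for i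
    proof (cases "s i = 0")
      case False
      have "P o\<^sub>L adj X = adj X" using P(2,4) by (metis adj_compose)
      then have "P (adj X (X (e i))) = adj X (X (e i))" by (metis blinfun_apply_blinfun_compose)
      then have "P (e i) = e i" using False by (simp add: eig blinfun.scaleR_right)
      then show ?thesis by simp
    qed simp
    have "(complex_of_real (s i) * z) *\<^sub>C e i = z *\<^sub>C (complex_of_real (s i) *\<^sub>C e i)" for i z
      by (simp add: scaleC_scaleC mult.commute)
    then have "P (R n f) = R n f" for n f
      by (simp only: R_def diag_op_apply blinfun.sum_right clinD[OF P(1)] se)
    then have "(\<lambda>n. R n f) \<longlonglongrightarrow> P (Q f)" for f
      using blinfun.tendsto[OF tendsto_const[of P] Qf[of f]] by simp
    then show ?thesis using Qf LIMSEQ_unique by (intro blinfun_eqI) fastforce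
  qed
  moreover have "Q o\<^sub>L P = Q" using PQ \<open>adj Q = Q\<close> P(2) by (metis adj_compose)
  ultimately show ?thesis by blast
qed

text \<open>At the first index where the lists differ, the larger value occurs in one list, while in
  the other it can only have occurred earlier, where both agree; the multiplicities would
  differ.\<close>

lemma enumerates_eigenvalues_unique:
  assumes s: "enumerates_eigenvalues A s" and t: "enumerates_eigenvalues A t"
  shows "s = t"
proof (rule ccontr)
  assume "s \<noteq> t"
  then obtain m where m: "s m \<noteq> t m" by blast
  define n where "n = (LEAST n. s n \<noteq> t n)"
  have n: "s n \<noteq> t n" unfolding n_def by (rule LeastI) (rule m)
  have eq: "s k = t k" if "k < n" for k using that not_less_Least unfolding n_def by blast
  have False if s: "enumerates_eigenvalues A s" and t: "enumerates_eigenvalues A t"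
    and eq: "\<And>k. k < n \<Longrightarrow> s k = t k" and less: "s n < t n" for s t
  proof -
    have t0: "t n > 0" using s less by (auto simp: enumerates_eigenvalues_def intro: le_less_trans)
    have "{k. s k = t n} \<subset> {k. t k = t n}"
    proof -
      have dec: "decseq s" using s by (simp add: enumerates_eigenvalues_def)
      have "k < n" if k: "s k = t n" for k
      proof (rule ccontr)
        assume "\<not> k < n"
        then have "s k \<le> s n" using decseqD[OF dec, of n k] by simp
        then show False using k less by simp
      qed
      then have "{k. s k = t n} \<subseteq> {k. t k = t n}" using eq by (intro Collect_mono impI) metis
      moreover have "n \<in> {k. t k = t n}" "n \<notin> {k. s k = t n}" using less by auto
      ultimately show ?thesis by blast
    qed
    moreover have "finite {k. t k = t n}" "card {k. s k = t n} = card {k. t k = t n}"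
      using s t t0 by (auto simp: enumerates_eigenvalues_def)
    ultimately show False by (metis psubset_card_mono less_irrefl)
  qed
  from this[OF s t] this[OF t s] eq n show False by (metis linorder_neqE_linordered_idom)
qed

locale closed_csubspace =
  fixes H :: "'a::{complex_inner, banach} set" and P :: "'a \<Rightarrow>\<^sub>L 'a"
  assumes subspace: "complex_vector.subspace H" and closed: "closed H"
    and P_in: "P x \<in> H" and P_fix: "x \<in> H \<Longrightarrow> P x = x"
    and clin_P: "clin P" and adj_P: "adj P = P"

text \<open>The real projection is complex linear because the orthogonal complement of a complex
  subspace is again a complex subspace.\<close>

lemma ex_closed_csubspace:
  fixes H :: "'a::{complex_inner, banach} set"
  assumes H: "complex_vector.subspace H" "closed H"
  shows "\<exists>P. closed_csubspace H P"
proof -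
  have H': "subspace H"
    using H(1) unfolding complex_vector.subspace_def subspace_def by (simp add: scaleR_eq_scaleC)
  obtain P :: "'a \<Rightarrow>\<^sub>L 'a" where P: "\<And>x. P x \<in> H" "\<And>x z. z \<in> H \<Longrightarrow> inner (x - P x) z = 0"
    "\<And>x. x \<in> H \<Longrightarrow> P x = x"
    using ex_orthogonal_projection_blinfun[OF H' H(2)] by metis
  have adj: "adj P = P"
  proof (rule adj_eqI)
    fix f g
    have "inner (P f) (g - P g) = 0" "inner (f - P f) (P g) = 0"
      using P(2)[OF P(1), of g f] P(2)[OF P(1), of f g] by (simp_all add: inner_commute)
    then show "inner (P f) g = inner f (P g)" by (simp add: inner_diff_left inner_diff_right)
  qed
  have "clin P"
    unfolding clin_def
  proof (intro allI)
    fix c x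
    let ?w = "c *\<^sub>C (x - P x)"
    have "inner ?w z = 0" if z: "z \<in> H" for z
    proof -
      have "\<i> *\<^sub>C z \<in> H" using H(1) z by (rule complex_vector.subspace_scale)
      then have "cinner (x - P x) z = 0" using P(2) z by (simp add: cinner_eq_zero_iff)
      then have "cinner ?w z = 0" by (simp add: cinner_scaleC_left)
      then show ?thesis by (simp flip: Re_cinner)
    qed
    then have "inner ?w (P (P ?w)) = 0" using P(1) by blast
    then have "inner (P ?w) (P ?w) = 0" by (simp add: inner_adj adj)
    then have "P ?w = 0" by simp
    moreover have "P (c *\<^sub>C P x) = c *\<^sub>C P x"
      using H(1) P(1) by (intro P(3) complex_vector.subspace_scale)
    ultimately show "P (c *\<^sub>C x) = c *\<^sub>C P x"
      by (simp add: scaleC_diff_right blinfun.diff_right)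
  qed
  with adj P(1,3) H have "closed_csubspace H P" by unfold_locales auto
  then show ?thesis by blast
qed

context closed_csubspace
begin

lemma in_H_iff: "x \<in> H \<longleftrightarrow> P x = x"
  using P_in P_fix by metis

text \<open>Operators of \<open>H\<close> extended by zero to the complement. Through
  \<open>graph\<close> they correspond one-to-one to the everywhere defined bounded operators in
  \<open>H\<close> given as relations (\<open>bounded_operatorE\<close>,
  \<open>graph_eqD\<close>).\<close>

definition on_H :: "('a \<Rightarrow>\<^sub>L 'a) \<Rightarrow> bool" where
  "on_H X \<longleftrightarrow> clin X \<and> P o\<^sub>L X = X \<and> X o\<^sub>L P = X"

definition graph :: "('a \<Rightarrow>\<^sub>L 'a) \<Rightarrow> 'a rel" where
  "graph X = {(f, X f) | f. f \<in> H}"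

lemma graph_iff: "(f, g) \<in> graph X \<longleftrightarrow> f \<in> H \<and> g = X f"
  by (auto simp: graph_def)

lemma on_H_in: "on_H X \<Longrightarrow> X f \<in> H"
  unfolding on_H_def by (metis P_in blinfun_apply_blinfun_compose)

lemma on_H_P: "on_H X \<Longrightarrow> X (P f) = X f"
  unfolding on_H_def by (metis blinfun_apply_blinfun_compose)

lemma on_H_adj: "on_H X \<Longrightarrow> on_H (adj X)"
  unfolding on_H_def by (metis adj_P adj_compose clin_adj)

lemma on_H_add: "on_H X \<Longrightarrow> on_H Y \<Longrightarrow> on_H (X + Y)"
  by (simp add: on_H_def clin_add blinfun_compose_simps)

lemma on_H_compose: "on_H X \<Longrightarrow> on_H Y \<Longrightarrow> on_H (X o\<^sub>L Y)"
  unfolding on_H_def by (metis blinfun_compose_assoc clin_compose)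

lemma graph_eqD: "on_H X \<Longrightarrow> on_H Y \<Longrightarrow> graph X = graph Y \<Longrightarrow> X = Y"
  by (rule blinfun_eqI) (metis P_in graph_iff on_H_P)

lemma graph_compose: "on_H X \<Longrightarrow> graph X O graph Y = graph (Y o\<^sub>L X)"
  using on_H_in by (auto simp: graph_def)

lemma bounded_operator_graph:
  assumes "on_H X"
  shows "bounded_operator H (graph X)"
  unfolding bounded_operator_def linear_operator_def
proof (intro conjI exI)
  show "graph X \<subseteq> H \<times> H" using on_H_in[OF assms] by (auto simp: graph_def)
  show "single_valued (graph X)" by (auto simp: single_valued_def graph_iff)
  show "(0, 0) \<in> graph X" using complex_vector.subspace_0[OF subspace] by (simp add: graph_iff)
  show "\<forall>f g f' g'. (f, g) \<in> graph X \<longrightarrow> (f', g') \<in> graph X \<longrightarrow> (f + f', g + g') \<in> graph X"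
    using complex_vector.subspace_add[OF subspace] by (simp add: graph_iff blinfun.add_right)
  show "\<forall>c f g. (f, g) \<in> graph X \<longrightarrow> (c *\<^sub>C f, c *\<^sub>C g) \<in> graph X"
    using complex_vector.subspace_scale[OF subspace] assms by (simp add: graph_iff clinD on_H_def)
  show "Domain (graph X) = H" by (auto simp: graph_def)
  show "\<forall>(f, g)\<in>graph X. norm g \<le> norm X * norm f"
    using norm_blinfun[of X] by (auto simp: graph_def)
qed

lemma bounded_operatorE:
  assumes T: "bounded_operator H T"
  obtains X where "on_H X" "T = graph X"
proof -
  have lin: "linear_operator H T" and dom: "Domain T = H" using T by (auto simp: bounded_operator_def)
  obtain c where c: "\<And>f g. (f, g) \<in> T \<Longrightarrow> norm g \<le> c * norm f"
    using T by (auto simp: bounded_operator_def)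
  define t where "t f = (THE g. (f, g) \<in> T)" for f
  have sv: "g = g'" if "(f, g) \<in> T" "(f, g') \<in> T" for f g g'
    using lin that by (auto simp: linear_operator_def single_valued_def)
  have t_eq: "t f = g" if "(f, g) \<in> T" for f g
    unfolding t_def using that sv by blast
  have t: "(f, t f) \<in> T" if "f \<in> H" for f
    using that dom t_eq by (metis DomainE)
  have add: "(f + f', g + g') \<in> T" if "(f, g) \<in> T" "(f', g') \<in> T" for f g f' g'
    using lin that by (simp add: linear_operator_def)
  have scale: "(z *\<^sub>C f, z *\<^sub>C g) \<in> T" if "(f, g) \<in> T" for f g z
    using lin that by (simp add: linear_operator_def)
  have bl: "bounded_linear (\<lambda>f. t (P f))"
  proof (rule bounded_linear_intro[where K = "\<bar>c\<bar> * norm P"])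
    show "t (P (x + y)) = t (P x) + t (P y)" for x y
      using add[OF t[OF P_in] t[OF P_in]] by (intro t_eq) (simp add: blinfun.add_right)
    show "t (P (r *\<^sub>R x)) = r *\<^sub>R t (P x)" for r x
      using scale[OF t[OF P_in], of "complex_of_real r" x]
      by (intro t_eq) (simp add: blinfun.scaleR_right scaleC_of_real)
    show "norm (t (P x)) \<le> norm x * (\<bar>c\<bar> * norm P)" for x
    proof -
      have "norm (t (P x)) \<le> c * norm (P x)" by (rule c[OF t[OF P_in]])
      also have "\<dots> \<le> \<bar>c\<bar> * (norm P * norm x)"
        by (intro mult_mono norm_blinfun) auto
      finally show ?thesis by (simp add: mult_ac)
    qed
  qed
  define X where "X = Blinfun (\<lambda>f. t (P f))"
  have X: "X f = t (P f)" for f unfolding X_def by (simp add: bounded_linear_Blinfun_apply[OF bl])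
  have "on_H X"
    unfolding on_H_def
  proof (intro conjI blinfun_eqI)
    show "clin X"
      unfolding clin_def X using scale[OF t[OF P_in]] by (intro allI t_eq) (simp add: clinD[OF clin_P])
    have "t (P f) \<in> H" for f using t[OF P_in, of f] lin by (auto simp: linear_operator_def)
    then show "(P o\<^sub>L X) f = X f" for f by (simp add: X P_fix)
    show "(X o\<^sub>L P) f = X f" for f by (simp add: X P_fix P_in)
  qed
  moreover have "T = graph X"
  proof (intro set_eqI, clarify)
    fix f g
    have "(f, g) \<in> T \<longleftrightarrow> f \<in> H \<and> g = t f" using t t_eq dom by blast
    then show "(f, g) \<in> T \<longleftrightarrow> (f, g) \<in> graph X"
      by (auto simp: graph_iff X P_fix)
  qed
  ultimately show ?thesis by (rule that)
qed

lemma adjoint_in_graph: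
  assumes "on_H X"
  shows "adjoint_in H (graph X) = graph (adj X)"
proof (intro set_eqI, clarify)
  fix u w
  have cX: "clin X" using assms by (simp add: on_H_def)
  have "w = adj X u" if "w \<in> H" and *: "\<And>f. f \<in> H \<Longrightarrow> cinner (X f) u = cinner f w"
  proof -
    have "cinner f (adj X u - w) = 0" if "f \<in> H" for f
      using *[OF that] by (simp add: cinner_diff_right cinner_adj[OF cX])
    moreover have "adj X u - w \<in> H"
      using on_H_in[OF on_H_adj[OF assms]] \<open>w \<in> H\<close> by (intro complex_vector.subspace_diff[OF subspace])
    ultimately have "cinner (adj X u - w) (adj X u - w) = 0" by blast
    then show ?thesis by (simp add: cinner_self)
  qed
  then show "(u, w) \<in> adjoint_in H (graph X) \<longleftrightarrow> (u, w) \<in> graph (adj X)"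
    using on_H_in[OF on_H_adj[OF assms], of u]
    by (auto simp: adjoint_in_def graph_def cinner_adj[OF cX])
qed

lemma compact_operator_graphD:
  assumes X: "on_H X" and "compact_operator H (graph X)"
  shows "compact_blinfun X"
  unfolding compact_blinfun_def
proof (intro allI impI)
  fix f :: "nat \<Rightarrow> 'a" assume f: "\<forall>n. norm (f n) \<le> 1"
  let ?C = "closure (graph X `` (H \<inter> cball 0 1))"
  have "compact ?C" using assms(2) by (simp add: compact_operator_def)
  moreover have "norm (P (f n)) \<le> 1" for n
  proof -
    have "(norm (P (f n)))\<^sup>2 = inner (f n) (P (f n))"
      by (simp add: power2_norm_eq_inner inner_adj adj_P P_fix P_in)
    also have "\<dots> \<le> norm (f n) * norm (P (f n))" by (rule norm_cauchy_schwarz)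
    also have "\<dots> \<le> 1 * norm (P (f n))" using f by (intro mult_right_mono) auto
    finally show ?thesis by (cases "P (f n) = 0") (auto simp: power2_eq_square)
  qed
  then have "X (f n) \<in> ?C" for n
    using P_in[of "f n"] on_H_P[OF X, of "f n"]
    by (intro subsetD[OF closure_subset] ImageI[of "P (f n)"]) (auto simp: graph_iff)
  then have "\<forall>n. (X \<circ> f) n \<in> ?C" by simp
  ultimately have "\<exists>l\<in>?C. \<exists>r. strict_mono r \<and> ((X \<circ> f) \<circ> r) \<longlonglongrightarrow> l"
    unfolding compact_def by (metis (no_types))
  then show "\<exists>r l. strict_mono r \<and> (\<lambda>n. X (f (r n))) \<longlonglongrightarrow> l" by (auto simp: o_def)
qed

lemma nonneg_operator_graph_iff:
  assumes X: "on_H X"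
  shows "nonneg_operator H (graph X) \<longleftrightarrow> adj X = X \<and> (\<forall>f. 0 \<le> inner (X f) f)"
proof
  assume n: "nonneg_operator H (graph X)"
  then have "graph (adj X) = graph X" by (simp add: nonneg_operator_def adjoint_in_graph[OF X])
  then have "adj X = X" using X on_H_adj graph_eqD by blast
  moreover have "0 \<le> inner (X f) f" for f
  proof -
    have "cinner (X (P f)) (P f) \<in> \<real>\<^sub>\<ge>\<^sub>0" using n P_in[of f] by (auto simp: nonneg_operator_def graph_def)
    then have "0 \<le> inner (X (P f)) (P f)" by (auto simp: complex_nonneg_Reals_iff Re_cinner)
    also have "\<dots> = inner (X f) (P f)" by (simp add: on_H_P[OF X])
    also have "\<dots> = inner (P (X f)) f" by (simp add: inner_adj adj_P)
    also have "\<dots> = inner (X f) f" using on_H_in[OF X] by (simp add: P_fix)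
    finally show ?thesis .
  qed
  ultimately show "adj X = X \<and> (\<forall>f. 0 \<le> inner (X f) f)" by blast
next
  assume a: "adj X = X \<and> (\<forall>f. 0 \<le> inner (X f) f)"
  have cX: "clin X" using X by (simp add: on_H_def)
  have "cinner (X f) f \<in> \<real>\<^sub>\<ge>\<^sub>0" for f
  proof -
    have "cinner (X f) f = cnj (cinner (X f) f)"
      using cinner_adj[OF cX, of f f] a cinner_commute[of f "X f"] by simp
    then have "Im (cinner (X f) f) = 0" by (simp add: complex_eq_iff)
    then show ?thesis using a by (simp add: complex_nonneg_Reals_iff Re_cinner)
  qed
  then show "nonneg_operator H (graph X)"
    using bounded_operator_graph[OF X] a
    by (auto simp: nonneg_operator_def bounded_operator_def adjoint_in_graph[OF X] graph_iff)
qed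

text \<open>A competing relation is turned into an operator by \<open>bounded_operatorE\<close> and
  then equals \<open>R\<close> by \<open>sqrt_unique\<close>, which is where the decomposition of
  \<open>X\<close> enters.\<close>

lemma modulus_graph:
  assumes X: "on_H X" and svd: "svd X e s"
    and R: "on_H R" "adj R = R" "\<And>f. 0 \<le> inner (R f) f" "R o\<^sub>L R = adj X o\<^sub>L X"
  shows "modulus H (graph X) = graph R"
  unfolding modulus_def
proof (rule the_equality)
  interpret svd X e s by fact
  have XX: "graph X O adjoint_in H (graph X) = graph (adj X o\<^sub>L X)"
    using X by (simp add: adjoint_in_graph graph_compose)
  show "bounded_operator H (graph R) \<and> nonneg_operator H (graph R) \<and>
      graph R O graph R = graph X O adjoint_in H (graph X)"
    using R by (simp add: bounded_operator_graph nonneg_operator_graph_iff XX graph_compose)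
  fix T assume T: "bounded_operator H T \<and> nonneg_operator H T \<and> T O T = graph X O adjoint_in H (graph X)"
  then obtain Q where Q: "on_H Q" "T = graph Q" using bounded_operatorE by blast
  have "graph (Q o\<^sub>L Q) = graph (adj X o\<^sub>L X)" using T Q XX by (simp add: graph_compose)
  then have QQ: "Q o\<^sub>L Q = adj X o\<^sub>L X" using Q X on_H_adj on_H_compose graph_eqD by metis
  have aQ: "adj Q = Q" and nQ: "\<And>f. 0 \<le> inner (Q f) f"
    using T Q nonneg_operator_graph_iff by auto
  have "clin Q" "clin R" using Q(1) R(1) by (auto simp: on_H_def)
  then have "Q = R" by (rule sqrt_unique[OF _ aQ nQ QQ _ R(2,3,4)])
  then show "T = graph R" using Q(2) by simp
qed

text \<open>The \<open>e n\<close> with \<open>s n = \<mu>\<close> form a basis of the eigenspace.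
  An eigenvector is orthogonal to all other \<open>e n\<close> since \<open>R\<close> is
  self-adjoint; its residual is orthogonal to every \<open>e n\<close>, so it is killed by
  \<open>R\<close>, but it also belongs to the eigenvalue \<open>\<mu>\<close>, hence it is
  zero.\<close>

lemma enumerates_eigenvalues_graph:
  assumes svd: "svd X e s" and R: "on_H R" "adj R = R" "\<And>f. 0 \<le> inner (R f) f" "R o\<^sub>L R = adj X o\<^sub>L X"
  shows "enumerates_eigenvalues (graph R) s"
  unfolding enumerates_eigenvalues_def
proof (intro conjI allI impI)
  interpret svd X e s by fact
  show "decseq s" by (rule dec)
  show "0 \<le> s n" for n by (rule nonneg)
  have cR: "clin R" using R(1) by (simp add: on_H_def)
  have Re: "R (e n) = s n *\<^sub>R e n" for n by (rule sqrt_eigen[OF R(2-4)])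
  fix \<mu> :: real assume \<mu>: "\<mu> > 0"
  define I where "I = {n. s n = \<mu>}"
  obtain N where N: "\<And>n. n \<ge> N \<Longrightarrow> s n < \<mu>"
    using order_tendstoD(2)[OF lim \<mu>] by (auto simp: eventually_sequentially)
  have IN: "I \<subseteq> {..<N}" using N by (force simp: I_def not_less[symmetric])
  then show fin: "finite {n. s n = \<mu>}" unfolding I_def[symmetric] by (rule finite_subset) simp
  have finI: "finite I" using fin by (simp add: I_def)
  have e1: "norm (e n) = 1" if "n \<in> I" for n
    using norm_e[of n] vanish[of n] that \<mu> by (auto simp: I_def)
  have inj: "inj_on e I"
  proof (rule inj_onI)
    fix i j assume "i \<in> I" "j \<in> I" "e i = e j"
    then show "i = j" using orth[of i j] e1[of j] by (auto simp: cinner_self)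
  qed
  let ?E = "eigenspace (graph R) (complex_of_real \<mu>)"
  have E: "f \<in> ?E \<longleftrightarrow> f \<in> H \<and> R f = \<mu> *\<^sub>R f" for f
    by (auto simp: eigenspace_def graph_iff scaleC_of_real)
  have "complex_vector.dim ?E = card (e ` I)"
  proof (rule complex_vector.dim_unique)
    show "e ` I \<subseteq> ?E"
    proof clarify
      fix n assume n: "n \<in> I"
      then have "R (e n) = \<mu> *\<^sub>R e n" using Re by (simp add: I_def)
      moreover have "e n \<in> H"
      proof -
        have "P (R (e n)) = R (e n)" using on_H_in[OF R(1)] P_fix by blast
        then have "P (e n) = e n" using calculation \<mu> by (simp add: blinfun.scaleR_right)
        then show ?thesis using in_H_iff by simp
      qed
      ultimately show "e n \<in> ?E" using E by simp
    qed
    show "?E \<subseteq> complex_vector.span (e ` I)"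
    proof
      fix f assume "f \<in> ?E"
      then have Rf: "R f = \<mu> *\<^sub>R f" using E by simp
      have 0: "cinner f (e n) = 0" if "n \<notin> I" for n
      proof -
        have "complex_of_real \<mu> * cinner f (e n) = cinner (R f) (e n)" by (simp add: Rf cinner_scaleR_left)
        also have "\<dots> = complex_of_real (s n) * cinner f (e n)"
          by (simp add: cinner_adj[OF cR] R(2) Re cinner_scaleR_right)
        finally show ?thesis using that by (auto simp: I_def)
      qed
      let ?r = "f - cproj e N f"
      have "cinner ?r (e n) = 0" for n
      proof (cases "n < N")
        case False
        then have "n \<notin> I" using IN by auto
        then show ?thesis
          using 0 False by (simp add: cinner_diff_left cproj_apply ortho_sum[OF ortho])
      qed (simp add: cproj_orth[OF ortho])
      then have "norm (X ?r) \<le> s n * norm ?r" for n by (intro bound)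
      moreover have "(\<lambda>n. s n * norm ?r) \<longlonglongrightarrow> 0 * norm ?r" by (intro tendsto_intros lim)
      ultimately have "norm (X ?r) \<le> 0 * norm ?r" by (intro LIMSEQ_le_const) auto
      then have "(R o\<^sub>L R) ?r = 0" by (simp add: R(4))
      then have "inner ?r (R (R ?r)) = 0" by simp
      then have "inner (R ?r) (R ?r) = 0" by (simp add: inner_adj R(2))
      then have R0: "R ?r = 0" by simp
      have "R (cproj e N f) = \<mu> *\<^sub>R cproj e N f"
        unfolding cproj_apply blinfun.sum_right clinD[OF cR] scaleR_sum_right Re
      proof (intro sum.cong refl)
        fix n
        show "cinner f (e n) *\<^sub>C s n *\<^sub>R e n = \<mu> *\<^sub>R (cinner f (e n) *\<^sub>C e n)"
          using 0[of n] by (cases "n \<in> I") (auto simp: I_def scaleR_eq_scaleC scaleC_scaleC mult.commute)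
      qed
      then have "\<mu> *\<^sub>R ?r = 0" using R0 Rf by (simp add: blinfun.diff_right scaleR_diff_right)
      then have "f = cproj e N f" using \<mu> by simp
      also have "\<dots> = (\<Sum>n\<in>I. cinner f (e n) *\<^sub>C e n)"
        unfolding cproj_apply using IN 0 by (intro sum.mono_neutral_right) auto
      also have "\<dots> \<in> complex_vector.span (e ` I)"
        by (intro complex_vector.span_sum complex_vector.span_scale complex_vector.span_base) auto
      finally show "f \<in> complex_vector.span (e ` I)" .
    qed
    show "\<not> complex_vector.dependent (e ` I)"
    proof
      assume "complex_vector.dependent (e ` I)"
      then obtain u v where v: "v \<in> e ` I" "u v \<noteq> 0" "(\<Sum>w\<in>e ` I. u w *\<^sub>C w) = 0"
        using complex_vector.dependent_finite[of "e ` I"] finI by auto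
      obtain n where n: "n \<in> I" "v = e n" using v(1) by blast
      have "0 = cinner (\<Sum>i\<in>I. u (e i) *\<^sub>C e i) (e n)" using v(3) by (simp add: sum.reindex[OF inj])
      also have "\<dots> = (\<Sum>i\<in>I. if i = n then u (e n) else 0)"
        unfolding cinner_sum_left cinner_scaleC_left
        by (intro sum.cong refl) (auto simp: orth cinner_self e1[OF n(1)])
      also have "\<dots> = u v" using finI n by simp
      finally show False using v(2) by simp
    qed
  qed simp
  also have "\<dots> = card I" using card_image[OF inj] .
  finally show "card {n. s n = \<mu>} = complex_vector.dim ?E" by (simp add: I_def)
qed

text \<open>For \<open>n = 0\<close> both sides refer to the index 0, as \<open>n - 1\<close> is
  truncated subtraction.\<close>

lemma s_number_graph:
  assumes X: "on_H X" and svd: "svd X e s"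
  shows "s_number H (graph X) n = s (n - 1)"
proof -
  obtain R where R: "clin R" "adj R = R" "\<forall>f. 0 \<le> inner (R f) f" "R o\<^sub>L R = adj X o\<^sub>L X"
      "P o\<^sub>L R = R" "R o\<^sub>L P = R"
    using svd.ex_sqrt[OF svd clin_P adj_P] X by (auto simp: on_H_def)
  have R': "on_H R" using R by (simp add: on_H_def)
  have "modulus H (graph X) = graph R" using modulus_graph[OF X svd R' R(2) _ R(4)] R(3) by blast
  moreover have "(THE s. enumerates_eigenvalues (graph R) s) = s"
    using enumerates_eigenvalues_graph[OF svd R' R(2) _ R(4)] R(3) enumerates_eigenvalues_unique
    by (intro the_equality) blast+
  ultimately show ?thesis by (simp add: s_number_def)
qed

end


section \<open>Completeness of the space of square-integrable functions\<close>

lemma L2_eq_refl: "square_integrable f \<Longrightarrow> L2_eq f f"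
  by (simp add: L2_eq_def)

lemma L2_rep:
  obtains f where "x = abs_L2 f" "square_integrable f"
  using that by (induct x rule: L2.abs_induct) (auto simp: L2_eq_def)

lemma cinner_abs_L2:
  "square_integrable f \<Longrightarrow> square_integrable g \<Longrightarrow>
    cinner (abs_L2 f) (abs_L2 g) = (LINT x|lebesgue. f x * cnj (g x))"
  by (rule cinner_L2.abs_eq) (auto simp: eq_onp_def L2_eq_refl)

lemma norm_abs_L2:
  assumes "square_integrable f"
  shows "(norm (abs_L2 f))\<^sup>2 = (LINT x|lebesgue. (cmod (f x))\<^sup>2)"
proof -
  have "complex_of_real ((norm (abs_L2 f))\<^sup>2) = (LINT x|lebesgue. complex_of_real ((cmod (f x))\<^sup>2))"
    unfolding cinner_self[symmetric] cinner_abs_L2[OF assms assms] by (simp only: complex_norm_square)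
  then show ?thesis by (simp only: integral_complex_of_real of_real_eq_iff)
qed

lemma square_integrable_diff:
  "square_integrable f \<Longrightarrow> square_integrable g \<Longrightarrow> square_integrable (\<lambda>x. f x - g x)"
  using square_integrable_add[of f "\<lambda>x. (-1) * g x"] square_integrable_scale[of g "-1"] by simp

lemma abs_L2_diff:
  assumes "square_integrable f" "square_integrable g"
  shows "abs_L2 f - abs_L2 g = abs_L2 (\<lambda>x. f x - g x)"
proof -
  have "abs_L2 f - abs_L2 g = abs_L2 f + (-1) *\<^sub>C abs_L2 g"
    by (simp add: scaleC_minus_one)
  also have "(-1) *\<^sub>C abs_L2 g = abs_L2 (\<lambda>x. (-1) * g x)"
    by (intro scaleC_L2.abs_eq L2_eq_refl assms)
  also have "abs_L2 f + \<dots> = abs_L2 (\<lambda>x. f x + (-1) * g x)"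
    by (intro plus_L2.abs_eq L2_eq_refl square_integrable_scale assms)
  finally show ?thesis by simp
qed

lemma nn_integral_norm_abs_L2:
  assumes "square_integrable f"
  shows "(\<integral>\<^sup>+x. ennreal ((cmod (f x))\<^sup>2) \<partial>lebesgue) = ennreal ((norm (abs_L2 f))\<^sup>2)"
  using assms unfolding norm_abs_L2[OF assms]
  by (intro nn_integral_eq_integral) (auto simp: square_integrable_def)

lemma square_integrableI_nn_integral:
  assumes "f \<in> borel_measurable lebesgue"
    and "(\<integral>\<^sup>+x. ennreal ((cmod (f x))\<^sup>2) \<partial>lebesgue) < \<infinity>"
  shows "square_integrable f"
proof -
  have "(\<lambda>x. (cmod (f x))\<^sup>2) \<in> borel_measurable lebesgue" using assms(1) by measurable
  then show ?thesis
    using assms unfolding square_integrable_def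
    by (intro conjI integrableI_bounded) auto
qed

text \<open>Multiplication by such a weight reduces completeness of \<open>L\<^sub>2\<close> to the subsequence theorem
  for Cauchy sequences in \<open>L\<^sub>1\<close>.\<close>

lemma ex_square_integrable_weight:
  "\<exists>w :: 'a::euclidean_space \<Rightarrow> real. (\<forall>x. w x > 0) \<and> square_integrable (\<lambda>x. complex_of_real (w x))"
proof -
  obtain h :: "'a \<Rightarrow> ennreal" where h: "h \<in> borel_measurable lborel" "integral\<^sup>N lborel h \<noteq> \<infinity>"
      "\<And>x. 0 < h x \<and> h x < \<infinity>"
    using sigma_finite_measure.Ex_finite_integrable_function[OF sigma_finite_lborel] by auto
  define w where "w x = sqrt (enn2real (h x))" for x
  have pos: "w x > 0" for x
    using h(3)[of x] by (simp add: w_def enn2real_positive_iff)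
  have m: "w \<in> borel_measurable lborel" unfolding w_def using h(1) by measurable
  have m': "(\<lambda>x. complex_of_real (w x)) \<in> borel_measurable lebesgue"
    using measurable_completion[OF m] by measurable
  have "ennreal ((cmod (complex_of_real (w x)))\<^sup>2) = h x" for x
    using h(3)[of x] by (simp add: w_def)
  then have "(\<integral>\<^sup>+x. ennreal ((cmod (complex_of_real (w x)))\<^sup>2) \<partial>lebesgue) < \<infinity>"
    using h(2) by (simp add: nn_integral_completion less_top)
  with m' have "square_integrable (\<lambda>x. complex_of_real (w x))"
    by (rule square_integrableI_nn_integral)
  with pos show ?thesis by blast
qed

text \<open>Cauchy-Schwarz for \<open>cinner\<close>, applied to the moduli of \<open>f\<close> and
  \<open>g\<close>.\<close>

lemma integral_norm_mult_le:
  assumes f: "square_integrable f" and g: "square_integrable g"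
  shows "(LINT x|lebesgue. cmod (f x) * cmod (g x)) \<le> norm (abs_L2 f) * norm (abs_L2 g)"
proof -
  have abs: "square_integrable (\<lambda>x. complex_of_real (cmod (f x)))"
    and nrm: "norm (abs_L2 (\<lambda>x. complex_of_real (cmod (f x)))) = norm (abs_L2 f)"
    if "square_integrable f" for f :: "'a \<Rightarrow> complex"
  proof -
    have "f \<in> borel_measurable lebesgue" using that by (simp add: square_integrable_def)
    then have "(\<lambda>x. complex_of_real (cmod (f x))) \<in> borel_measurable lebesgue" by measurable
    then show 1: "square_integrable (\<lambda>x. complex_of_real (cmod (f x)))"
      using that by (simp add: square_integrable_def)
    have "(norm (abs_L2 (\<lambda>x. complex_of_real (cmod (f x)))))\<^sup>2 = (norm (abs_L2 f))\<^sup>2"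
      unfolding norm_abs_L2[OF 1] norm_abs_L2[OF that] by simp
    then show "norm (abs_L2 (\<lambda>x. complex_of_real (cmod (f x)))) = norm (abs_L2 f)"
      by (simp add: power2_eq_iff_nonneg)
  qed
  have "complex_of_real (LINT x|lebesgue. cmod (f x) * cmod (g x))
      = cinner (abs_L2 (\<lambda>x. complex_of_real (cmod (f x)))) (abs_L2 (\<lambda>x. complex_of_real (cmod (g x))))"
    unfolding cinner_abs_L2[OF abs[OF f] abs[OF g]] by (simp flip: integral_complex_of_real)
  then have "\<bar>LINT x|lebesgue. cmod (f x) * cmod (g x)\<bar> \<le> norm (abs_L2 f) * norm (abs_L2 g)"
    using norm_cinner_le[of "abs_L2 (\<lambda>x. complex_of_real (cmod (f x)))"]
    by (metis norm_of_real nrm[OF f] nrm[OF g])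
  then show ?thesis by linarith
qed

text \<open>The weighted sequence has a subsequence converging almost everywhere; dividing by the
  weight gives the candidate \<open>g\<close>. Fatou's lemma along the subsequence shows that
  \<open>g\<close> is square integrable and is the limit in norm of the whole sequence.\<close>

instance L2 :: (euclidean_space) banach
proof
  fix X :: "nat \<Rightarrow> 'a L2" assume X: "Cauchy X"
  have "\<exists>f. \<forall>n. X n = abs_L2 (f n) \<and> square_integrable (f n)"
    by (intro choice allI) (metis L2_rep)
  then obtain f where Xf: "\<And>n. X n = abs_L2 (f n)" and f: "\<And>n. square_integrable (f n)" by blast
  obtain w :: "'a \<Rightarrow> real" where w0: "\<And>x. w x > 0" and w: "square_integrable (\<lambda>x. complex_of_real (w x))"
    using ex_square_integrable_weight by blast
  have fm[measurable]: "f n \<in> borel_measurable lebesgue" for n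
    using f by (simp add: square_integrable_def)
  have dX: "X m - X n = abs_L2 (\<lambda>x. f m x - f n x)" for m n
    by (simp add: Xf abs_L2_diff f)
  have int: "integrable lebesgue (\<lambda>x. f n x * complex_of_real (w x))" for n
    using integrable_mult_cnj[OF f w] by simp
  have "\<exists>N. \<forall>i\<ge>N. \<forall>j\<ge>N. (LINT x|lebesgue. norm (f i x * complex_of_real (w x) - f j x * complex_of_real (w x))) < r"
    if r: "r > 0" for r
  proof -
    define c where "c = norm (abs_L2 (\<lambda>x::'a. complex_of_real (w x))) + 1"
    have c: "c > 0" by (simp add: c_def add_nonneg_pos)
    obtain N where N: "\<And>i j. i \<ge> N \<Longrightarrow> j \<ge> N \<Longrightarrow> norm (X i - X j) < r / c"
      using X c r unfolding Cauchy_iff by (meson divide_pos_pos)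
    have "(LINT x|lebesgue. norm (f i x * complex_of_real (w x) - f j x * complex_of_real (w x))) < r"
      if "i \<ge> N" "j \<ge> N" for i j
    proof -
      have "(LINT x|lebesgue. norm (f i x * complex_of_real (w x) - f j x * complex_of_real (w x)))
          = (LINT x|lebesgue. cmod (f i x - f j x) * cmod (complex_of_real (w x)))"
        by (simp only: left_diff_distrib[symmetric] norm_mult)
      also have "\<dots> \<le> norm (X i - X j) * norm (abs_L2 (\<lambda>x::'a. complex_of_real (w x)))"
        unfolding dX by (intro integral_norm_mult_le square_integrable_diff f w)
      also have "\<dots> \<le> norm (X i - X j) * c" by (intro mult_left_mono) (auto simp: c_def)
      also have "\<dots> < r / c * c" using N[OF that] c by (intro mult_strict_right_mono)
      finally show ?thesis using c by simp
    qed
    then show ?thesis by blast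
  qed
  then obtain r where r: "strict_mono r"
    and AE: "AE x in lebesgue. Cauchy (\<lambda>i. f (r i) x * complex_of_real (w x))"
    using cauchy_L1_AE_cauchy_subseq[of lebesgue "\<lambda>n x. f n x * complex_of_real (w x)"] int by blast
  define g where "g x = lim (\<lambda>i. f (r i) x)" for x
  have gm[measurable]: "g \<in> borel_measurable lebesgue" unfolding g_def by measurable
  have lim: "AE x in lebesgue. (\<lambda>i. f (r i) x) \<longlonglongrightarrow> g x"
    using AE
  proof eventually_elim
    case (elim x)
    then obtain l where "(\<lambda>i. f (r i) x * complex_of_real (w x)) \<longlonglongrightarrow> l"
      using Cauchy_convergent convergent_def by blast
    then have "(\<lambda>i. f (r i) x * complex_of_real (w x) / complex_of_real (w x)) \<longlonglongrightarrow> l / complex_of_real (w x)"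
      using w0[of x] by (intro tendsto_divide tendsto_const) auto
    then have "(\<lambda>i. f (r i) x) \<longlonglongrightarrow> l / complex_of_real (w x)" using w0[of x] by simp
    then show ?case unfolding g_def using limI by fastforce
  qed
  have fatou: "(\<integral>\<^sup>+x. ennreal ((cmod (f n x - g x))\<^sup>2) \<partial>lebesgue) \<le> ennreal (c\<^sup>2)"
    if c: "\<And>m. m \<ge> n \<Longrightarrow> norm (X n - X m) \<le> c" for n c
  proof -
    have "(\<integral>\<^sup>+x. ennreal ((cmod (f n x - g x))\<^sup>2) \<partial>lebesgue)
        = (\<integral>\<^sup>+x. liminf (\<lambda>i. ennreal ((cmod (f n x - f (r i) x))\<^sup>2)) \<partial>lebesgue)"
    proof (rule nn_integral_cong_AE)
      show "AE x in lebesgue. ennreal ((cmod (f n x - g x))\<^sup>2)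
          = liminf (\<lambda>i. ennreal ((cmod (f n x - f (r i) x))\<^sup>2))"
        using lim
      proof eventually_elim
        case (elim x)
        have "(\<lambda>i. ennreal ((cmod (f n x - f (r i) x))\<^sup>2)) \<longlonglongrightarrow> ennreal ((cmod (f n x - g x))\<^sup>2)"
          by (intro tendsto_ennrealI tendsto_intros elim)
        then show ?case by (intro lim_imp_Liminf[symmetric]) auto
      qed
    qed
    also have "\<dots> \<le> liminf (\<lambda>i. \<integral>\<^sup>+x. ennreal ((cmod (f n x - f (r i) x))\<^sup>2) \<partial>lebesgue)"
      by (intro nn_integral_liminf) measurable
    also have "\<dots> \<le> ennreal (c\<^sup>2)"
    proof (rule Liminf_le)
      show "\<forall>\<^sub>F i in sequentially. (\<integral>\<^sup>+x. ennreal ((cmod (f n x - f (r i) x))\<^sup>2) \<partial>lebesgue) \<le> ennreal (c\<^sup>2)"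
      proof (rule eventually_sequentiallyI[of n])
        fix i assume "i \<ge> n"
        then have "r i \<ge> n" using seq_suble[OF r, of i] by linarith
        then have "(norm (X n - X (r i)))\<^sup>2 \<le> c\<^sup>2" using c by (intro power_mono) auto
        then show "(\<integral>\<^sup>+x. ennreal ((cmod (f n x - f (r i) x))\<^sup>2) \<partial>lebesgue) \<le> ennreal (c\<^sup>2)"
          by (simp add: nn_integral_norm_abs_L2 square_integrable_diff f dX ennreal_leI)
      qed
    qed simp
    finally show ?thesis .
  qed
  have diff: "square_integrable (\<lambda>x. f n x - g x)" "norm (abs_L2 (\<lambda>x. f n x - g x)) \<le> c"
    if c: "\<And>m. m \<ge> n \<Longrightarrow> norm (X n - X m) \<le> c" for n c
  proof -
    have "(\<integral>\<^sup>+x. ennreal ((cmod (f n x - g x))\<^sup>2) \<partial>lebesgue) < \<infinity>"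
      using le_less_trans[OF fatou[OF c] ennreal_less_top] by simp
    then show 1: "square_integrable (\<lambda>x. f n x - g x)"
      by (intro square_integrableI_nn_integral) (auto intro!: borel_measurable_diff)
    have "c \<ge> 0" using c[of n] by simp
    moreover have "(norm (abs_L2 (\<lambda>x. f n x - g x)))\<^sup>2 \<le> c\<^sup>2"
      using fatou[OF c] unfolding nn_integral_norm_abs_L2[OF 1] by simp
    ultimately show "norm (abs_L2 (\<lambda>x. f n x - g x)) \<le> c" by (rule power2_le_imp_le[rotated])
  qed
  obtain N where "\<And>m n. m \<ge> N \<Longrightarrow> n \<ge> N \<Longrightarrow> norm (X m - X n) < 1"
    using X unfolding Cauchy_iff by (meson zero_less_one)
  then have "square_integrable (\<lambda>x. f N x - g x)" by (intro diff(1)[of N 1]) (auto intro: less_imp_le)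
  from square_integrable_diff[OF f[of N] this] have g: "square_integrable g" by simp
  have "X \<longlonglongrightarrow> abs_L2 g"
  proof (rule metric_LIMSEQ_I)
    fix e :: real assume e: "e > 0"
    then obtain N where N: "\<And>m n. m \<ge> N \<Longrightarrow> n \<ge> N \<Longrightarrow> norm (X m - X n) < e / 2"
      using X unfolding Cauchy_iff by (meson half_gt_zero)
    have "dist (X n) (abs_L2 g) < e" if "n \<ge> N" for n
    proof -
      have "norm (abs_L2 (\<lambda>x. f n x - g x)) \<le> e / 2"
        using N that by (intro diff(2)) (auto intro: less_imp_le)
      then show ?thesis using e by (simp add: dist_norm Xf abs_L2_diff[OF f g])
    qed
    then show "\<exists>N. \<forall>n\<ge>N. dist (X n) (abs_L2 g) < e" by blast
  qed
  then show "convergent X" by (auto simp: convergent_def)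
qed

lemma L2_on_iff:
  assumes "square_integrable f"
  shows "abs_L2 f \<in> L2_on \<Omega> \<longleftrightarrow> (AE x in lebesgue. x \<notin> \<Omega> \<longrightarrow> f x = 0)"
proof
  assume "abs_L2 f \<in> L2_on \<Omega>"
  then obtain g where g: "abs_L2 f = abs_L2 g" "square_integrable g"
    "AE x in lebesgue. x \<notin> \<Omega> \<longrightarrow> g x = 0" by (auto simp: L2_on_def)
  then have "L2_eq f g"
    using Quotient3_rel[OF Quotient3_L2, of f g] assms by (simp add: L2_eq_refl)
  then have "AE x in lebesgue. f x = g x" by (simp add: L2_eq_def)
  with g(3) show "AE x in lebesgue. x \<notin> \<Omega> \<longrightarrow> f x = 0" by eventually_elim auto
qed (use assms in \<open>auto simp: L2_on_def\<close>)

lemma L2_on_subspace: "complex_vector.subspace (L2_on \<Omega>)"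
  unfolding complex_vector.subspace_def
proof (intro conjI ballI allI)
  show "0 \<in> L2_on \<Omega>"
    unfolding zero_L2_def by (subst L2_on_iff) (auto simp: square_integrable_zero)
  fix x assume "x \<in> L2_on \<Omega>"
  then obtain f where f: "x = abs_L2 f" "square_integrable f" "AE t in lebesgue. t \<notin> \<Omega> \<longrightarrow> f t = 0"
    by (auto simp: L2_on_def)
  show "c *\<^sub>C x \<in> L2_on \<Omega>" for c
  proof -
    have "c *\<^sub>C x = abs_L2 (\<lambda>t. c * f t)"
      unfolding f(1) using f(2) by (intro scaleC_L2.abs_eq) (auto simp: eq_onp_def L2_eq_refl)
    moreover have "AE t in lebesgue. t \<notin> \<Omega> \<longrightarrow> c * f t = 0" using f(3) by eventually_elim auto
    ultimately show ?thesis using square_integrable_scale[OF f(2)] by (simp add: L2_on_iff)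
  qed
  fix y assume "y \<in> L2_on \<Omega>"
  then obtain g where g: "y = abs_L2 g" "square_integrable g" "AE t in lebesgue. t \<notin> \<Omega> \<longrightarrow> g t = 0"
    by (auto simp: L2_on_def)
  have "x + y = abs_L2 (\<lambda>t. f t + g t)"
    unfolding f(1) g(1) using f(2) g(2) by (intro plus_L2.abs_eq) (auto simp: eq_onp_def L2_eq_refl)
  moreover have "AE t in lebesgue. t \<notin> \<Omega> \<longrightarrow> f t + g t = 0" using f(3) g(3) by eventually_elim auto
  ultimately show "x + y \<in> L2_on \<Omega>" using square_integrable_add[OF f(2) g(2)] by (simp add: L2_on_iff)
qed

text \<open>The squared norm of \<open>f\<close> outside \<open>\<Omega>\<close> is at most the
  squared distance to any element of \<open>L2_on \<Omega>\<close>, so it vanishes for a limit of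
  such elements.\<close>

lemma closed_L2_on:
  assumes "open \<Omega>"
  shows "closed (L2_on \<Omega>)"
  unfolding closed_sequential_limits
proof (intro allI impI, elim conjE)
  fix y x assume y: "\<forall>n. y n \<in> L2_on \<Omega>" and lim: "y \<longlonglongrightarrow> x"
  obtain f where f: "x = abs_L2 f" "square_integrable f" by (rule L2_rep)
  have fm[measurable]: "f \<in> borel_measurable lebesgue" using f(2) by (simp add: square_integrable_def)
  have [measurable]: "\<Omega> \<in> sets lebesgue" using assms by simp
  define I where "I = (\<integral>\<^sup>+t. ennreal (indicator (- \<Omega>) t * (cmod (f t))\<^sup>2) \<partial>lebesgue)"
  have "I \<le> ennreal ((norm (x - y n))\<^sup>2)" for n
  proof -
    obtain g where g: "y n = abs_L2 g" "square_integrable g" "AE t in lebesgue. t \<notin> \<Omega> \<longrightarrow> g t = 0"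
      using y by (auto simp: L2_on_def)
    have "I \<le> (\<integral>\<^sup>+t. ennreal ((cmod (f t - g t))\<^sup>2) \<partial>lebesgue)"
      unfolding I_def
    proof (rule nn_integral_mono_AE)
      show "AE t in lebesgue. ennreal (indicator (- \<Omega>) t * (cmod (f t))\<^sup>2) \<le> ennreal ((cmod (f t - g t))\<^sup>2)"
        using g(3) by eventually_elim (auto simp: indicator_def)
    qed
    also have "\<dots> = ennreal ((norm (x - y n))\<^sup>2)"
      by (simp add: nn_integral_norm_abs_L2 square_integrable_diff f g abs_L2_diff)
    finally show ?thesis .
  qed
  moreover have "(\<lambda>n. ennreal ((norm (x - y n))\<^sup>2)) \<longlonglongrightarrow> ennreal ((norm (x - x))\<^sup>2)"
    by (intro tendsto_ennrealI tendsto_intros lim)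
  ultimately have "I \<le> ennreal ((norm (x - x))\<^sup>2)" by (intro LIMSEQ_le_const) auto
  then have "I = 0" by simp
  then have "AE t in lebesgue. ennreal (indicator (- \<Omega>) t * (cmod (f t))\<^sup>2) = 0"
    unfolding I_def by (subst (asm) nn_integral_0_iff_AE) auto
  then have "AE t in lebesgue. t \<notin> \<Omega> \<longrightarrow> f t = 0"
    by eventually_elim (auto simp: indicator_def)
  then show "x \<in> L2_on \<Omega>" using f by (simp add: L2_on_iff)
qed


section \<open>Density of test functions\<close>

lemma C_k_const: "C_k k (\<lambda>x::'a::euclidean_space. c :: complex)"
proof (induction k arbitrary: c)
  case (Suc k)
  have "partial_deriv i (\<lambda>x::'a. c) = (\<lambda>x. 0)" for i
    by (rule ext) (simp add: partial_deriv_def frechet_derivative_const)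
  then show ?case using Suc by simp
qed simp

lemma partial_deriv_eqI:
  assumes "(f has_derivative f') (at x)"
  shows "partial_deriv i f x = f' i"
  using frechet_derivative_at[OF assms] by (simp add: partial_deriv_def)

lemma C_k_Suc_imp:
  fixes f :: "'a::euclidean_space \<Rightarrow> complex"
  shows "C_k (Suc k) f \<Longrightarrow> C_k k f"
proof (induction k arbitrary: f)
  case 0
  then show ?case
    by (auto intro!: continuous_at_imp_continuous_on differentiable_imp_continuous_within)
qed (metis C_k.simps(2))

lemma C_k_add:
  fixes f g :: "'a::euclidean_space \<Rightarrow> complex"
  shows "C_k k f \<Longrightarrow> C_k k g \<Longrightarrow> C_k k (\<lambda>x. f x + g x)"
proof (induction k arbitrary: f g)
  case (Suc k)
  have "partial_deriv i (\<lambda>x. f x + g x) = (\<lambda>x. partial_deriv i f x + partial_deriv i g x)" for i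
  proof
    fix x
    show "partial_deriv i (\<lambda>x. f x + g x) x = partial_deriv i f x + partial_deriv i g x"
      unfolding partial_deriv_def[of i f] partial_deriv_def[of i g] using Suc.prems
      by (intro partial_deriv_eqI has_derivative_add) (auto simp: frechet_derivative_works)
  qed
  then show ?case using Suc by (auto intro: differentiable_add)
qed (auto intro: continuous_on_add)

lemma C_k_mult:
  fixes f g :: "'a::euclidean_space \<Rightarrow> complex"
  shows "C_k k f \<Longrightarrow> C_k k g \<Longrightarrow> C_k k (\<lambda>x. f x * g x)"
proof (induction k arbitrary: f g)
  case (Suc k)
  have "partial_deriv i (\<lambda>x. f x * g x) = (\<lambda>x. f x * partial_deriv i g x + partial_deriv i f x * g x)" for i
  proof
    fix x
    show "partial_deriv i (\<lambda>x. f x * g x) x = f x * partial_deriv i g x + partial_deriv i f x * g x"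
      unfolding partial_deriv_def[of i f] partial_deriv_def[of i g] using Suc.prems
      by (intro partial_deriv_eqI has_derivative_mult) (auto simp: frechet_derivative_works)
  qed
  moreover have "C_k k f" "C_k k g" using Suc.prems by (auto intro: C_k_Suc_imp)
  ultimately show ?case using Suc.prems Suc.IH by (auto intro!: differentiable_mult C_k_add)
qed (auto intro: continuous_on_mult)

lemma C_k_prod:
  fixes f :: "'b \<Rightarrow> 'a::euclidean_space \<Rightarrow> complex"
  assumes "\<And>i. i \<in> I \<Longrightarrow> C_k k (f i)"
  shows "C_k k (\<lambda>x. \<Prod>i\<in>I. f i x)"
  using assms by (induction I rule: infinite_finite_induct) (auto intro: C_k_const C_k_mult)

text \<open>Partial derivatives of a function of one coordinate are one-dimensional derivatives up
  to constant factors; hence the whole sequence \<open>d\<close> of derivatives is taken as data,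
  and the induction on \<open>k\<close> treats all \<open>n\<close> at once.\<close>

lemma C_k_coordinate:
  fixes i :: "'a::euclidean_space"
  assumes d: "\<And>n x. (d n has_real_derivative d (Suc n) x) (at x)"
  shows "C_k k (\<lambda>x. complex_of_real (d n (inner x i)))"
proof (induction k arbitrary: n)
  case 0
  have "isCont (d n) x" for x using d DERIV_isCont by blast
  then have "continuous_on UNIV (d n)" by (simp add: continuous_at_imp_continuous_on)
  then have "continuous_on UNIV (\<lambda>x. d n (inner x i))"
    by (rule continuous_on_compose2) (auto intro: continuous_intros)
  then show ?case by (auto intro: continuous_on_of_real)
next
  case (Suc k)
  have der: "((\<lambda>x. complex_of_real (d n (inner x i))) has_derivative
      (\<lambda>h. complex_of_real (inner h i * d (Suc n) (inner x i)))) (at x)" for x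
  proof -
    have "((\<lambda>x. d n (inner x i)) has_derivative (\<lambda>h. inner h i * d (Suc n) (inner x i))) (at x)"
    proof -
      have "((\<lambda>x. inner x i) has_derivative (\<lambda>h. inner h i)) (at x)"
        by (auto intro!: derivative_eq_intros)
      moreover have "(d n has_derivative (\<lambda>h. h * d (Suc n) (inner x i))) (at (inner x i))"
        using d[of n "inner x i"] unfolding has_field_derivative_def
        by (rule has_derivative_eq_rhs) (simp add: fun_eq_iff mult.commute)
      ultimately show ?thesis by (rule has_derivative_compose)
    qed
    then show ?thesis by (rule has_derivative_of_real)
  qed
  have "partial_deriv j (\<lambda>x. complex_of_real (d n (inner x i)))
      = (\<lambda>x. complex_of_real (inner j i) * complex_of_real (d (Suc n) (inner x i)))" for j
    by (rule ext) (simp add: partial_deriv_eqI[OF der])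
  then show ?case using der Suc by (auto simp: differentiable_def intro: C_k_mult C_k_const)
qed

text \<open>These products of a polynomial in \<open>1 / x\<close> with
  \<open>exp (- (1 / x))\<close>, extended by zero, form a family closed under differentiation; it
  contains the standard flat function and all its derivatives.\<close>

definition flat :: "real poly \<Rightarrow> real \<Rightarrow> real" where
  "flat p x = (if x > 0 then poly p (1 / x) * exp (- (1 / x)) else 0)"

lemma poly_exp_tendsto_0: "((\<lambda>t. poly p t * exp (- t)) \<longlongrightarrow> 0) at_top" for p :: "real poly"
proof -
  have "((\<lambda>t. \<Sum>i\<le>degree p. coeff p i * (t ^ i / exp t)) \<longlongrightarrow> (\<Sum>i\<le>degree p. coeff p i * 0)) at_top"
    by (intro tendsto_intros tendsto_power_div_exp_0)
  then show ?thesis by (simp add: poly_altdef sum_distrib_right exp_minus divide_inverse mult.assoc)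
qed

text \<open>The chain rule gives a factor \<open>1 / x\<^sup>2\<close>, encoded by the polynomial
  \<open>[:0, 0, 1:]\<close> in \<open>1 / x\<close>. At 0 the difference quotient is a function of
  the same kind, with \<open>p\<close> multiplied by its variable, and tends to 0.\<close>

lemma flat_has_derivative:
  "(flat p has_real_derivative flat ((p - pderiv p) * [:0, 0, 1:]) x) (at x)"
proof -
  consider "x > 0" | "x < 0" | "x = 0" by linarith
  then show ?thesis
  proof cases
    case 1
    have "((\<lambda>x. poly p (1 / x) * exp (- (1 / x))) has_real_derivative
        flat ((p - pderiv p) * [:0, 0, 1:]) x) (at x)"
      using 1 by (auto intro!: derivative_eq_intros DERIV_chain2[OF poly_DERIV] simp: flat_def)
         (simp add: field_simps power2_eq_square)
    then show ?thesis
      by (rule has_field_derivative_transform_within_open[of _ _ _ "{0<..}"]) (use 1 in \<open>auto simp: flat_def\<close>)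
  next
    case 2
    have "((\<lambda>x. 0) has_real_derivative flat ((p - pderiv p) * [:0, 0, 1:]) x) (at x)"
      using 2 by (auto simp: flat_def)
    then show ?thesis
      by (rule has_field_derivative_transform_within_open[of _ _ _ "{..<0}"]) (use 2 in \<open>auto simp: flat_def\<close>)
  next
    case 3
    have "((\<lambda>h. flat p h / h) \<longlongrightarrow> 0) (at 0)"
    proof (rule filterlim_split_at)
      show "((\<lambda>h. flat p h / h) \<longlongrightarrow> 0) (at_left 0)"
        by (rule tendsto_eventually) (auto simp: flat_def eventually_at_left_field intro!: exI[of _ "-1"])
      have "((\<lambda>h. poly (p * [:0, 1:]) (inverse h) * exp (- inverse h)) \<longlongrightarrow> 0) (at_right 0)"
        by (rule filterlim_compose[OF poly_exp_tendsto_0 filterlim_inverse_at_top_right])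
      then show "((\<lambda>h. flat p h / h) \<longlongrightarrow> 0) (at_right 0)"
        by (rule Lim_transform_eventually)
           (auto simp: flat_def eventually_at_right_field divide_inverse intro!: exI[of _ 1])
    qed
    then show ?thesis using 3 by (simp add: has_field_derivative_iff flat_def)
  qed
qed

section \<open>Bump functions on boxes\<close>

definition bump :: "real \<Rightarrow> real" where
  "bump x = (if x > 0 then exp (- (1 / x)) else 0)"

lemma bump_nonneg: "0 \<le> bump x" and bump_le_1: "bump x \<le> 1"
  by (auto simp: bump_def)

lemma bump_scaled_tendsto: "x > 0 \<Longrightarrow> (\<lambda>n. bump (real (Suc n) * x)) \<longlonglongrightarrow> 1"
proof -
  assume x: "x > 0"
  have "(\<lambda>n. exp (- (inverse (real (Suc n)) * inverse x))) \<longlonglongrightarrow> exp (- (0 * inverse x))"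
    by (intro tendsto_intros LIMSEQ_inverse_real_of_nat)
  moreover have "bump (real (Suc n) * x) = exp (- (inverse (real (Suc n)) * inverse x))" for n
    using x by (simp add: bump_def divide_inverse zero_less_mult_iff)
  ultimately show ?thesis by simp
qed

lemma C_k_bump: "C_k k (\<lambda>x. complex_of_real (bump (c * (inner x i - a))))"
proof -
  \<comment> \<open>\<open>flat (p n)\<close> is the n-th derivative of \<open>flat 1\<close>; the
    inner scaling contributes \<open>c ^ n\<close>.\<close>
  define p where "p n = ((\<lambda>p. (p - pderiv p) * [:0, 0, 1:]) ^^ n) (1 :: real poly)" for n
  define d where "d n t = c ^ n * flat (p n) (c * (t - a))" for n t
  have "(d n has_real_derivative d (Suc n) t) (at t)" for n t
  proof -
    have "((\<lambda>t. flat (p n) (c * (t - a))) has_real_derivative flat (p (Suc n)) (c * (t - a)) * c) (at t)"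
    proof -
      have "(flat (p n) has_real_derivative flat (p (Suc n)) (c * (t - a))) (at (c * (t - a)))"
        using flat_has_derivative by (simp only: p_def funpow.simps o_def)
      moreover have "((\<lambda>t. c * (t - a)) has_real_derivative c) (at t)"
        by (auto intro!: derivative_eq_intros)
      ultimately show ?thesis by (rule DERIV_chain2)
    qed
    from DERIV_cmult[OF this, of "c ^ n"] show ?thesis by (simp add: d_def[abs_def] mult_ac)
  qed
  then have "C_k k (\<lambda>x. complex_of_real (d 0 (inner x i)))" by (rule C_k_coordinate)
  moreover have "d 0 t = bump (c * (t - a))" for t by (simp add: d_def p_def flat_def bump_def)
  ultimately show ?thesis by simp
qed

text \<open>Smooth approximation of the indicator of an open box: positive exactly inside, with
  slopes that steepen as \<open>n\<close> grows. The factor \<open>Suc n\<close> is positive also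
  for \<open>n = 0\<close>.\<close>

definition box_bump :: "'a::euclidean_space \<Rightarrow> 'a \<Rightarrow> nat \<Rightarrow> 'a \<Rightarrow> real" where
  "box_bump a b n x = (\<Prod>i\<in>Basis. bump (real (Suc n) * (inner x i - inner a i)) *
      bump (- real (Suc n) * (inner x i - inner b i)))"

lemma box_bump_nonneg: "0 \<le> box_bump a b n x"
  by (simp add: box_bump_def prod_nonneg bump_nonneg)

lemma box_bump_le_1: "box_bump a b n x \<le> 1"
  unfolding box_bump_def
  by (intro prod_le_1) (simp add: bump_nonneg bump_le_1 mult_le_one)

lemma box_bump_outside: "x \<notin> box a b \<Longrightarrow> box_bump a b n x = 0"
proof -
  assume "x \<notin> box a b"
  then obtain i where "i \<in> Basis" "inner x i \<le> inner a i \<or> inner b i \<le> inner x i"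
    by (auto simp: mem_box not_less)
  then have "bump (real (Suc n) * (inner x i - inner a i)) * bump (- real (Suc n) * (inner x i - inner b i)) = 0"
    by (auto simp: bump_def zero_less_mult_iff mult_less_0_iff simp del: of_nat_Suc)
  then show ?thesis unfolding box_bump_def using \<open>i \<in> Basis\<close> by (meson finite_Basis prod_zero)
qed

lemma box_bump_tendsto: "(\<lambda>n. box_bump a b n x) \<longlonglongrightarrow> indicator (box a b) x"
proof (cases "x \<in> box a b")
  case True
  have "(\<lambda>n. box_bump a b n x) \<longlonglongrightarrow> (\<Prod>i\<in>(Basis :: 'a set). 1 * 1)"
    unfolding box_bump_def
  proof (intro tendsto_prod tendsto_mult)
    fix i :: 'a assume "i \<in> Basis"
    then have i: "inner a i < inner x i" "inner x i < inner b i" using True by (auto simp: mem_box)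
    then show "(\<lambda>n. bump (real (Suc n) * (inner x i - inner a i))) \<longlonglongrightarrow> 1"
      by (intro bump_scaled_tendsto) simp
    have "(\<lambda>n. bump (real (Suc n) * (inner b i - inner x i))) \<longlonglongrightarrow> 1"
      using i by (intro bump_scaled_tendsto) simp
    then show "(\<lambda>n. bump (- real (Suc n) * (inner x i - inner b i))) \<longlonglongrightarrow> 1"
      by (simp only: mult_minus_left mult_minus_right[symmetric] minus_diff_eq)
  qed
  then show ?thesis using True by simp
qed (simp add: box_bump_outside)

lemma test_function_box_bump:
  assumes "cbox a b \<subseteq> \<Omega>"
  shows "test_function \<Omega> (\<lambda>x. complex_of_real (box_bump a b n x))"
proof -
  have "C_k k (\<lambda>x. complex_of_real (box_bump a b n x))" for k
    unfolding box_bump_def of_real_prod of_real_mult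
    by (intro C_k_prod C_k_mult C_k_bump)
  moreover have "closure {x. complex_of_real (box_bump a b n x) \<noteq> 0} \<subseteq> cbox a b"
    by (rule closure_minimal) (use box_bump_outside box_subset_cbox in \<open>auto, blast\<close>)
  moreover have "compact (closure {x. complex_of_real (box_bump a b n x) \<noteq> 0})"
    using calculation(2) bounded_subset[OF bounded_cbox] by (simp add: compact_eq_bounded_closed) blast
  ultimately show ?thesis using assms by (auto simp: test_function_def smooth_def)
qed

lemma square_integrable_box_bump: "square_integrable (\<lambda>x::'a::euclidean_space. complex_of_real (box_bump a b n x))"
proof -
  have "C_k 0 (\<lambda>x. complex_of_real (box_bump a b n x))"
    using test_function_box_bump[of a b UNIV n] by (simp only: test_function_def smooth_def) blast
  then have "(\<lambda>x. complex_of_real (box_bump a b n x)) \<in> borel_measurable borel"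
    by (auto intro: borel_measurable_continuous_onI)
  then have m: "(\<lambda>x. complex_of_real (box_bump a b n x)) \<in> borel_measurable lebesgue"
    by (simp add: measurable_completion)
  moreover have "integrable lebesgue (\<lambda>x. (cmod (complex_of_real (box_bump a b n x)))\<^sup>2)"
  proof (rule Bochner_Integration.integrable_bound)
    show "integrable lebesgue (indicator (cbox a b) :: 'a \<Rightarrow> real)"
      by (simp add: integrable_indicator_iff emeasure_lborel_cbox_eq)
    show "AE x in lebesgue. norm ((cmod (complex_of_real (box_bump a b n x)))\<^sup>2)
        \<le> norm (indicator (cbox a b) x :: real)"
    proof (intro AE_I2)
      fix x
      show "norm ((cmod (complex_of_real (box_bump a b n x)))\<^sup>2) \<le> norm (indicator (cbox a b) x :: real)"
      proof (cases "x \<in> cbox a b")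
        case True
        then show ?thesis using box_bump_nonneg[of a b n x] box_bump_le_1[of a b n x]
          by (simp add: power_le_one)
      next
        case False
        then have "x \<notin> box a b" using box_subset_cbox by blast
        then show ?thesis by (simp add: box_bump_outside)
      qed
    qed
  qed (use m in measurable)
  ultimately show ?thesis by (simp add: square_integrable_def)
qed

text \<open>The bumps of the box are test functions bounded by 1 that tend to its indicator, so
  dominated convergence applies.\<close>

lemma integral_box_eq_0:
  fixes \<Omega> :: "'a::euclidean_space set"
  assumes v: "integrable lebesgue v" "square_integrable v"
    and orth: "\<And>\<phi>. test_function \<Omega> \<phi> \<Longrightarrow> cinner (abs_L2 v) (abs_L2 \<phi>) = 0"
    and box: "cbox a b \<subseteq> \<Omega>"
  shows "(LINT x|lebesgue. indicator (box a b) x *\<^sub>R v x) = 0"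
proof -
  have "(\<lambda>n. LINT x|lebesgue. box_bump a b n x *\<^sub>R v x) \<longlonglongrightarrow> (LINT x|lebesgue. indicator (box a b) x *\<^sub>R v x)"
  proof (rule integral_dominated_convergence[where w = "\<lambda>x. cmod (v x)"])
    show "(\<lambda>x. box_bump a b n x *\<^sub>R v x) \<in> borel_measurable lebesgue" for n
      using integrable_mult_cnj[OF v(2) square_integrable_box_bump[of a b n]]
      by (simp add: scaleR_conv_of_real mult.commute borel_measurable_integrable)
    show "AE x in lebesgue. (\<lambda>n. box_bump a b n x *\<^sub>R v x) \<longlonglongrightarrow> indicator (box a b) x *\<^sub>R v x"
      by (intro AE_I2 tendsto_intros box_bump_tendsto)
    show "AE x in lebesgue. norm (box_bump a b n x *\<^sub>R v x) \<le> cmod (v x)" for n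
      using box_bump_nonneg[of a b n] box_bump_le_1[of a b n]
      by (intro AE_I2) (simp add: mult_left_le_one_le)
    show "(\<lambda>x. indicator (box a b) x *\<^sub>R v x) \<in> borel_measurable lebesgue"
      using v(1) by (intro borel_measurable_scaleR borel_measurable_indicator) auto
  qed (use v(1) in auto)
  moreover have "(LINT x|lebesgue. box_bump a b n x *\<^sub>R v x) = 0" for n
    using orth[OF test_function_box_bump[OF box, of n]]
    by (simp add: cinner_abs_L2[OF v(2) square_integrable_box_bump] scaleR_conv_of_real mult.commute)
  ultimately show ?thesis by (simp add: LIMSEQ_const_iff)
qed


text \<open>Let \<open>w\<close> be \<open>v\<close> cut off to the box. Its integrals over open
  boxes vanish; as boxes are stable under intersection, so do those over Borel sets and, up to null
  sets, over Lebesgue sets. A function with all integrals zero vanishes almost everywhere.\<close>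

lemma AE_box_eq_0:
  fixes \<Omega> :: "'a::euclidean_space set"
  assumes v: "integrable lebesgue v" "square_integrable v"
    and orth: "\<And>\<phi>. test_function \<Omega> \<phi> \<Longrightarrow> cinner (abs_L2 v) (abs_L2 \<phi>) = 0"
    and box: "cbox a b \<subseteq> \<Omega>"
  shows "AE x in lebesgue. x \<in> box a b \<longrightarrow> v x = 0"
proof -
  define w where "w x = indicator (box a b) x *\<^sub>R v x" for x
  have w: "integrable lebesgue w"
    unfolding w_def using v(1) by (intro integrable_mult_indicator) auto
  have int: "set_integrable lebesgue A w" if "A \<in> sets lebesgue" for A
    unfolding set_integrable_def using that w by (intro integrable_mult_indicator)
  let ?G = "range (\<lambda>(a, b). box a b :: 'a set)"
  have w0: "(LINT x|lebesgue. w x) = 0"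
    unfolding w_def by (rule integral_box_eq_0[OF v orth box])
  have borel: "set_lebesgue_integral lebesgue S w = 0" if "S \<in> sets borel" for S
  proof -
    have sets: "T \<in> sets lebesgue" if "T \<in> sigma_sets UNIV ?G" for T
    proof -
      have "T \<in> sets borel" using that by (simp add: borel_eq_box)
      then show ?thesis by simp
    qed
    have "Int_stable ?G" by (auto simp: Int_stable_def box_Int_box)
    moreover have "?G \<subseteq> Pow UNIV" by auto
    moreover have "S \<in> sigma_sets UNIV ?G" using that by (simp add: borel_eq_box)
    ultimately show ?thesis
    proof (induction rule: sigma_sets_induct_disjoint)
      case (basic A)
      then obtain c d where A: "A = box c d" by auto
      obtain a' b' where ab: "A \<inter> box a b = box a' b'" unfolding A box_Int_box by blast
      have "set_lebesgue_integral lebesgue A w = (LINT x|lebesgue. indicator (box a' b') x *\<^sub>R v x)"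
        unfolding set_lebesgue_integral_def w_def ab[symmetric] by (simp add: indicator_inter_arith)
      also have "\<dots> = 0"
      \<comment> \<open>An empty intersection is treated apart: the corners of an empty open box do
        not control its closed box, which need not lie in \<open>\<Omega>\<close>.\<close>
      proof (cases "box a' b' = {}")
        case False
        then have "cbox a' b' = closure (box a' b')" by (simp add: closure_box)
        also have "\<dots> \<subseteq> closure (box a b)" unfolding ab[symmetric] by (intro closure_mono) auto
        also have "\<dots> \<subseteq> cbox a b" by (intro closure_minimal box_subset_cbox closed_cbox)
        finally have "cbox a' b' \<subseteq> \<Omega>" using box by blast
        then show ?thesis by (intro integral_box_eq_0[OF v orth])
      qed simp
      finally show ?case .
    next
      case (compl A)
      have "set_lebesgue_integral lebesgue (UNIV - A) w
          = (LINT x|lebesgue. w x - indicator A x *\<^sub>R w x)"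
        unfolding set_lebesgue_integral_def by (intro Bochner_Integration.integral_cong) (auto simp: indicator_def)
      also have "\<dots> = (LINT x|lebesgue. w x) - set_lebesgue_integral lebesgue A w"
        using int[OF sets[OF compl(1)]] w unfolding set_lebesgue_integral_def set_integrable_def
        by (intro Bochner_Integration.integral_diff)
      finally show ?case using compl w0 by simp
    next
      case (union A)
      have "range A \<subseteq> sets lebesgue" using union sets by blast
      then have "set_lebesgue_integral lebesgue (\<Union>i. A i) w = (\<Sum>i. set_lebesgue_integral lebesgue (A i) w)"
        using union(1) by (intro lebesgue_integral_countable_add int)
          (auto simp: disjoint_family_on_def)
      then show ?case using union by simp
    qed (simp_all add: set_lebesgue_integral_def)
  qed
  have all: "set_lebesgue_integral lebesgue A w = 0" if AL: "A \<in> sets lebesgue" for A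
  proof -
    obtain S N N' where A: "A = S \<union> N" "N \<subseteq> N'" "N' \<in> null_sets lborel" "S \<in> sets lborel"
      using sets_completionE[OF AL] by metis
    have "AE x in lebesgue. x \<notin> N'" using A(3) by (intro AE_completion AE_not_in)
    then have "set_lebesgue_integral lebesgue A w = set_lebesgue_integral lebesgue S w"
      unfolding set_lebesgue_integral_def using int[OF AL] int[of S] A(4)
      by (intro integral_cong_AE) (auto simp: set_integrable_def A(1) indicator_def elim!: eventually_mono
          intro: borel_measurable_integrable subsetD[OF A(2)])
    then show ?thesis using borel[of S] A(4) by simp
  qed
  \<comment> \<open>\<open>density_zero\<close> is a fact about sigma-finite measures; the
    exhausting sets are taken over from \<open>lborel\<close>.\<close>
  obtain C :: "'a set set" where "countable C" "C \<subseteq> sets lborel" "\<Union>C = space lborel" "\<forall>a\<in>C. emeasure lborel a \<noteq> \<infinity>"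
    using sigma_finite_measure.sigma_finite_countable[OF sigma_finite_lborel] by blast
  then interpret sigma_finite_measure "lebesgue :: 'a measure"
    by unfold_locales (auto intro!: exI[of _ C] simp: subset_iff)
  have "AE x in lebesgue. w x = 0" by (rule density_zero[OF w all])
  then show ?thesis by eventually_elim (auto simp: w_def)
qed

text \<open>Boundedness of \<open>\<Omega>\<close> makes \<open>v\<close> integrable.
  \<open>\<Omega>\<close> is a countable union of closed boxes, whose boundaries are null sets, so
  vanishing on the open boxes is enough.\<close>

lemma test_functions_total:
  fixes \<Omega> :: "'a::euclidean_space set"
  assumes \<Omega>: "open \<Omega>" "bounded \<Omega>" and x: "x \<in> L2_on \<Omega>"
    and orth: "\<And>\<phi>. test_function \<Omega> \<phi> \<Longrightarrow> cinner (abs_L2 \<phi>) x = 0"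
  shows "x = 0"
proof -
  obtain v where v: "x = abs_L2 v" "square_integrable v" "AE t in lebesgue. t \<notin> \<Omega> \<longrightarrow> v t = 0"
    using x by (auto simp: L2_on_def)
  have vm: "v \<in> borel_measurable lebesgue" using v(2) by (simp add: square_integrable_def)
  have "emeasure lebesgue \<Omega> < \<infinity>"
    using emeasure_bounded_finite[OF \<Omega>(2)] \<Omega>(1) by simp
  moreover have "(\<lambda>t. (cmod (indicator \<Omega> t))\<^sup>2) = (indicator \<Omega> :: 'a \<Rightarrow> real)"
    by (auto simp: indicator_def)
  ultimately have "square_integrable (indicator \<Omega> :: 'a \<Rightarrow> complex)"
    using \<Omega>(1) unfolding square_integrable_def
    by (auto simp: integrable_indicator_iff intro!: borel_measurable_indicator)
  then have "integrable lebesgue (\<lambda>t. v t * cnj (indicator \<Omega> t))" by (rule integrable_mult_cnj[OF v(2)])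
  moreover have "AE t in lebesgue. v t * cnj (indicator \<Omega> t) = v t"
    using v(3) by eventually_elim (auto simp: indicator_def)
  ultimately have vi: "integrable lebesgue v"
    using integrable_cong_AE_imp[OF _ vm] by (auto elim: eventually_mono)
  have orth': "cinner (abs_L2 v) (abs_L2 \<phi>) = 0" if "test_function \<Omega> \<phi>" for \<phi>
    using orth[OF that] cinner_commute[of "abs_L2 v"] by (simp add: v(1))
  obtain \<D> where D: "countable \<D>" "\<D> \<subseteq> Pow \<Omega>" "\<And>X. X \<in> \<D> \<Longrightarrow> \<exists>a b. X = cbox a b" "\<Union>\<D> = \<Omega>"
    using open_countable_Union_open_cbox[OF \<Omega>(1)] by metis
  have "AE t in lebesgue. t \<in> X \<longrightarrow> v t = 0" if X: "X \<in> \<D>" for X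
  proof -
    obtain a b where ab: "X = cbox a b" using D(3)[OF X] by blast
    have "AE t in lebesgue. t \<in> box a b \<longrightarrow> v t = 0"
      using D(2) X ab by (intro AE_box_eq_0[OF vi v(2) orth']) auto
    moreover have "AE t in lebesgue. t \<notin> cbox a b - box a b"
      using negligible_frontier_interval[of a b] by (intro AE_not_in) (simp add: negligible_iff_null_sets)
    ultimately show ?thesis by eventually_elim (auto simp: ab)
  qed
  then have "AE t in lebesgue. \<forall>X\<in>\<D>. t \<in> X \<longrightarrow> v t = 0"
    unfolding AE_ball_countable[OF D(1)] by blast
  then have "AE t in lebesgue. v t = 0"
    using v(3) by eventually_elim (use D(4) in blast)
  then have "L2_eq v (\<lambda>t. 0)" using v(2) by (simp add: L2_eq_def square_integrable_zero)
  then show ?thesis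
    using Quotient3_rel[OF Quotient3_L2, of v "\<lambda>t. 0"] v(2)
    by (simp add: v(1) zero_L2_def L2_eq_refl square_integrable_zero)
qed


section \<open>Slowly varying functions and the theorem\<close>

text \<open>\<open>l x * x powr \<delta>\<close> is eventually increasing: its derivative is
  \<open>x powr (\<delta> - 1)\<close> times \<open>x * l' x + \<delta> * l x\<close>, and the last
  factor is positive once \<open>x * l' x / l x > - \<delta>\<close>.\<close>

lemma slowly_varying_lower_bound:
  assumes "slowly_varying b l" and \<delta>: "\<delta> > 0"
  shows "\<exists>c>0. \<exists>x0. \<forall>x\<ge>x0. c * x powr (- \<delta>) \<le> l x"
proof -
  obtain l' where b: "b > 0" and pos: "\<And>x. x \<ge> b \<Longrightarrow> l x > 0"
    and der: "\<And>x. x \<ge> b \<Longrightarrow> (l has_real_derivative l' x) (at x within {b..})"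
    and lim: "((\<lambda>x. x * l' x / l x) \<longlongrightarrow> 0) at_top"
    using assms(1) unfolding slowly_varying_def by blast
  have "\<forall>\<^sub>F x in at_top. - \<delta> < x * l' x / l x" using order_tendstoD(1)[OF lim] \<delta> by simp
  then obtain y where y: "\<And>x. x \<ge> y \<Longrightarrow> - \<delta> < x * l' x / l x" by (auto simp: eventually_at_top_linorder)
  \<comment> \<open>Strictly to the right of \<open>b\<close>, so that the one-sided derivative is a
    two-sided one.\<close>
  define x0 where "x0 = max y (b + 1)"
  let ?g = "\<lambda>x. l x * x powr \<delta>"
  have mono: "?g x0 \<le> ?g x" if "x \<ge> x0" for x
  proof (rule DERIV_nonneg_imp_nondecreasing[OF that])
    fix z assume "x0 \<le> z" "z \<le> x"
    then have z: "z \<ge> y" "z > b" "z > 0" using b by (auto simp: x0_def)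
    have "(l has_real_derivative l' z) (at z)"
    proof -
      have "at z within {b..} = at z" using z by (intro at_within_open_subset[of z "{b<..}"]) auto
      then show ?thesis using der[of z] z by simp
    qed
    then have "(?g has_real_derivative l' z * z powr \<delta> + l z * (\<delta> * z powr (\<delta> - 1))) (at z)"
      using z by (auto intro!: derivative_eq_intros)
    moreover have "0 \<le> l' z * z powr \<delta> + l z * (\<delta> * z powr (\<delta> - 1))"
    proof -
      have "z powr \<delta> = z * z powr (\<delta> - 1)" using z by (simp add: powr_diff)
      then have "l' z * z powr \<delta> + l z * (\<delta> * z powr (\<delta> - 1)) = (z * l' z + \<delta> * l z) * z powr (\<delta> - 1)"
        by (simp add: algebra_simps)
      moreover have "0 \<le> z * l' z + \<delta> * l z"
        using y[OF z(1)] pos[of z] z by (simp add: pos_less_divide_eq)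
      ultimately show ?thesis by simp
    qed
    ultimately show "\<exists>d. (?g has_real_derivative d) (at z) \<and> 0 \<le> d" by blast
  qed
  have x0: "x0 > 0" "x0 \<ge> b" using b by (auto simp: x0_def)
  have "?g x0 * x powr (- \<delta>) \<le> l x" if "x \<ge> x0" for x
  proof -
    have "x > 0" using that x0 by simp
    have "?g x0 * x powr (- \<delta>) \<le> ?g x * x powr (- \<delta>)" by (intro mult_right_mono mono that) simp
    also have "\<dots> = l x" using \<open>x > 0\<close> by (simp add: mult.assoc flip: powr_add)
    finally show ?thesis .
  qed
  moreover have "?g x0 > 0" using pos[OF x0(2)] x0 by simp
  ultimately show ?thesis by blast
qed

lemma slowly_varying_not_power_bounded:
  fixes s :: "nat \<Rightarrow> real" and p :: nat
  assumes l: "slowly_varying b l" and a: "0 < a" and p: "p > 0"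
    and lim: "(\<lambda>n. 1 / l (real n) * s (n - 1)) \<longlonglongrightarrow> a"
    and C: "\<And>n. s n ^ p * real (Suc n) \<le> C"
  shows False
proof -
  \<comment> \<open>Half of the critical exponent \<open>1 / p\<close>: then the p-th power of
    \<open>real n powr (- \<delta>)\<close> times \<open>n\<close> is \<open>sqrt (real n)\<close>,
    which is unbounded.\<close>
  define \<delta> where "\<delta> = 1 / (2 * real p)"
  have \<delta>: "\<delta> > 0" using p by (simp add: \<delta>_def)
  obtain c x0 where c: "c > 0" and x0: "\<And>x. x \<ge> x0 \<Longrightarrow> c * x powr (- \<delta>) \<le> l x"
    using slowly_varying_lower_bound[OF l \<delta>] by blast
  have ev: "\<forall>\<^sub>F n in sequentially. a / 2 < 1 / l (real n) * s (n - 1)"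
    using order_tendstoD(1)[OF lim, of "a / 2"] a by simp
  have "\<forall>\<^sub>F n in sequentially. (a / 2 * c) ^ p * sqrt (real n) \<le> C"
    using ev eventually_ge_at_top[of "nat \<lceil>x0\<rceil>"] eventually_ge_at_top[of "1::nat"]
  proof eventually_elim
    case (elim n)
    have n: "real n \<ge> x0" "real n > 0" using elim by linarith+
    have "0 < c * real n powr (- \<delta>)" using c n by simp
    then have ln: "l (real n) > 0" using x0[OF n(1)] by linarith
    have "a / 2 * (c * real n powr (- \<delta>)) \<le> a / 2 * l (real n)"
      using a by (intro mult_left_mono x0 n) auto
    also have "\<dots> \<le> s (n - 1)" using elim(1) ln by (simp add: field_simps)
    finally have "(a / 2 * (c * real n powr (- \<delta>))) ^ p \<le> s (n - 1) ^ p"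
      using a c by (intro power_mono) auto
    then have "(a / 2 * (c * real n powr (- \<delta>))) ^ p * real n \<le> s (n - 1) ^ p * real n"
      by (intro mult_right_mono) auto
    also have "\<dots> \<le> C" using C[of "n - 1"] elim(3) by simp
    also have "(a / 2 * (c * real n powr (- \<delta>))) ^ p * real n = (a / 2 * c) ^ p * ((real n powr (- \<delta>)) ^ p * real n)"
      by (simp only: power_mult_distrib mult.assoc)
    also have "(real n powr (- \<delta>)) ^ p * real n = sqrt (real n)"
    proof -
      have "(real n powr (- \<delta>)) ^ p = real n powr (- \<delta> * real p)"
        using n by (simp add: powr_realpow[symmetric] powr_powr)
      also have "- \<delta> * real p = - (1 / 2)" using p by (simp add: \<delta>_def)
      finally have "(real n powr (- \<delta>)) ^ p * real n = real n powr (- (1 / 2)) * real n powr 1"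
        using n by simp
      also have "\<dots> = real n powr (1 / 2)" by (subst powr_add[symmetric]) simp
      finally show ?thesis using n by (simp add: powr_half_sqrt)
    qed
    finally show ?case .
  qed
  moreover have "filterlim (\<lambda>n. (a / 2 * c) ^ p * sqrt (real n)) at_top sequentially"
    using a c by (intro filterlim_tendsto_pos_mult_at_top[OF tendsto_const]
        filterlim_compose[OF sqrt_at_top] filterlim_real_sequentially) auto
  then have "\<forall>\<^sub>F n in sequentially. C + 1 \<le> (a / 2 * c) ^ p * sqrt (real n)"
    by (simp add: filterlim_at_top)
  ultimately have "\<forall>\<^sub>F n in sequentially. C + 1 \<le> C" by eventually_elim linarith
  then show False by simp
qed

section \<open>The maximal operator and Volterra operators\<close>

lemma adjoint_in_add:
  assumes "complex_vector.subspace H" "(u, w) \<in> adjoint_in H T" "(u', w') \<in> adjoint_in H T"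
  shows "(u + u', w + w') \<in> adjoint_in H T"
proof -
  have "cinner g u = cinner f w" "cinner g u' = cinner f w'" if "(f, g) \<in> T" for f g
    using assms(2,3) that by (auto simp: adjoint_in_def)
  then show ?thesis
    using assms by (auto simp: adjoint_in_def cinner_add_right complex_vector.subspace_add)
qed

lemma adjoint_in_diff:
  assumes "complex_vector.subspace H" "(u, w) \<in> adjoint_in H T" "(u', w') \<in> adjoint_in H T"
  shows "(u - u', w - w') \<in> adjoint_in H T"
proof -
  have "cinner g u = cinner f w" "cinner g u' = cinner f w'" if "(f, g) \<in> T" for f g
    using assms(2,3) that by (auto simp: adjoint_in_def)
  then show ?thesis
    using assms by (auto simp: adjoint_in_def cinner_diff_right complex_vector.subspace_diff)
qed

text \<open>The adjoint of a densely defined operator is an operator; density is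
  \<open>test_functions_total\<close>, applied to the difference of two values.\<close>

lemma maximal_operator_single_valued:
  assumes "open \<Omega>" "bounded \<Omega>" and "(u, w) \<in> maximal_operator \<Omega>" "(u, w') \<in> maximal_operator \<Omega>"
  shows "w = w'"
proof -
  have d: "(0, w - w') \<in> maximal_operator \<Omega>"
    using adjoint_in_diff[OF L2_on_subspace, of u w \<Omega> _ u w'] assms(3,4)
    by (simp add: maximal_operator_def)
  have "w - w' = 0"
  proof (rule test_functions_total[OF assms(1,2)])
    show "w - w' \<in> L2_on \<Omega>" using d by (simp add: maximal_operator_def adjoint_in_def)
    fix \<phi> assume "test_function \<Omega> \<phi>"
    then have "(abs_L2 \<phi>, abs_L2 (\<lambda>x. - laplacian \<phi> x)) \<in> minimal_operator \<Omega>"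
      unfolding minimal_operator_def by (intro subsetD[OF closure_subset]) blast
    then show "cinner (abs_L2 \<phi>) (w - w') = 0"
      using d by (auto simp: maximal_operator_def adjoint_in_def)
  qed
  then show ?thesis by simp
qed

text \<open>Schatten classes grow with the exponent, since all but finitely many \<open>t n\<close>
  are below 1.\<close>

lemma summable_power_of_powr:
  fixes t :: "nat \<Rightarrow> real"
  assumes t: "t \<longlonglongrightarrow> 0" "\<And>n. 0 \<le> t n" and q: "0 < q" "q \<le> real p" and sm: "summable (\<lambda>n. t n powr q)"
  shows "summable (\<lambda>n. t n ^ p)"
proof (rule summable_comparison_test_ev[OF _ sm])
  have "\<forall>\<^sub>F n in sequentially. t n < 1" using order_tendstoD(2)[OF t(1)] by simp
  then show "\<forall>\<^sub>F n in sequentially. norm (t n ^ p) \<le> t n powr q"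
  proof eventually_elim
    case (elim n)
    have p: "p > 0" using q by (cases p) auto
    show ?case
    proof (cases "t n = 0")
      case False
      then have "t n > 0" using t(2)[of n] by simp
      then have "t n ^ p = t n powr real p" by (simp add: powr_realpow)
      also have "\<dots> \<le> t n powr q" using elim \<open>t n > 0\<close> q by (intro powr_mono') auto
      finally show ?thesis using t(2)[of n] by simp
    qed (use p in \<open>simp add: power_0_left\<close>)
  qed
qed

text \<open>Outside the spectrum \<open>T - \<mu>\<close> is injective, expressed here by its
  converse being single-valued; an eigenvector and \<open>0\<close> are both mapped to
  \<open>0\<close>.\<close>

lemma volterra_no_eigenvector:
  assumes "volterra H T" "linear_operator H T" "(f, \<mu> *\<^sub>C f) \<in> T" "\<mu> \<noteq> 0"
  shows "f = 0"
proof -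
  let ?S = "{(f, g - \<mu> *\<^sub>C f) | f g. (f, g) \<in> T}"
  have "\<mu> \<notin> spectrum_in H T" using assms(1,4) by (simp add: volterra_def)
  then have "well_defined H ?S" by (simp add: spectrum_in_def)
  then have sv: "single_valued (?S\<inverse>)"
    by (simp add: well_defined_def bounded_operator_def linear_operator_def)
  have f: "(0, f) \<in> ?S\<inverse>" using assms(3) by force
  have "(0, 0) \<in> ?S\<inverse>" using assms(2) unfolding linear_operator_def by force
  then show ?thesis using single_valuedD[OF sv f] by simp
qed

theorem theorem3p3:
  fixes \<Omega> :: "(real ^ 'm) set"
    and L K :: "(real ^ 'm) L2 rel"
    and l :: "real \<Rightarrow> real"
    and a b q :: real
  assumes "bounded_domain \<Omega>" and "smooth_boundary \<Omega>"
    and "well_defined_restriction \<Omega> L"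
    and "compact_operator (L2_on \<Omega>) (L\<inverse>)"
    and "nonneg_operator (L2_on \<Omega>) (L\<inverse>)"
    and "slowly_varying b l" and "0 < a"
    and "(\<lambda>n. 1 / l (real n) * s_number (L2_on \<Omega>) (L\<inverse>) n) \<longlonglongrightarrow> a"
    and "bounded_operator (L2_on \<Omega>) K"
    and "Range K \<subseteq> op_kernel (maximal_operator \<Omega>)"
    and "0 < q" and "K \<in> schatten_class (L2_on \<Omega>) q"
  shows "well_defined_restriction \<Omega> (perturbed_restriction \<Omega> L K) \<and>
    (perturbed_restriction \<Omega> L K)\<inverse> = op_add (L\<inverse>) K \<and>
    \<not> volterra (L2_on \<Omega>) (op_add (L\<inverse>) K) \<and>
    \<not> volterra_well_defined (L2_on \<Omega>) (perturbed_restriction \<Omega> L K)"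
proof -
  let ?H = "L2_on \<Omega>" and ?M = "maximal_operator \<Omega>" and ?LK = "perturbed_restriction \<Omega> L K"
  have \<Omega>: "open \<Omega>" "bounded \<Omega>" using assms(1) by (auto simp: bounded_domain_def)
  obtain P where "closed_csubspace ?H P"
    using ex_closed_csubspace[OF L2_on_subspace closed_L2_on[OF \<Omega>(1)]] by blast
  then interpret closed_csubspace ?H P .
  have L: "linear_operator ?H L" "bounded_operator ?H (L\<inverse>)" "L \<subseteq> ?M"
    using assms(3) by (auto simp: well_defined_restriction_def well_defined_def)
  obtain A where A: "on_H A" "L\<inverse> = graph A" using bounded_operatorE[OF L(2)] by blast
  obtain B where B: "on_H B" "K = graph B" using bounded_operatorE[OF assms(9)] by blast
  have L_iff: "(u, f) \<in> L \<longleftrightarrow> f \<in> ?H \<and> u = A f" for u f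
    using A(2) by (metis converse_iff graph_iff)
  have V: "on_H (A + B)" using A(1) B(1) by (rule on_H_add)
  have op_add: "op_add (L\<inverse>) K = graph (A + B)"
    unfolding op_add_def A(2) B(2) by (auto simp: graph_iff plus_blinfun.rep_eq)
  have sv: "w = w'" if "(u, w) \<in> ?M" "(u, w') \<in> ?M" for u w w'
    using maximal_operator_single_valued[OF \<Omega>] that by blast
  have kerB: "(B f, 0) \<in> ?M" if "f \<in> ?H" for f
    using assms(10) that B(2) graph_iff by (fastforce simp: op_kernel_def)
  have M_add: "(u + u', w + w') \<in> ?M" and M_diff: "(u - u', w - w') \<in> ?M"
    if "(u, w) \<in> ?M" "(u', w') \<in> ?M" for u u' w w'
    using that adjoint_in_add[OF L2_on_subspace] adjoint_in_diff[OF L2_on_subspace]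
    by (auto simp: maximal_operator_def)
  \<comment> \<open>Both inclusions rest on \<open>kerB\<close>: adding or subtracting
    \<open>B w\<close> leaves the value of the maximal operator unchanged. Its single-valuedness
    then identifies \<open>w'\<close> with \<open>w\<close>.\<close>
  have inv: "?LK\<inverse> = graph (A + B)"
  proof (intro set_eqI, clarify)
    fix w u
    show "(w, u) \<in> ?LK\<inverse> \<longleftrightarrow> (w, u) \<in> graph (A + B)"
    proof
      assume "(w, u) \<in> ?LK\<inverse>"
      then obtain k where uw: "(u, w) \<in> ?M" and k: "(w, k) \<in> K" and "u - k \<in> Domain L"
        by (auto simp: perturbed_restriction_def)
      then obtain w' where w': "(u - k, w') \<in> L" by blast
      have w: "w \<in> ?H" "k = B w" using k B(2) by (auto simp: graph_iff)
      have "(u - k, w - 0) \<in> ?M" using M_diff[OF uw kerB[OF w(1)]] w(2) by simp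
      then have "w' = w" using sv w' L(3) by auto
      then have "u - k = A w" using w' L_iff by simp
      then show "(w, u) \<in> graph (A + B)" using w by (simp add: graph_iff plus_blinfun.rep_eq algebra_simps)
    next
      assume "(w, u) \<in> graph (A + B)"
      then have w: "w \<in> ?H" "u = A w + B w" by (auto simp: graph_iff plus_blinfun.rep_eq)
      then have Aw: "(A w, w) \<in> L" by (simp add: L_iff)
      then have "(u, w + 0) \<in> ?M" using M_add[OF _ kerB[OF w(1)]] L(3) w(2) by blast
      moreover have "(w, B w) \<in> K" using w(1) B(2) by (simp add: graph_iff)
      moreover have "u - B w \<in> Domain L" using Aw w(2) by auto
      ultimately show "(w, u) \<in> ?LK\<inverse>" by (auto simp: perturbed_restriction_def)
    qed
  qed
  have LK_iff: "(u, w) \<in> ?LK \<longleftrightarrow> w \<in> ?H \<and> u = (A + B) w" for u w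
    using inv by (metis converse_iff graph_iff)
  have LK_M: "?LK \<subseteq> ?M" by (auto simp: perturbed_restriction_def)
  have bV: "bounded_operator ?H (graph (A + B))" by (rule bounded_operator_graph[OF V])
  have wd: "well_defined_restriction \<Omega> ?LK"
    unfolding well_defined_restriction_def well_defined_def
  proof (intro conjI LK_M)
    show "bounded_operator ?H (?LK\<inverse>)" using bV inv by simp
    have "?LK = {z. snd z \<in> ?H} \<inter> {z. fst z = (A + B) (snd z)}" using LK_iff by auto
    moreover have "closed {z :: (real ^ 'm) L2 \<times> (real ^ 'm) L2. snd z \<in> ?H}"
      using closed_vimage_snd[OF closed] by (simp add: vimage_def)
    moreover have "closed {z :: (real ^ 'm) L2 \<times> (real ^ 'm) L2. fst z = (A + B) (snd z)}"
      by (intro closed_Collect_eq continuous_intros)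
    ultimately show "closed ?LK" by auto
    show "linear_operator ?H ?LK"
      using bV sv LK_M unfolding bounded_operator_def linear_operator_def inv[symmetric]
      by (auto simp: single_valued_def)
  qed
  have "\<not> volterra ?H (graph (A + B))"
  proof
    assume volt: "volterra ?H (graph (A + B))"
    have lin: "linear_operator ?H (graph (A + B))" using bV by (simp add: bounded_operator_def)
    have no_eig: "f = 0" if f: "(A + B) f = \<mu> *\<^sub>C f" "\<mu> \<noteq> 0" for f \<mu>
    proof -
      \<comment> \<open>\<open>f\<close> is any element of the whole space; a nonzero eigenvalue
        puts it into the range of \<open>A + B\<close>, hence into \<open>?H\<close>.\<close>
      have "f = inverse \<mu> *\<^sub>C (A + B) f" using f by (simp add: scaleC_scaleC)
      then have "f \<in> ?H"
        using on_H_in[OF V, of f] complex_vector.subspace_scale[OF subspace] by metis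
      then have "(f, \<mu> *\<^sub>C f) \<in> graph (A + B)" using f by (simp add: graph_iff)
      then show ?thesis by (rule volterra_no_eigenvector[OF volt lin]) (rule f(2))
    qed
    have cA: "clin A" and cB: "clin B" using A(1) B(1) by (auto simp: on_H_def)
    have compA: "compact_blinfun A" using compact_operator_graphD[OF A(1)] assms(4) A(2) by simp
    have compB: "compact_blinfun B"
      using compact_operator_graphD[OF B(1)] assms(12) B(2) by (simp add: schatten_class_def)
    have nnA: "adj A = A" "\<And>f. 0 \<le> inner (A f) f"
      using assms(5) nonneg_operator_graph_iff[OF A(1)] A(2) by auto
    obtain e s where svdA: "svd A e s" using ex_svd[OF cA compA] by blast
    obtain e' t where svdB: "svd B e' t" using ex_svd[OF cB compB] by blast
    interpret A: svd A e s by fact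
    interpret B: svd B e' t by fact
    have sA: "s_number ?H (L\<inverse>) n = s (n - 1)" for n
      using s_number_graph[OF A(1) svdA] A(2) by simp
    have sB: "s_number ?H K n = t (n - 1)" for n
      using s_number_graph[OF B(1) svdB] B(2) by simp
    \<comment> \<open>Being non-negative, \<open>A\<close> is itself the square root of
      \<open>adj A o\<^sub>L A\<close>; its singular vectors are therefore eigenvectors.\<close>
    have Ae: "A (e n) = s n *\<^sub>R e n" for n
      using nnA by (intro A.sqrt_eigen) auto
    have lim: "(\<lambda>n. 1 / l (real n) * s (n - 1)) \<longlonglongrightarrow> a" using assms(8) by (simp add: sA)
    \<comment> \<open>A singular value zero would make all later ones zero, against the positive
      limit \<open>a\<close>.\<close>
    have s_pos: "s n > 0" for n
    proof (rule ccontr)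
      assume "\<not> s n > 0"
      then have "s m = 0" if "m \<ge> n" for m
        using A.nonneg[of m] decseqD[OF A.dec that] by simp
      then have "\<forall>\<^sub>F m in sequentially. 1 / l (real m) * s (m - 1) = 0"
        by (intro eventually_sequentiallyI[of "Suc n"]) simp
      then have "(\<lambda>n. 1 / l (real n) * s (n - 1)) \<longlonglongrightarrow> 0" by (rule tendsto_eventually)
      then show False using LIMSEQ_unique[OF lim] assms(7) by simp
    qed
    \<comment> \<open>Large enough for \<open>q \<le> 2 ^ Suc k\<close>, so that \<open>K\<close>
      belongs to the class of that power of two.\<close>
    define k where "k = nat \<lceil>q\<rceil>"
    have "q \<le> real k" unfolding k_def by (rule real_nat_ceiling_ge)
    also have "real k \<le> 2 ^ k" by (rule less_imp_le) (rule of_nat_less_two_power)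
    also have "(2::real) ^ k \<le> 2 ^ Suc k" by simp
    finally have q: "q \<le> real (2 ^ Suc k)" by simp
    have "summable (\<lambda>n. t n powr q)" using assms(12) by (simp add: schatten_class_def sB)
    then have t: "summable (\<lambda>n. t n ^ (2 ^ Suc k))"
      by (rule summable_power_of_powr[OF B.lim B.nonneg assms(11) q])
    \<comment> \<open>As the inverse of the operator \<open>L\<close>, \<open>A\<close> is injective
      on \<open>?H\<close>; its kernel in the whole space is therefore orthogonal to
      \<open>?H\<close>, where \<open>B\<close> takes its values.\<close>
    have ran: "cinner (B f) h = 0" if "A h = 0" for f h
    proof -
      have "(0, P h) \<in> L" using that on_H_P[OF A(1), of h] P_in by (simp add: L_iff)
      moreover have "(0, 0) \<in> L" "single_valued L" using L(1) by (auto simp: linear_operator_def)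
      ultimately have "P h = 0" by (auto simp: single_valued_def)
      moreover have "cinner (B f) h = cinner (P (B f)) h" using on_H_in[OF B(1)] by (simp add: P_fix)
      ultimately show ?thesis using cinner_adj[OF clin_P, of "B f" h] by (simp add: adj_P)
    qed
    have "\<exists>C. \<forall>n. s n ^ (2 ^ Suc k) * real (Suc n) \<le> C"
    proof (rule A.s_number_decay[OF nnA(1) compA Ae s_pos svdB compB t])
      show "f = 0" if "(A + B) f = \<mu> *\<^sub>C f" "\<mu> \<noteq> 0" for f \<mu>
        using that by (rule no_eig)
      show "cinner (B f) h = 0" if "A h = 0" for f h
        using that by (rule ran)
    qed
    then obtain C where C: "\<And>n. s n ^ (2 ^ Suc k) * real (Suc n) \<le> C" by blast
    show False
      by (rule slowly_varying_not_power_bounded[OF assms(6,7) _ lim C]) simp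
  qed
  then show ?thesis
    using wd inv op_add by (auto simp: volterra_well_defined_def)
qed

end
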